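(* Let $G$ be a topological group and let $X$ be a compact $G$-system with its unique compatible uniform structure $\mu$. The following conditions are equivalent: (1) $X$ is $\mathrm{RN}_{app}$. (2) $X$ is hereditarily not sensitive (HNS). (3) The map $\pi_{\sharp}: X \to C(G,X)$, $\pi_{\sharp}(x)(g)=gx$, is a fragmented map. (4) $\breve{G}=\{\breve{g}: X \to X\}_{g\in G}$ is a fragmented family. (5) $(X,\mu_H)$ is uniformly Lindelöf for every countable (equivalently, for every uniformly Lindelöf) subgroup $H<G$.
   Context: A compact $G$-system is a compact Hausdorff space $X$ with a (jointly) continuous left action $G\times X\to X$ of the topological group $G$; $\breve g:X\to X$, $x\mapsto gx$, is the homeomorphism given by $g\in G$. RN and $\mathrm{RN}_{app}$: a Banach space $V$ is Asplund if every separable Banach subspace of $V$ has separable dual. $\mathrm{Iso}(V)$ is the group of linear isometries of $V$ onto itself. $X$ is Radon-Nikodým (RN) if there exist an Asplund space $V$, a strongly continuous co-homomorphism $h:G\to \mathrm{Iso}(V)$ (i.e. $h(gg')=h(g')h(g)$, and $g\mapsto h(g)v$ is norm continuous for each $v\in V$), and a bounded topological embedding $\alpha:X\to(V^*,\text{weak}^* )$ with $\alpha(gx)=g\alpha(x)$, where $(g\varphi)(v)=\varphi(h(g)(v))$. $X$ is $\mathrm{RN}_{app}$ if it is isomorphic to a $G$-subsystem of a product of RN $G$-systems. HNS: a uniform $G$-space $(Y,\mu)$ is not sensitive (NS) if for every $\varepsilon\in\mu$ there is a nonempty open $O\subset Y$ such that $(gx,gy)\in\varepsilon$ for all $x,y\in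 O$, $g\in G$. $X$ is HNS if every nonempty closed $G$-invariant subspace is NS. Fragmentability: a subset $B$ of a uniform space is $\varepsilon$-small if $B\times B\subset\varepsilon$. A (not necessarily continuous) map $f$ from a topological space $X$ to a uniform space $(Y,\nu)$ is fragmented if for every nonempty $A\subset X$ and $\varepsilon\in\nu$ there is an open $O\subset X$ with $O\cap A\neq\emptyset$ and $f(O\cap A)$ $\varepsilon$-small. A family $\mathcal F$ of maps $X\to Y$ is fragmented if, for every such $A,\varepsilon$, one such $O$ can be chosen for which $f(O\cap A)$ is $\varepsilon$-small simultaneously for all $f\in\mathcal F$. Here $X$ as a target of maps carries $\mu$. $C(G,X)$ is the set of continuous maps $G\to X$ with the uniform structure of uniform convergence, with basis the sets $\{(f,f'):(f(g),f'(g))\in\varepsilon\ \forall g\in G\}$, $\varepsilon\in\mu$. For a subgroup $H<G$, $\mu_H$ is the uniform structure on the set $X$ with basis $[\varepsilon]_H=\{(x,y):(hx,hy)\in\varepsilon\ \forall h\in H\}$, $\varepsilon\in\mu$. A uniform space $(Y,\nu)$ is uniformly Lindelöf if for every $\varepsilon\in\nu$ the cover $\{\varepsilon(y):y\in Y\}$, $\varepsilon(y)=\{z:(y,z)\in\varepsilon\}$, has a countable subcover. A topological group $H$ is uniformly Lindelöf if for every neighborhood $U$ of the identity there is a countable $C\subset H$ with $H=CU$ (equivalently, $H$ is uniformly Lindelöf in its right, or left, uniform structure). *)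

theory Defs
  imports "HOL-Analysis.Analysis" "HOL-Algebra.Group_Action" "HOL-Algebra.Module"
begin

section \<open>Topological groups and compact systems\<close>

text \<open>A structured object is given by an explicit carrier: a group \<open>G\<close> in the sense of HOL-Algebra
  with a topology \<open>T\<close> on its carrier, a space \<open>X\<close> as an abstract topology. No separation axiom
  is imposed on \<open>G\<close>.\<close>

definition topological_group :: "('g, 'b) monoid_scheme \<Rightarrow> 'g topology \<Rightarrow> bool" where
  "topological_group G T \<longleftrightarrow>
     group G \<and> topspace T = carrier G \<and>
     continuous_map (prod_topology T T) T (\<lambda>(g, h). g \<otimes>\<^bsub>G\<^esub> h) \<and>
     continuous_map T T (\<lambda>g. inv\<^bsub>G\<^esub> g)"

text \<open>\<open>act g\<close> is the homeomorphism of \<open>X\<close> given by \<open>g\<close>. As usual for \<open>group_action\<close> it has the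
  dummy value \<open>undefined\<close> outside \<open>topspace X\<close>.\<close>

definition compact_G_system ::
    "('g, 'b) monoid_scheme \<Rightarrow> 'g topology \<Rightarrow> 'x topology \<Rightarrow> ('g \<Rightarrow> 'x \<Rightarrow> 'x) \<Rightarrow> bool" where
  "compact_G_system G T X act \<longleftrightarrow>
     compact_space X \<and> Hausdorff_space X \<and>
     group_action G (topspace X) act \<and>
     continuous_map (prod_topology T X) X (\<lambda>(g, x). act g x)"

definition invariant :: "('g, 'b) monoid_scheme \<Rightarrow> ('g \<Rightarrow> 'x \<Rightarrow> 'x) \<Rightarrow> 'x set \<Rightarrow> bool" where
  "invariant G act S \<longleftrightarrow> (\<forall>g\<in>carrier G. \<forall>x\<in>S. act g x \<in> S)"

definition G_subsystem ::
    "('g, 'b) monoid_scheme \<Rightarrow> 'x topology \<Rightarrow> ('g \<Rightarrow> 'x \<Rightarrow> 'x) \<Rightarrow> 'x set \<Rightarrow> bool" where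
  "G_subsystem G X act S \<longleftrightarrow> closedin X S \<and> invariant G act S"

definition G_isomorphic ::
    "('g, 'b) monoid_scheme \<Rightarrow> 'x topology \<Rightarrow> ('g \<Rightarrow> 'x \<Rightarrow> 'x) \<Rightarrow>
     'y topology \<Rightarrow> ('g \<Rightarrow> 'y \<Rightarrow> 'y) \<Rightarrow> bool" where
  "G_isomorphic G X actX Y actY \<longleftrightarrow>
     (\<exists>f. homeomorphic_map X Y f \<and>
          (\<forall>g\<in>carrier G. \<forall>x\<in>topspace X. f (actX g x) = actY g (f x)))"

definition product_action ::
    "'i set \<Rightarrow> ('i \<Rightarrow> 'g \<Rightarrow> 'y \<Rightarrow> 'y) \<Rightarrow> 'g \<Rightarrow> ('i \<Rightarrow> 'y) \<Rightarrow> ('i \<Rightarrow> 'y)" where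
  "product_action I acts g x = (\<lambda>i\<in>I. acts i g (x i))"


section \<open>Uniform structures\<close>

definition uniform_structure :: "'a set \<Rightarrow> ('a \<times> 'a) set set \<Rightarrow> bool" where
  "uniform_structure Y \<nu> \<longleftrightarrow>
     \<nu> \<noteq> {} \<and>
     (\<forall>e\<in>\<nu>. Id_on Y \<subseteq> e \<and> e \<subseteq> Y \<times> Y) \<and>
     (\<forall>e\<in>\<nu>. \<forall>d. e \<subseteq> d \<and> d \<subseteq> Y \<times> Y \<longrightarrow> d \<in> \<nu>) \<and>
     (\<forall>e\<in>\<nu>. \<forall>d\<in>\<nu>. e \<inter> d \<in> \<nu>) \<and>
     (\<forall>e\<in>\<nu>. e\<inverse> \<in> \<nu>) \<and>
     (\<forall>e\<in>\<nu>. \<exists>d\<in>\<nu>. d O d \<subseteq> e)"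

definition uniform_openin :: "'a set \<Rightarrow> ('a \<times> 'a) set set \<Rightarrow> 'a set \<Rightarrow> bool" where
  "uniform_openin Y \<nu> S \<longleftrightarrow> S \<subseteq> Y \<and> (\<forall>y\<in>S. \<exists>e\<in>\<nu>. e `` {y} \<subseteq> S)"

definition compatible_uniformity :: "'a topology \<Rightarrow> ('a \<times> 'a) set set \<Rightarrow> bool" where
  "compatible_uniformity X \<mu> \<longleftrightarrow>
     uniform_structure (topspace X) \<mu> \<and> openin X = uniform_openin (topspace X) \<mu>"

definition uniformity_with_basis :: "'a set \<Rightarrow> ('a \<times> 'a) set set \<Rightarrow> ('a \<times> 'a) set set" where
  "uniformity_with_basis Y B = {e. e \<subseteq> Y \<times> Y \<and> (\<exists>b\<in>B. b \<subseteq> e)}"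

definition subspace_uniformity :: "('a \<times> 'a) set set \<Rightarrow> 'a set \<Rightarrow> ('a \<times> 'a) set set" where
  "subspace_uniformity \<mu> Y = (\<lambda>e. e \<inter> Y \<times> Y) ` \<mu>"

definition small :: "('a \<times> 'a) set \<Rightarrow> 'a set \<Rightarrow> bool" where
  "small e B \<longleftrightarrow> B \<times> B \<subseteq> e"

definition fragmented_map ::
    "'x topology \<Rightarrow> ('y \<times> 'y) set set \<Rightarrow> ('x \<Rightarrow> 'y) \<Rightarrow> bool" where
  "fragmented_map X \<nu> f \<longleftrightarrow>
     (\<forall>A e. A \<noteq> {} \<and> A \<subseteq> topspace X \<and> e \<in> \<nu> \<longrightarrow>
        (\<exists>S. openin X S \<and> S \<inter> A \<noteq> {} \<and> small e (f ` (S \<inter> A))))"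

definition fragmented_family ::
    "'x topology \<Rightarrow> ('y \<times> 'y) set set \<Rightarrow> ('x \<Rightarrow> 'y) set \<Rightarrow> bool" where
  "fragmented_family X \<nu> F \<longleftrightarrow>
     (\<forall>A e. A \<noteq> {} \<and> A \<subseteq> topspace X \<and> e \<in> \<nu> \<longrightarrow>
        (\<exists>S. openin X S \<and> S \<inter> A \<noteq> {} \<and> (\<forall>f\<in>F. small e (f ` (S \<inter> A)))))"

definition uniformly_Lindelof :: "'a set \<Rightarrow> ('a \<times> 'a) set set \<Rightarrow> bool" where
  "uniformly_Lindelof Y \<nu> \<longleftrightarrow>
     (\<forall>e\<in>\<nu>. \<exists>C. countable C \<and> C \<subseteq> Y \<and> Y \<subseteq> (\<Union>y\<in>C. e `` {y}))"

definition uniformly_Lindelof_group :: "('g, 'b) monoid_scheme \<Rightarrow> 'g topology \<Rightarrow> bool" where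
  "uniformly_Lindelof_group H T \<longleftrightarrow>
     (\<forall>U. U \<subseteq> carrier H \<and> (\<exists>W. openin T W \<and> \<one>\<^bsub>H\<^esub> \<in> W \<and> W \<subseteq> U) \<longrightarrow>
        (\<exists>C. countable C \<and> C \<subseteq> carrier H \<and> carrier H = C <#>\<^bsub>H\<^esub> U))"


section \<open>Uniformities and sensitivity of a system\<close>

definition not_sensitive ::
    "('g, 'b) monoid_scheme \<Rightarrow> 'y set \<Rightarrow> ('y \<times> 'y) set set \<Rightarrow> ('g \<Rightarrow> 'y \<Rightarrow> 'y) \<Rightarrow> bool" where
  "not_sensitive G Y \<nu> act \<longleftrightarrow>
     (\<forall>e\<in>\<nu>. \<exists>S. uniform_openin Y \<nu> S \<and> S \<noteq> {} \<and>
        (\<forall>x\<in>S. \<forall>y\<in>S. \<forall>g\<in>carrier G. (act g x, act g y) \<in> e))"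

definition HNS ::
    "('g, 'b) monoid_scheme \<Rightarrow> 'x topology \<Rightarrow> ('x \<times> 'x) set set \<Rightarrow> ('g \<Rightarrow> 'x \<Rightarrow> 'x) \<Rightarrow> bool" where
  "HNS G X \<mu> act \<longleftrightarrow>
     (\<forall>Y. Y \<noteq> {} \<and> closedin X Y \<and> invariant G act Y \<longrightarrow>
        not_sensitive G Y (subspace_uniformity \<mu> Y) act)"

text \<open>\<open>C(G,X)\<close>; its elements are extensional on the carrier of \<open>G\<close>.\<close>

definition cont_maps ::
    "('g, 'b) monoid_scheme \<Rightarrow> 'g topology \<Rightarrow> 'x topology \<Rightarrow> ('g \<Rightarrow> 'x) set" where
  "cont_maps G T X = {f \<in> extensional (carrier G). continuous_map T X f}"

definition uniform_convergence ::
    "('g, 'b) monoid_scheme \<Rightarrow> 'g topology \<Rightarrow> 'x topology \<Rightarrow> ('x \<times> 'x) set set \<Rightarrow>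
     (('g \<Rightarrow> 'x) \<times> ('g \<Rightarrow> 'x)) set set" where
  "uniform_convergence G T X \<mu> =
     uniformity_with_basis (cont_maps G T X)
       ((\<lambda>e. {(f, f') \<in> cont_maps G T X \<times> cont_maps G T X.
                \<forall>g\<in>carrier G. (f g, f' g) \<in> e}) ` \<mu>)"

definition pi_sharp :: "('g, 'b) monoid_scheme \<Rightarrow> ('g \<Rightarrow> 'x \<Rightarrow> 'x) \<Rightarrow> 'x \<Rightarrow> 'g \<Rightarrow> 'x" where
  "pi_sharp G act x = (\<lambda>g\<in>carrier G. act g x)"

definition subgroup_uniformity ::
    "'x topology \<Rightarrow> ('x \<times> 'x) set set \<Rightarrow> ('g \<Rightarrow> 'x \<Rightarrow> 'x) \<Rightarrow> 'g set \<Rightarrow> ('x \<times> 'x) set set" where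
  "subgroup_uniformity X \<mu> act H =
     uniformity_with_basis (topspace X)
       ((\<lambda>e. {(x, y) \<in> topspace X \<times> topspace X. \<forall>h\<in>H. (act h x, act h y) \<in> e}) ` \<mu>)"


section \<open>Real Banach spaces on a carrier, duals, Asplund spaces\<close>

definition real_ring :: "real ring" where
  "real_ring = \<lparr>carrier = UNIV, mult = (*), one = 1, zero = 0, add = (+)\<rparr>"

text \<open>The Banach space in the definition of Radon-Nikodym systems is existentially quantified, so
  it cannot be a type. The fields \<open>mult\<close> and \<open>one\<close> that a module record inherits from
  \<open>ring\<close> carry no meaning.\<close>

record 'v normed = "(real, 'v) module" +
  nrm :: "'v \<Rightarrow> real"

definition normed_space :: "'v normed \<Rightarrow> bool" where
  "normed_space V \<longleftrightarrow>
     Module.module real_ring V \<and>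
     (\<forall>v\<in>carrier V. nrm V v = 0 \<longleftrightarrow> v = \<zero>\<^bsub>V\<^esub>) \<and>
     (\<forall>c. \<forall>v\<in>carrier V. nrm V (c \<odot>\<^bsub>V\<^esub> v) = \<bar>c\<bar> * nrm V v) \<and>
     (\<forall>v\<in>carrier V. \<forall>w\<in>carrier V. nrm V (v \<oplus>\<^bsub>V\<^esub> w) \<le> nrm V v + nrm V w)"

text \<open>\<open>Metric_space\<close> requires nonnegativity and symmetry on the whole type, hence the value \<open>0\<close>
  off the carrier; the same holds for \<open>dual_dist\<close> below.\<close>

definition norm_dist :: "'v normed \<Rightarrow> 'v \<Rightarrow> 'v \<Rightarrow> real" where
  "norm_dist V v w = (if v \<in> carrier V \<and> w \<in> carrier V then nrm V (v \<ominus>\<^bsub>V\<^esub> w) else 0)"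

definition norm_topology :: "'v normed \<Rightarrow> 'v topology" where
  "norm_topology V = Metric_space.mtopology (carrier V) (norm_dist V)"

definition banach_space :: "'v normed \<Rightarrow> bool" where
  "banach_space V \<longleftrightarrow>
     normed_space V \<and> Metric_space.mcomplete (carrier V) (norm_dist V)"

definition dual :: "'v normed \<Rightarrow> ('v \<Rightarrow> real) set" where
  "dual V = {\<phi> \<in> extensional (carrier V).
     (\<forall>v\<in>carrier V. \<forall>w\<in>carrier V. \<phi> (v \<oplus>\<^bsub>V\<^esub> w) = \<phi> v + \<phi> w) \<and>
     (\<forall>c. \<forall>v\<in>carrier V. \<phi> (c \<odot>\<^bsub>V\<^esub> v) = c * \<phi> v) \<and>
     (\<exists>K. \<forall>v\<in>carrier V. \<bar>\<phi> v\<bar> \<le> K * nrm V v)}"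

definition dual_norm :: "'v normed \<Rightarrow> ('v \<Rightarrow> real) \<Rightarrow> real" where
  "dual_norm V \<phi> = (SUP v\<in>{v \<in> carrier V. nrm V v \<le> 1}. \<bar>\<phi> v\<bar>)"

definition dual_dist :: "'v normed \<Rightarrow> ('v \<Rightarrow> real) \<Rightarrow> ('v \<Rightarrow> real) \<Rightarrow> real" where
  "dual_dist V \<phi> \<psi> =
     (if \<phi> \<in> dual V \<and> \<psi> \<in> dual V then dual_norm V (\<lambda>v. \<phi> v - \<psi> v) else 0)"

definition dual_norm_topology :: "'v normed \<Rightarrow> ('v \<Rightarrow> real) topology" where
  "dual_norm_topology V = Metric_space.mtopology (dual V) (dual_dist V)"

definition weak_star_topology :: "'v normed \<Rightarrow> ('v \<Rightarrow> real) topology" where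
  "weak_star_topology V = subtopology (product_topology (\<lambda>_. euclideanreal) (carrier V)) (dual V)"

definition asplund_space :: "'v normed \<Rightarrow> bool" where
  "asplund_space V \<longleftrightarrow>
     banach_space V \<and>
     (\<forall>W. submodule W real_ring V \<and> closedin (norm_topology V) W \<and>
          separable_space (norm_topology (V\<lparr>carrier := W\<rparr>)) \<longrightarrow>
          separable_space (dual_norm_topology (V\<lparr>carrier := W\<rparr>)))"

definition linear_isometries :: "'v normed \<Rightarrow> ('v \<Rightarrow> 'v) set" where
  "linear_isometries V = {L.
     bij_betw L (carrier V) (carrier V) \<and>
     (\<forall>v\<in>carrier V. \<forall>w\<in>carrier V. L (v \<oplus>\<^bsub>V\<^esub> w) = L v \<oplus>\<^bsub>V\<^esub> L w) \<and>
     (\<forall>c. \<forall>v\<in>carrier V. L (c \<odot>\<^bsub>V\<^esub> v) = c \<odot>\<^bsub>V\<^esub> L v) \<and>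
     (\<forall>v\<in>carrier V. nrm V (L v) = nrm V v)}"

definition cont_cohom ::
    "('g, 'b) monoid_scheme \<Rightarrow> 'g topology \<Rightarrow> 'v normed \<Rightarrow> ('g \<Rightarrow> 'v \<Rightarrow> 'v) \<Rightarrow> bool" where
  "cont_cohom G T V h \<longleftrightarrow>
     (\<forall>g\<in>carrier G. h g \<in> linear_isometries V) \<and>
     (\<forall>g\<in>carrier G. \<forall>g'\<in>carrier G. \<forall>v\<in>carrier V. h (g \<otimes>\<^bsub>G\<^esub> g') v = h g' (h g v)) \<and>
     (\<forall>v\<in>carrier V. continuous_map T (norm_topology V) (\<lambda>g. h g v))"


section \<open>Radon-Nikodym systems\<close>

text \<open>HOL cannot quantify existentially over types. The type argument \<open>'u\<close> is the universe from
  which the carriers of the Banach spaces, of the factors of a product, and the index set of the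
  product are taken. The universe stays a type variable in the theorem, so that Banach spaces and
  families of any cardinality are covered; the only demand on it is an injection of
  \<open>'x \<Rightarrow> real\<close> into \<open>'u\<close>, where \<open>'x\<close> is the point type of the system. This makes room for
  an index set \<open>C(X)\<close>, for quotients of \<open>X\<close> and for the spaces \<open>V / K\<close>, where
  \<open>K\<close> consists of the vectors on which all of \<open>\<alpha>(X)\<close> vanishes: these embed linearly
  in \<open>C(X)\<close>, so replacing \<open>V\<close> by \<open>V / K\<close> shows that no representation is lost.\<close>

definition RN ::
    "'u itself \<Rightarrow> ('g, 'b) monoid_scheme \<Rightarrow> 'g topology \<Rightarrow> 'x topology \<Rightarrow> ('g \<Rightarrow> 'x \<Rightarrow> 'x) \<Rightarrow> bool"
  where
  "RN universe G T X act \<longleftrightarrow>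
     compact_G_system G T X act \<and>
     (\<exists>(V :: 'u normed) h \<alpha>.
        asplund_space V \<and> cont_cohom G T V h \<and>
        embedding_map X (weak_star_topology V) \<alpha> \<and>
        (\<exists>K. \<forall>x\<in>topspace X. dual_norm V (\<alpha> x) \<le> K) \<and>
        (\<forall>g\<in>carrier G. \<forall>x\<in>topspace X. \<forall>v\<in>carrier V. \<alpha> (act g x) v = \<alpha> x (h g v)))"

definition RN_app ::
    "'u itself \<Rightarrow> ('g, 'b) monoid_scheme \<Rightarrow> 'g topology \<Rightarrow> 'x topology \<Rightarrow> ('g \<Rightarrow> 'x \<Rightarrow> 'x) \<Rightarrow> bool"
  where
  "RN_app universe G T X act \<longleftrightarrow>
     compact_G_system G T X act \<and>
     (\<exists>(I :: 'u set) (Xs :: 'u \<Rightarrow> 'u topology) acts S.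
        (\<forall>i\<in>I. RN universe G T (Xs i) (acts i)) \<and>
        G_subsystem G (product_topology Xs I) (product_action I acts) S \<and>
        G_isomorphic G X act (subtopology (product_topology Xs I) S) (product_action I acts))"

end

theory Submission
  imports Defs "HOL-Probability.Discrete_Topology" "HOL-Algebra.Generated_Groups"
begin

text \<open>Everything is compared with the Lindelof property (5) for countable subgroups. If \<open>X\<close> is not
  fragmented by \<open>G\<close>, a Cantor tree of open sets produces countably many group elements that separate
  uncountably many points uniformly. Conversely, for countable \<open>H\<close> the \<open>H\<close>-translates of finitely
  many continuous functions map \<open>X\<close> onto a second countable space; fragmentation passes to it and a
  Cantor-Bendixson argument covers it by countably many small sets.

  If \<open>X\<close> is represented on an Asplund space, the \<open>H\<close>-orbit of a vector spans a separable subspace;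
  its dual is separable, which gives (5) coordinatewise. For the converse let \<open>f\<close> be continuous on
  \<open>X\<close> and \<open>W\<close> the absolutely convex hull of its \<open>G\<close>-translates. On the vectors whose interpolation
  functionals between \<open>W\<close> and the sup norm tend to zero, \<open>G\<close> acts by isometries. A functional on a
  separable subspace is bounded by a small multiple of the norm plus a multiple of the sup norm
  (gliding hump), hence, by a convex combination argument on \<open>X\<close>, by a small multiple of the norm
  plus finitely many point evaluations, and these may be taken from the countably many centres that
  (5) supplies. So the space is Asplund, and the factors of \<open>X\<close> obtained in this way separate its
  points.\<close>

section \<open>Uniformities and fragmentability\<close>

text \<open>Condition (5) is a natural hub because both ends of the argument live on separable
  pieces: the Asplund property is tested on separable subspaces, and a countable subgroup moves one
  vector or function around inside such a piece. The obstacle is that \<open>X\<close> carries no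
  metric. Sequences in \<open>X\<close> need not have convergent subsequences, and open sets have no
  countable base, so every countable extraction must come from countably many real functions.
  Vectors are therefore taken as bounded functions on the points of \<open>X\<close>, a space that
  also contains the indicators of points, and functionals are produced by Hahn-Banach from sublinear
  functions built as infima. Letting the interpolation functionals tend to zero, a condition of type
  c_0, leaves only finitely many levels \<open>n\<close> to be controlled by the sup norm. This
  drives the gliding hump and the strong continuity of the action, and it also shows that every
  vector is a uniform limit of multiples of elements of \<open>W\<close>, hence a continuous
  function.\<close>

lemma uniform_structure_half:
  assumes "uniform_structure Y \<nu>" "e \<in> \<nu>"
  obtains d where "d \<in> \<nu>" "sym d" "d O d \<subseteq> e"
proof -
  obtain d where d: "d \<in> \<nu>" "d O d \<subseteq> e"
    using assms unfolding uniform_structure_def by meson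
  have "d \<inter> d\<inverse> \<in> \<nu>" using d assms unfolding uniform_structure_def by meson
  moreover have "sym (d \<inter> d\<inverse>)" by (auto simp: sym_def)
  moreover have "(d \<inter> d\<inverse>) O (d \<inter> d\<inverse>) \<subseteq> e" using d by blast
  ultimately show ?thesis using that by blast
qed

lemma uniform_structure_refl: "uniform_structure Y \<nu> \<Longrightarrow> e \<in> \<nu> \<Longrightarrow> y \<in> Y \<Longrightarrow> (y, y) \<in> e"
  unfolding uniform_structure_def by (meson Id_onI subsetD)

lemma uniform_structure_subset: "uniform_structure Y \<nu> \<Longrightarrow> e \<in> \<nu> \<Longrightarrow> e \<subseteq> Y \<times> Y"
  unfolding uniform_structure_def by meson

lemma uniform_structure_mono:
  "uniform_structure Y \<nu> \<Longrightarrow> e \<in> \<nu> \<Longrightarrow> e \<subseteq> d \<Longrightarrow> d \<subseteq> Y \<times> Y \<Longrightarrow> d \<in> \<nu>"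
  unfolding uniform_structure_def by meson

lemma uniform_structure_Int:
  "uniform_structure Y \<nu> \<Longrightarrow> e \<in> \<nu> \<Longrightarrow> d \<in> \<nu> \<Longrightarrow> e \<inter> d \<in> \<nu>"
  unfolding uniform_structure_def by meson

lemma uniform_structure_INT:
  assumes "uniform_structure Y \<nu>" "finite F" "F \<noteq> {}" "\<And>i. i \<in> F \<Longrightarrow> d i \<in> \<nu>"
  shows "(\<Inter>i\<in>F. d i) \<in> \<nu>"
  using assms(2-4)
  by (induction rule: finite_ne_induct) (simp_all add: uniform_structure_Int[OF assms(1)])

lemma uniform_structure_third:
  assumes "uniform_structure Y \<nu>" "e \<in> \<nu>"
  obtains d where "d \<in> \<nu>" "sym d" "d O d \<subseteq> e" "d O d O d \<subseteq> e"
proof -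
  obtain d where d: "d \<in> \<nu>" "sym d" "d O d \<subseteq> e"
    using uniform_structure_half[OF assms] by blast
  obtain d' where d': "d' \<in> \<nu>" "sym d'" "d' O d' \<subseteq> d"
    using uniform_structure_half[OF assms(1) d(1)] by blast
  have sub: "d' \<subseteq> d"
    using d' uniform_structure_refl[OF assms(1) d'(1)] uniform_structure_subset[OF assms(1) d'(1)]
    by fastforce
  show ?thesis
  proof
    show "d' O d' O d' \<subseteq> e" "d' O d' \<subseteq> e" using d d' sub by blast+
  qed (use d' in auto)
qed

text \<open>A section of an entourage need not be open. Its uniform interior is open, because
  halving an entourage leaves room around each interior point.\<close>

lemma compatible_uniformity_nbhd:
  assumes "compatible_uniformity X \<mu>" "e \<in> \<mu>" "x \<in> topspace X"
  obtains U where "openin X U" "x \<in> U" "U \<subseteq> e `` {x}"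
proof -
  have us: "uniform_structure (topspace X) \<mu>" and op: "openin X = uniform_openin (topspace X) \<mu>"
    using assms by (auto simp: compatible_uniformity_def)
  define U where "U = {y \<in> topspace X. \<exists>d\<in>\<mu>. d `` {y} \<subseteq> e `` {x}}"
  have "uniform_openin (topspace X) \<mu> U"
    unfolding uniform_openin_def
  proof (intro conjI ballI)
    fix y assume "y \<in> U"
    then obtain d where d: "y \<in> topspace X" "d \<in> \<mu>" "d `` {y} \<subseteq> e `` {x}" by (auto simp: U_def)
    obtain d' where d': "d' \<in> \<mu>" "sym d'" "d' O d' \<subseteq> d"
      using uniform_structure_half[OF us d(2)] by blast
    have "d' `` {y} \<subseteq> U"
      using d d' uniform_structure_subset[OF us d'(1)] unfolding U_def by blast
    then show "\<exists>e\<in>\<mu>. e `` {y} \<subseteq> U" using d' by blast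
  qed (auto simp: U_def)
  moreover have "U \<subseteq> e `` {x}"
    unfolding U_def using uniform_structure_refl[OF us] by fastforce
  ultimately show ?thesis using that[of U] op assms by (auto simp: U_def)
qed

text \<open>The predicate \<open>P\<close> carries local data along, so that a finite subcover comes
  with finitely many choices of data, one for each member.\<close>

lemma compact_space_finite_subcover:
  assumes "compact_space X" "\<And>x. x \<in> topspace X \<Longrightarrow> \<exists>U. openin X U \<and> x \<in> U \<and> P x U"
  obtains F U where "finite F" "F \<subseteq> topspace X" "topspace X = (\<Union>x\<in>F. U x)"
    "\<And>x. x \<in> F \<Longrightarrow> openin X (U x)" "\<And>x. x \<in> F \<Longrightarrow> x \<in> U x" "\<And>x. x \<in> F \<Longrightarrow> P x (U x)"
proof -
  obtain U where U: "\<And>x. x \<in> topspace X \<Longrightarrow> openin X (U x) \<and> x \<in> U x \<and> P x (U x)"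
    using assms(2) by metis
  have "(\<forall>V\<in>U ` topspace X. openin X V) \<and> \<Union> (U ` topspace X) = topspace X"
    using U openin_subset by fastforce
  then obtain \<F> where "finite \<F>" "\<F> \<subseteq> U ` topspace X" "\<Union>\<F> = topspace X"
    using assms(1) unfolding compact_space by meson
  then obtain F where F: "finite F" "F \<subseteq> topspace X" "\<F> = U ` F"
    by (meson finite_subset_image)
  show ?thesis
  proof
    show "topspace X = (\<Union>x\<in>F. U x)" using F \<open>\<Union>\<F> = topspace X\<close> by auto
  qed (use F U in \<open>auto simp: subset_iff\<close>)
qed

section \<open>Compact systems, and the equivalences that rest on definitions and orbit
  closures\<close>

locale compact_system =
  fixes G :: "('g, 'b) monoid_scheme" and T :: "'g topology"
    and X :: "'x topology" and act :: "'g \<Rightarrow> 'x \<Rightarrow> 'x" and \<mu> :: "('x \<times> 'x) set set"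
  assumes top_group: "topological_group G T"
    and system: "compact_G_system G T X act"
    and compat: "compatible_uniformity X \<mu>"
begin

lemma uniform: "uniform_structure (topspace X) \<mu>"
  using compat by (simp add: compatible_uniformity_def)

lemma openin_iff: "openin X = uniform_openin (topspace X) \<mu>"
  using compat by (simp add: compatible_uniformity_def)

lemma compact: "compact_space X" and Hausdorff: "Hausdorff_space X"
  and act_cont: "continuous_map (prod_topology T X) X (\<lambda>(g, x). act g x)"
  using system by (auto simp: compact_G_system_def)

lemma regular: "regular_space X"
  by (simp add: compact Hausdorff compact_Hausdorff_or_regular_imp_normal_space
      normal_t1_eq_Hausdorff_space compact_Hausdorff_imp_regular_space)

lemma group: "group G"
  using top_group by (simp add: topological_group_def)

lemmas G_closed [simp] = group.is_monoid[OF group, THEN monoid.one_closed]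
  group.is_monoid[OF group, THEN monoid.m_closed] group.inv_closed[OF group]

lemma topspace_T [simp]: "topspace T = carrier G"
  using top_group by (simp add: topological_group_def)

sublocale A: group_action G "topspace X" act
  using system by (simp add: compact_G_system_def)

lemma act_in [simp]: "g \<in> carrier G \<Longrightarrow> x \<in> topspace X \<Longrightarrow> act g x \<in> topspace X"
  using A.element_image by blast

lemma act_one [simp]: "x \<in> topspace X \<Longrightarrow> act \<one>\<^bsub>G\<^esub> x = x"
  by (metis A.id_eq_one restrict_apply')

lemma act_mult:
  "g \<in> carrier G \<Longrightarrow> h \<in> carrier G \<Longrightarrow> x \<in> topspace X \<Longrightarrow> act (g \<otimes>\<^bsub>G\<^esub> h) x = act g (act h x)"
  using A.composition_rule by blast

lemma act_inv [simp]:
  "g \<in> carrier G \<Longrightarrow> x \<in> topspace X \<Longrightarrow> act (inv\<^bsub>G\<^esub> g) (act g x) = x"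
  by (metis G_closed(3) group.l_inv[OF group] act_mult act_one)

lemma act_inv' [simp]:
  "g \<in> carrier G \<Longrightarrow> x \<in> topspace X \<Longrightarrow> act g (act (inv\<^bsub>G\<^esub> g) x) = x"
  by (metis G_closed(3) group.r_inv[OF group] act_mult act_one)

lemma continuous_act:
  assumes "g \<in> carrier G" shows "continuous_map X X (act g)"
proof -
  have "continuous_map X (prod_topology T X) (\<lambda>x. (g, x))"
    using assms by (auto intro: continuous_map_pairedI)
  from continuous_map_compose[OF this act_cont] show ?thesis by (simp add: o_def)
qed

lemma continuous_orbit:
  assumes "x \<in> topspace X" shows "continuous_map T X (\<lambda>g. act g x)"
proof -
  have "continuous_map T (prod_topology T X) (\<lambda>g. (g, x))"
    using assms by (auto intro: continuous_map_pairedI)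
  from continuous_map_compose[OF this act_cont] show ?thesis by (simp add: o_def)
qed

definition Lindelof_countable :: bool where
  "Lindelof_countable \<longleftrightarrow> (\<forall>H. subgroup H G \<and> countable H \<longrightarrow>
         uniformly_Lindelof (topspace X) (subgroup_uniformity X \<mu> act H))"

text \<open>Uniform convergence on \<open>G\<close> tests all \<open>g\<close> at once, so the same
  open set serves both sides. Continuity of the orbit maps places the values of
  \<open>pi_sharp\<close> in \<open>cont_maps G T X\<close>.\<close>

lemma fragmented_map_iff_family:
  "fragmented_map X (uniform_convergence G T X \<mu>) (pi_sharp G act) \<longleftrightarrow>
      fragmented_family X \<mu> (act ` carrier G)"
proof -
  have cm: "pi_sharp G act x \<in> cont_maps G T X" if "x \<in> topspace X" for x
  proof -
    have "continuous_map T X (pi_sharp G act x)"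
      by (rule continuous_map_eq[OF continuous_orbit[OF that]]) (simp add: pi_sharp_def)
    then show ?thesis by (simp add: cont_maps_def pi_sharp_def)
  qed
  show ?thesis
  proof
    assume L: "fragmented_map X (uniform_convergence G T X \<mu>) (pi_sharp G act)"
    show "fragmented_family X \<mu> (act ` carrier G)"
      unfolding fragmented_family_def
    proof (intro allI impI, elim conjE)
      fix A e assume A: "A \<noteq> {}" "A \<subseteq> topspace X" "e \<in> \<mu>"
      let ?e = "{(f, f') \<in> cont_maps G T X \<times> cont_maps G T X. \<forall>g\<in>carrier G. (f g, f' g) \<in> e}"
      have "?e \<in> uniform_convergence G T X \<mu>"
        using A(3) unfolding uniform_convergence_def uniformity_with_basis_def by auto
      then obtain S where S: "openin X S" "S \<inter> A \<noteq> {}" "small ?e (pi_sharp G act ` (S \<inter> A))"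
        using L A unfolding fragmented_map_def by meson
      have "small e (act g ` (S \<inter> A))" if g: "g \<in> carrier G" for g
        unfolding small_def
      proof clarify
        fix x y assume xy: "x \<in> S" "x \<in> A" "y \<in> S" "y \<in> A"
        then have "(pi_sharp G act x, pi_sharp G act y) \<in> ?e" using S(3) unfolding small_def by blast
        then have "(pi_sharp G act x g, pi_sharp G act y g) \<in> e" using g by blast
        then show "(act g x, act g y) \<in> e" using g by (simp add: pi_sharp_def)
      qed
      then show "\<exists>S. openin X S \<and> S \<inter> A \<noteq> {} \<and> (\<forall>f\<in>act ` carrier G. small e (f ` (S \<inter> A)))"
        using S by blast
    qed
  next
    assume R: "fragmented_family X \<mu> (act ` carrier G)"
    show "fragmented_map X (uniform_convergence G T X \<mu>) (pi_sharp G act)"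
      unfolding fragmented_map_def
    proof (intro allI impI, elim conjE)
      fix A e' assume A: "A \<noteq> {}" "A \<subseteq> topspace X" "e' \<in> uniform_convergence G T X \<mu>"
      then obtain e where e: "e \<in> \<mu>" "{(f, f') \<in> cont_maps G T X \<times> cont_maps G T X.
           \<forall>g\<in>carrier G. (f g, f' g) \<in> e} \<subseteq> e'"
        unfolding uniform_convergence_def uniformity_with_basis_def by blast
      then obtain S where S: "openin X S" "S \<inter> A \<noteq> {}"
        "\<forall>f\<in>act ` carrier G. small e (f ` (S \<inter> A))"
        using R A unfolding fragmented_family_def by meson
      have "small e' (pi_sharp G act ` (S \<inter> A))"
        unfolding small_def
      proof clarify
        fix x y assume xy: "x \<in> S" "x \<in> A" "y \<in> S" "y \<in> A"
        have "(pi_sharp G act x g, pi_sharp G act y g) \<in> e" if "g \<in> carrier G" for g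
          using S(3) xy that unfolding small_def pi_sharp_def by auto
        moreover have "pi_sharp G act x \<in> cont_maps G T X" "pi_sharp G act y \<in> cont_maps G T X"
          using A(2) xy cm by blast+
        ultimately show "(pi_sharp G act x, pi_sharp G act y) \<in> e'"
          using e(2) by auto
      qed
      then show "\<exists>S. openin X S \<and> S \<inter> A \<noteq> {} \<and> small e' (pi_sharp G act ` (S \<inter> A))"
        using S by blast
    qed
  qed
qed

text \<open>To fragment an arbitrary \<open>A\<close>, non-sensitivity is applied to the closure
  \<open>Y\<close> of its orbit. The open set obtained meets the orbit at some
  \<open>act h a\<close>, and its preimage under \<open>act h\<close> meets \<open>A\<close>.
  Conversely, fragmenting the closed invariant set itself gives the open set that non-sensitivity
  asks for.\<close>

lemma HNS_iff_fragmented: "HNS G X \<mu> act \<longleftrightarrow> fragmented_family X \<mu> (act ` carrier G)"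
proof
  assume L: "HNS G X \<mu> act"
  show "fragmented_family X \<mu> (act ` carrier G)"
    unfolding fragmented_family_def
  proof (intro allI impI, elim conjE)
    fix A e assume A: "A \<noteq> {}" "A \<subseteq> topspace X" "e \<in> \<mu>"
    define B where "B = (\<Union>g\<in>carrier G. act g ` A)"
    define Y where "Y = X closure_of B"
    have BX: "B \<subseteq> topspace X" using A by (auto simp: B_def)
    have AB: "A \<subseteq> B" unfolding B_def using A(2) by (force intro!: bexI[of _ "\<one>\<^bsub>G\<^esub>"])
    have BY: "B \<subseteq> Y" unfolding Y_def by (rule closure_of_subset[OF BX])
    have invB: "act g ` B \<subseteq> B" if g: "g \<in> carrier G" for g
    proof clarify
      fix b assume "b \<in> B"
      then obtain h a where h: "h \<in> carrier G" "a \<in> A" "b = act h a" by (auto simp: B_def)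
      then have "act g b = act (g \<otimes>\<^bsub>G\<^esub> h) a" using g A(2) by (simp add: act_mult subset_iff)
      then show "act g b \<in> B" using g h by (auto simp: B_def)
    qed
    have "invariant G act Y"
      unfolding invariant_def
    proof (intro ballI)
      fix g x assume g: "g \<in> carrier G" and x: "x \<in> Y"
      have "act g ` (X closure_of B) \<subseteq> X closure_of (act g ` B)"
        using continuous_act[OF g] by (simp add: continuous_map_image_closure_subset)
      also have "\<dots> \<subseteq> Y" unfolding Y_def by (rule closure_of_mono[OF invB[OF g]])
      finally show "act g x \<in> Y" using x by (auto simp: Y_def)
    qed
    moreover have "closedin X Y" "Y \<noteq> {}" using A(1) AB BY by (auto simp: Y_def)
    ultimately have "not_sensitive G Y (subspace_uniformity \<mu> Y) act"
      using L unfolding HNS_def by blast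
    then obtain S where S: "uniform_openin Y (subspace_uniformity \<mu> Y) S" "S \<noteq> {}"
      "\<forall>x\<in>S. \<forall>y\<in>S. \<forall>g\<in>carrier G. (act g x, act g y) \<in> e \<inter> Y \<times> Y"
      using A(3) unfolding not_sensitive_def subspace_uniformity_def by blast
    obtain y where y: "y \<in> S" using S by blast
    then obtain d where d: "d \<in> \<mu>" "(d \<inter> Y \<times> Y) `` {y} \<subseteq> S" and yY: "y \<in> Y"
      using S(1) unfolding uniform_openin_def subspace_uniformity_def by blast
    have "y \<in> topspace X" using yY closure_of_subset_topspace unfolding Y_def by fastforce
    then obtain U where U: "openin X U" "y \<in> U" "U \<subseteq> d `` {y}"
      using compatible_uniformity_nbhd[OF compat d(1)] by blast
    then obtain b where b: "b \<in> B" "b \<in> U"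
      using yY unfolding Y_def in_closure_of by blast
    then obtain h a where h: "h \<in> carrier G" "a \<in> A" "b = act h a" by (auto simp: B_def)
    define W where "W = {x \<in> topspace X. act h x \<in> U}"
    have "openin X W" unfolding W_def
      using openin_continuous_map_preimage[OF continuous_act[OF h(1)] U(1)] .
    moreover have "a \<in> W \<inter> A" using h b A(2) by (auto simp: W_def)
    moreover have "small e (act g ` (W \<inter> A))" if g: "g \<in> carrier G" for g
      unfolding small_def
    proof clarify
      have *: "act h x \<in> S" if "x \<in> W" "x \<in> A" for x
      proof -
        have "act h x \<in> B" using that h by (auto simp: B_def)
        then show ?thesis using that d(2) U(3) BY yY by (auto simp: W_def)
      qed
      fix x y assume xy: "x \<in> W" "x \<in> A" "y \<in> W" "y \<in> A"
      \<comment> \<open>The bound in \<open>S\<close> holds for all group elements at once, so the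
        displacement by \<open>h\<close> is absorbed by using \<open>g\<close> times the inverse of
        \<open>h\<close>.\<close>
      have "act (g \<otimes>\<^bsub>G\<^esub> inv\<^bsub>G\<^esub> h) (act h z) = act g z" if "z \<in> topspace X" for z
        using that g h by (simp add: act_mult)
      then have "act (g \<otimes>\<^bsub>G\<^esub> inv\<^bsub>G\<^esub> h) (act h x) = act g x"
        "act (g \<otimes>\<^bsub>G\<^esub> inv\<^bsub>G\<^esub> h) (act h y) = act g y" using xy A(2) by blast+
      moreover have "(act (g \<otimes>\<^bsub>G\<^esub> inv\<^bsub>G\<^esub> h) (act h x), act (g \<otimes>\<^bsub>G\<^esub> inv\<^bsub>G\<^esub> h) (act h y)) \<in> e"
        using S(3) *[OF xy(1,2)] *[OF xy(3,4)] G_closed(2)[OF g G_closed(3)[OF h(1)]] by blast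
      ultimately show "(act g x, act g y) \<in> e" by simp
    qed
    ultimately show "\<exists>S. openin X S \<and> S \<inter> A \<noteq> {} \<and> (\<forall>f\<in>act ` carrier G. small e (f ` (S \<inter> A)))"
      by blast
  qed
next
  assume R: "fragmented_family X \<mu> (act ` carrier G)"
  show "HNS G X \<mu> act"
    unfolding HNS_def not_sensitive_def
  proof (intro allI impI ballI, elim conjE)
    fix Y e' assume Y: "Y \<noteq> {}" "closedin X Y" "invariant G act Y" and "e' \<in> subspace_uniformity \<mu> Y"
    then obtain e where e: "e \<in> \<mu>" "e' = e \<inter> Y \<times> Y" by (auto simp: subspace_uniformity_def)
    then obtain S where S: "openin X S" "S \<inter> Y \<noteq> {}" "\<forall>f\<in>act ` carrier G. small e (f ` (S \<inter> Y))"
      using R Y closedin_subset unfolding fragmented_family_def by meson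
    have "uniform_openin Y (subspace_uniformity \<mu> Y) (S \<inter> Y)"
      unfolding uniform_openin_def
    proof (intro conjI ballI)
      fix y assume y: "y \<in> S \<inter> Y"
      then obtain d where "d \<in> \<mu>" "d `` {y} \<subseteq> S" using S(1) unfolding openin_iff uniform_openin_def by blast
      then show "\<exists>e\<in>subspace_uniformity \<mu> Y. e `` {y} \<subseteq> S \<inter> Y"
        by (intro bexI[of _ "d \<inter> Y \<times> Y"]) (auto simp: subspace_uniformity_def)
    qed auto
    moreover have "\<forall>x\<in>S \<inter> Y. \<forall>y\<in>S \<inter> Y. \<forall>g\<in>carrier G. (act g x, act g y) \<in> e'"
      using S(3) Y(3) unfolding e(2) small_def invariant_def by blast
    ultimately show "\<exists>S. uniform_openin Y (subspace_uniformity \<mu> Y) S \<and> S \<noteq> {} \<and>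
        (\<forall>x\<in>S. \<forall>y\<in>S. \<forall>g\<in>carrier G. (act g x, act g y) \<in> e')"
      using S(2) by blast
  qed
qed

end

section \<open>From the Lindelof property to fragmentability\<close>

text \<open>Every generated element is the value of a finite word in \<open>S\<close> and its
  inverses, and there are countably many words.\<close>

lemma (in group) countable_generate:
  assumes "countable S" "S \<subseteq> carrier G"
  shows "countable (generate G S)"
proof -
  let ?A = "S \<union> (\<lambda>s. inv s) ` S"
  let ?f = "\<lambda>l. foldr (\<otimes>) l \<one>"
  have A: "?A \<subseteq> carrier G" using assms by auto
  have closed: "?f l \<in> carrier G" if "l \<in> lists ?A" for l
    using that A by (induction l) auto
  have app: "?f l \<otimes> ?f l' = ?f (l @ l')" if "l \<in> lists ?A" "l' \<in> lists ?A" for l l'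
    using that(1)
  proof (induction l)
    case (Cons a l)
    then have "a \<in> carrier G" "?f l \<in> carrier G" using A closed by auto
    then show ?case using Cons closed[OF that(2)] by (simp add: m_assoc)
  qed (use closed[OF that(2)] in simp)
  have "generate G S \<subseteq> ?f ` lists ?A"
  proof
    fix x assume "x \<in> generate G S"
    then show "x \<in> ?f ` lists ?A"
    proof (induction rule: generate.induct)
      case one then show ?case by (intro image_eqI[of _ _ "[]"]) auto
    next
      case (incl h) then show ?case using assms by (intro image_eqI[of _ _ "[h]"]) auto
    next
      case (inv h) then show ?case using assms by (intro image_eqI[of _ _ "[inv h]"]) auto
    next
      case (eng h1 h2)
      then obtain l l' where "l \<in> lists ?A" "l' \<in> lists ?A" "h1 = ?f l" "h2 = ?f l'" by blast
      then show ?case using app by (intro image_eqI[of _ _ "l @ l'"]) auto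
    qed
  qed
  moreover have "countable (lists ?A)" using assms by (intro countable_lists) auto
  ultimately show ?thesis using countable_subset countable_image by metis
qed

lemma regular_space_shrink:
  assumes "regular_space X" "openin X W" "x \<in> W"
  obtains U where "openin X U" "x \<in> U" "X closure_of U \<subseteq> W"
proof -
  have "neighbourhood_base_of (closedin X) X" using assms(1) by (simp add: neighbourhood_base_of_closedin)
  from neighbourhood_base_of[THEN iffD1, rule_format, OF this conjI[OF assms(2,3)]]
  obtain U V where U: "openin X U" "closedin X V" "x \<in> U" "U \<subseteq> V" "V \<subseteq> W"
    by (elim exE conjE)
  then have "X closure_of U \<subseteq> W" using closure_of_minimal[OF U(4,2)] by blast
  with U that show ?thesis by blast
qed

lemma uncountable_binary_sequences: "uncountable (UNIV :: (nat \<Rightarrow> bool) set)"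
proof
  assume "countable (UNIV :: (nat \<Rightarrow> bool) set)"
  then have "range (from_nat_into (UNIV :: (nat \<Rightarrow> bool) set)) = UNIV"
    by (simp add: range_from_nat_into)
  then obtain n where "from_nat_into UNIV n = (\<lambda>n. \<not> from_nat_into UNIV n n)"
    by (metis rangeE UNIV_I)
  from fun_cong[OF this, of n] show False by simp
qed

context compact_system
begin

definition H_small :: "'g set \<Rightarrow> ('x \<times> 'x) set \<Rightarrow> ('x \<times> 'x) set" where
  "H_small H e = {(x, y) \<in> topspace X \<times> topspace X. \<forall>h\<in>H. (act h x, act h y) \<in> e}"

lemma subgroup_uniformity_eq:
  "subgroup_uniformity X \<mu> act H = uniformity_with_basis (topspace X) (H_small H ` \<mu>)"
  by (simp add: subgroup_uniformity_def H_small_def[abs_def])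

text \<open>Basic entourages suffice, since a countable cover by sections survives enlarging the
  entourage.\<close>

lemma uniformly_Lindelof_subgroup_iff:
  "uniformly_Lindelof (topspace X) (subgroup_uniformity X \<mu> act H) \<longleftrightarrow>
   (\<forall>e\<in>\<mu>. \<exists>C. countable C \<and> C \<subseteq> topspace X \<and> topspace X \<subseteq> (\<Union>y\<in>C. H_small H e `` {y}))"
  (is "?L \<longleftrightarrow> ?R")
proof
  assume ?L
  show ?R
  proof
    fix e assume "e \<in> \<mu>"
    then have "H_small H e \<in> subgroup_uniformity X \<mu> act H"
      unfolding subgroup_uniformity_eq uniformity_with_basis_def by (auto simp: H_small_def)
    then show "\<exists>C. countable C \<and> C \<subseteq> topspace X \<and> topspace X \<subseteq> (\<Union>y\<in>C. H_small H e `` {y})"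
      using \<open>?L\<close> unfolding uniformly_Lindelof_def by blast
  qed
next
  assume R: ?R
  show ?L
    unfolding uniformly_Lindelof_def
  proof
    fix e' assume "e' \<in> subgroup_uniformity X \<mu> act H"
    then obtain e where e: "e \<in> \<mu>" "H_small H e \<subseteq> e'"
      unfolding subgroup_uniformity_eq uniformity_with_basis_def by blast
    then obtain C where "countable C" "C \<subseteq> topspace X" "topspace X \<subseteq> (\<Union>y\<in>C. H_small H e `` {y})"
      using bspec[OF R e(1)] by (elim exE conjE)
    then show "\<exists>C. countable C \<and> C \<subseteq> topspace X \<and> topspace X \<subseteq> (\<Union>y\<in>C. e' `` {y})"
      using e(2) by (intro exI[of _ C] conjI) (assumption, assumption, blast)
  qed
qed

text \<open>A family that is not fragmented yields a Cantor tree of open sets in which any two branches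
  are separated by one of countably many group elements.\<close>

lemma Lindelof_imp_fragmented:
  assumes L: Lindelof_countable
  shows "fragmented_family X \<mu> (act ` carrier G)"
  unfolding fragmented_family_def
proof (intro allI impI, elim conjE, rule ccontr)
  fix A e assume A: "A \<noteq> {}" "A \<subseteq> topspace X" and e: "e \<in> \<mu>"
    and neg: "\<not> (\<exists>S. openin X S \<and> S \<inter> A \<noteq> {} \<and> (\<forall>f\<in>act ` carrier G. small e (f ` (S \<inter> A))))"
  have nf: "\<exists>g\<in>carrier G. \<not> small e (act g ` (S \<inter> A))" if "openin X S" "S \<inter> A \<noteq> {}" for S
  proof (rule ccontr)
    assume "\<not> ?thesis"
    then have "\<forall>f\<in>act ` carrier G. small e (f ` (S \<inter> A))" by simp
    with that have "\<exists>S. openin X S \<and> S \<inter> A \<noteq> {} \<and> (\<forall>f\<in>act ` carrier G. small e (f ` (S \<inter> A)))"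
      by (intro exI[of _ S] conjI)
    with neg show False by (rule notE)
  qed
  \<comment> \<open>Three steps of size \<open>d\<close> make one of size \<open>e\<close>: the
    images of both closures below stay within \<open>d\<close> of two points that are not
    \<open>e\<close>-close, so they cannot be \<open>d\<close>-close to each other.\<close>
  obtain d where d: "d \<in> \<mu>" "sym d" "d O d O d \<subseteq> e"
    by (rule uniform_structure_third[OF uniform e]) (rule that)
  define good where "good S \<longleftrightarrow> openin X S \<and> S \<inter> A \<noteq> {}" for S
  \<comment> \<open>One splitting of the tree. The closures of the children are kept apart, and not
    only the children, because the end of a branch is only known to lie in closures.\<close>
  define Q where "Q S = (\<lambda>(g, S1, S2). g \<in> carrier G \<and> good S1 \<and> good S2 \<and>
       X closure_of S1 \<subseteq> S \<and> X closure_of S2 \<subseteq> S \<and>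
       (\<forall>u\<in>X closure_of S1. \<forall>v\<in>X closure_of S2. (act g u, act g v) \<notin> d))" for S
  have step: "\<exists>t. Q S t" if S: "good S" for S
  proof -
    obtain g x y where g: "g \<in> carrier G" and xy: "x \<in> S" "x \<in> A" "y \<in> S" "y \<in> A" "(act g x, act g y) \<notin> e"
    proof -
      obtain g where "g \<in> carrier G" "\<not> small e (act g ` (S \<inter> A))"
        using nf[of S] S unfolding good_def by blast
      then show ?thesis using that unfolding small_def by auto
    qed
    have nb: "\<exists>U. good U \<and> X closure_of U \<subseteq> S \<and> (\<forall>u\<in>X closure_of U. (act g z, act g u) \<in> d)"
      if z: "z \<in> S" "z \<in> A" for z
    proof -
      have zX: "z \<in> topspace X" "act g z \<in> topspace X" using z A g by auto
      obtain W where W: "openin X W" "act g z \<in> W" "W \<subseteq> d `` {act g z}"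
        using compatible_uniformity_nbhd[OF compat d(1) zX(2)] by blast
      define P where "P = S \<inter> {x \<in> topspace X. act g x \<in> W}"
      have "openin X P" unfolding P_def
        using S openin_continuous_map_preimage[OF continuous_act[OF g] W(1)]
        unfolding good_def by blast
      moreover have "z \<in> P" using zX W z by (auto simp: P_def)
      ultimately obtain U where U: "openin X U" "z \<in> U" "X closure_of U \<subseteq> P"
        by (rule regular_space_shrink[OF regular])
      then have "good U" using z(2) by (auto simp: good_def)
      moreover have "X closure_of U \<subseteq> S" using U(3) by (auto simp: P_def)
      moreover have "\<forall>u\<in>X closure_of U. (act g z, act g u) \<in> d" using U(3) W(3) by (auto simp: P_def)
      ultimately show ?thesis by (intro exI[of _ U] conjI)
    qed
    obtain U where U: "good U" "X closure_of U \<subseteq> S" "\<forall>u\<in>X closure_of U. (act g x, act g u) \<in> d"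
      using nb[OF xy(1,2)] by (elim exE conjE)
    obtain V where V: "good V" "X closure_of V \<subseteq> S" "\<forall>u\<in>X closure_of V. (act g y, act g u) \<in> d"
      using nb[OF xy(3,4)] by (elim exE conjE)
    have "(act g u, act g v) \<notin> d"
      if uv: "(act g x, act g u) \<in> d" "(act g y, act g v) \<in> d" for u v
    proof
      assume "(act g u, act g v) \<in> d"
      moreover have "(act g v, act g y) \<in> d" using uv(2) d(2) by (rule symD[rotated])
      ultimately have "(act g x, act g y) \<in> d O d O d" using uv(1) by (intro relcompI)
      then have "(act g x, act g y) \<in> e" by (rule subsetD[OF d(3)])
      then show False using xy(5) by simp
    qed
    then have "\<forall>u\<in>X closure_of U. \<forall>v\<in>X closure_of V. (act g u, act g v) \<notin> d"
      using U(3) V(3) by simp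
    then have "Q S (g, U, V)" using g U(1,2) V(1,2) by (simp add: Q_def)
    then show ?thesis by (rule exI)
  qed
  then obtain f where f: "\<And>S. good S \<Longrightarrow> Q S (f S)" by metis
  define \<gamma> \<sigma>1 \<sigma>2 where "\<gamma> S = fst (f S)" and "\<sigma>1 S = fst (snd (f S))" and "\<sigma>2 S = snd (snd (f S))" for S
  then have Q: "Q S (\<gamma> S, \<sigma>1 S, \<sigma>2 S)" if "good S" for S using f[OF that] by simp
  have \<gamma>: "\<And>S. good S \<Longrightarrow> \<gamma> S \<in> carrier G"
    and g1: "\<And>S. good S \<Longrightarrow> good (\<sigma>1 S)" and g2: "\<And>S. good S \<Longrightarrow> good (\<sigma>2 S)"
    and s1: "\<And>S. good S \<Longrightarrow> X closure_of (\<sigma>1 S) \<subseteq> S" and s2: "\<And>S. good S \<Longrightarrow> X closure_of (\<sigma>2 S) \<subseteq> S"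
    and sep: "\<And>S u v. good S \<Longrightarrow> u \<in> X closure_of (\<sigma>1 S) \<Longrightarrow> v \<in> X closure_of (\<sigma>2 S) \<Longrightarrow>
        (act (\<gamma> S) u, act (\<gamma> S) v) \<notin> d"
    using Q unfolding Q_def prod.case by simp_all
  define \<sigma> where "\<sigma> b S = (if b then \<sigma>1 S else \<sigma>2 S)" for b S
  define node where "node b n = fold \<sigma> (map b [0..<n]) (topspace X)" for b :: "nat \<Rightarrow> bool" and n
  have node_Suc: "node b (Suc n) = \<sigma> (b n) (node b n)" for b n by (simp add: node_def)
  have good: "good (node b n)" for b n
  proof (induction n)
    case 0 then show ?case using A by (auto simp: node_def good_def)
  next
    case (Suc n) then show ?case using g1 g2 by (simp add: node_Suc \<sigma>_def)
  qed
  have nest: "X closure_of (node b (Suc n)) \<subseteq> node b n" for b n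
    using s1 s2 good by (simp add: node_Suc \<sigma>_def)
  have sub: "node b n \<subseteq> X closure_of (node b n)" for b n
    using good[of b n] unfolding good_def by (intro closure_of_subset openin_subset) simp
  have ne: "(\<Inter>n. X closure_of (node b n)) \<noteq> {}" for b
  proof (rule compact_space_imp_nest[OF compact])
    have "node b n \<noteq> {}" for n using good[of b n] by (auto simp: good_def)
    then show "X closure_of (node b n) \<noteq> {}" for n using sub[of b n] by auto
    show "antimono_on UNIV (\<lambda>n. X closure_of (node b n))"
      by (rule decseq_SucI) (rule order_trans[OF nest sub])
  qed auto
  have "\<exists>x. \<forall>n. x \<in> X closure_of (node b n)" for b using ne[of b] by auto
  then obtain p where p: "\<And>b n. p b \<in> X closure_of (node b n)" by metis
  have pX: "p b \<in> topspace X" for b using p[of b 0] closure_of_subset_topspace by fastforce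
  \<comment> \<open>A node depends on a finite bit string only, so uncountably many branches use
    countably many splitting elements.\<close>
  define \<Gamma> where "\<Gamma> = {\<gamma> (node b n) | b n. True}"
  have "\<Gamma> \<subseteq> range (\<lambda>l. \<gamma> (fold \<sigma> l (topspace X)))" by (auto simp: \<Gamma>_def node_def)
  then have "countable \<Gamma>" by (rule countable_subset) simp
  define H where "H = generate G \<Gamma>"
  have \<Gamma>: "\<Gamma> \<subseteq> carrier G" using \<gamma> good by (auto simp: \<Gamma>_def)
  have H: "subgroup H G" "countable H" unfolding H_def
    using group.generate_is_subgroup[OF group, OF \<Gamma>] group.countable_generate[OF group, OF \<open>countable \<Gamma>\<close> \<Gamma>] by auto
  have sepp: "(p b, p c) \<notin> H_small H d" if "b \<noteq> c" for b c
  proof -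
    have "\<exists>n. b n \<noteq> c n" using that by auto
    \<comment> \<open>Up to the first differing bit the branches share a node, and the splitting
      element of this node separates their ends.\<close>
    define n where "n = (LEAST n. b n \<noteq> c n)"
    have n: "b n \<noteq> c n" unfolding n_def by (rule LeastI_ex) fact
    have "b k = c k" if "k < n" for k using not_less_Least[OF that[unfolded n_def]] by simp
    then have "map b [0..<n] = map c [0..<n]" by simp
    then have eq: "node b n = node c n" by (simp only: node_def)
    have "\<gamma> (node b n) \<in> H" unfolding H_def by (rule generate.incl) (auto simp: \<Gamma>_def)
    moreover have "(act (\<gamma> (node b n)) (p b), act (\<gamma> (node b n)) (p c)) \<notin> d"
    proof (cases "b n")
      case True
      then show ?thesis
        using sep[OF good] p[of b "Suc n"] p[of c "Suc n"] n eq by (simp add: node_Suc \<sigma>_def)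
    next
      case False
      then have "(act (\<gamma> (node b n)) (p c), act (\<gamma> (node b n)) (p b)) \<notin> d"
        using sep[OF good] p[of b "Suc n"] p[of c "Suc n"] n eq by (simp add: node_Suc \<sigma>_def)
      then show ?thesis using symD[OF d(2)] by auto
    qed
    ultimately show ?thesis by (auto simp: H_small_def)
  qed
  \<comment> \<open>Two ends with a common centre would be \<open>d\<close>-close along
    \<open>H\<close>, so distinct branches need distinct centres and no countable \<open>C\<close>
    can supply them.\<close>
  obtain d' where d': "d' \<in> \<mu>" "sym d'" "d' O d' \<subseteq> d"
    by (rule uniform_structure_half[OF uniform d(1)]) (rule that)
  have "\<exists>C. countable C \<and> C \<subseteq> topspace X \<and> topspace X \<subseteq> (\<Union>y\<in>C. H_small H d' `` {y})"
    using L H d'(1) unfolding Lindelof_countable_def uniformly_Lindelof_subgroup_iff by simp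
  then obtain C where C: "countable C" "topspace X \<subseteq> (\<Union>y\<in>C. H_small H d' `` {y})" by (elim exE conjE)
  have "\<exists>c. c \<in> C \<and> (c, p b) \<in> H_small H d'" for b using subsetD[OF C(2) pX[of b]] by auto
  then obtain q where q: "\<And>b. q b \<in> C \<and> (q b, p b) \<in> H_small H d'" by metis
  have "inj q"
  proof (rule injI, rule ccontr)
    fix b c assume eq: "q b = q c" and "b \<noteq> c"
    have "(act h (p b), act h (p c)) \<in> d" if "h \<in> H" for h
    proof -
      have 1: "(act h (q b), act h (p b)) \<in> d'" and 2: "(act h (q b), act h (p c)) \<in> d'"
        using q[of b] q[of c] eq that by (auto simp: H_small_def)
      have "(act h (p b), act h (p c)) \<in> d' O d'" by (rule relcompI[OF symD[OF d'(2) 1] 2])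
      then show ?thesis by (rule subsetD[OF d'(3)])
    qed
    then have "(p b, p c) \<in> H_small H d" using pX by (auto simp: H_small_def)
    then show False using sepp[OF \<open>b \<noteq> c\<close>] by simp
  qed
  moreover have "countable (range q)" by (rule countable_subset[OF _ C(1)]) (use q in auto)
  ultimately have "countable (UNIV :: (nat \<Rightarrow> bool) set)" using countable_image_inj_on by metis
  then show False using uncountable_binary_sequences by simp
qed

text \<open>Joint continuity at the identity and a point \<open>x\<close> gives a product
  neighbourhood on which points move by less than \<open>e\<close>. Compactness of \<open>X\<close>
  makes the neighbourhood of the identity independent of \<open>x\<close>.\<close>

lemma uniform_nbhd_one:
  assumes "e \<in> \<mu>"
  obtains U where "openin T U" "\<one>\<^bsub>G\<^esub> \<in> U" "\<And>u x. u \<in> U \<Longrightarrow> x \<in> topspace X \<Longrightarrow> (act u x, x) \<in> e"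
proof -
  obtain d where d: "d \<in> \<mu>" "sym d" "d O d \<subseteq> e"
    using uniform_structure_half[OF uniform assms] by blast
  have "\<exists>V. openin X V \<and> x \<in> V \<and> (\<exists>U. openin T U \<and> \<one>\<^bsub>G\<^esub> \<in> U \<and> (\<forall>u\<in>U. \<forall>y\<in>V. (act u y, y) \<in> e))"
    if x: "x \<in> topspace X" for x
  proof -
    obtain W where W: "openin X W" "x \<in> W" "W \<subseteq> d `` {x}"
      using compatible_uniformity_nbhd[OF compat d(1) x] by blast
    have "openin (prod_topology T X) {z \<in> topspace (prod_topology T X). (case z of (g, x) \<Rightarrow> act g x) \<in> W}"
      by (rule openin_continuous_map_preimage[OF act_cont W(1)])
    moreover have "(\<one>\<^bsub>G\<^esub>, x) \<in> {z \<in> topspace (prod_topology T X). (case z of (g, x) \<Rightarrow> act g x) \<in> W}"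
      using x W(2) by simp
    ultimately obtain U V where UV: "openin T U" "openin X V" "\<one>\<^bsub>G\<^esub> \<in> U" "x \<in> V"
      "U \<times> V \<subseteq> {z \<in> topspace (prod_topology T X). (case z of (g, x) \<Rightarrow> act g x) \<in> W}"
      unfolding openin_prod_topology_alt by (elim allE impE exE conjE)
    have "(act u y, y) \<in> e" if "u \<in> U" "y \<in> V \<inter> W" for u y
    proof -
      have "(x, act u y) \<in> d" "(x, y) \<in> d" using that UV(5) W(3) by auto
      then show ?thesis using d(2,3) by (meson relcompI subsetD symD)
    qed
    then show ?thesis using UV W by (intro exI[of _ "V \<inter> W"]) blast
  qed
  note local = this
  obtain F V where F: "finite F" "F \<subseteq> topspace X" "topspace X = (\<Union>x\<in>F. V x)"
    "\<And>x. x \<in> F \<Longrightarrow> openin X (V x)" "\<And>x. x \<in> F \<Longrightarrow> x \<in> V x"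
    "\<And>x. x \<in> F \<Longrightarrow> \<exists>U. openin T U \<and> \<one>\<^bsub>G\<^esub> \<in> U \<and> (\<forall>u\<in>U. \<forall>y\<in>V x. (act u y, y) \<in> e)"
    using compact_space_finite_subcover[OF compact local] by metis
  obtain U where U: "\<And>x. x \<in> F \<Longrightarrow> openin T (U x) \<and> \<one>\<^bsub>G\<^esub> \<in> U x \<and> (\<forall>u\<in>U x. \<forall>y\<in>V x. (act u y, y) \<in> e)"
    using F(6) by metis
  show ?thesis
  proof
    \<comment> \<open>The factor \<open>topspace T\<close> keeps the set within the group when
      \<open>X\<close> is empty and there is nothing to intersect.\<close>
    have "openin T (topspace T \<inter> \<Inter> (U ` F))"
      using F(1) U openin_topspace[of T] by (cases "F = {}") (auto intro!: openin_Int_Inter)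
    then show "openin T (carrier G \<inter> (\<Inter>x\<in>F. U x))" by simp
  qed (use U F in auto)
qed

text \<open>Up to a small left factor every \<open>h\<close> in \<open>H\<close> lies in the
  countable group \<open>K\<close> generated by \<open>C\<close>. A small factor moves all points by
  less than \<open>d\<close>, so closeness along \<open>K\<close> passes to closeness along
  \<open>H\<close> at the price of two further steps of size \<open>d\<close>.\<close>

lemma Lindelof_countable_imp_uniformly_Lindelof:
  assumes L: Lindelof_countable and H: "subgroup H G"
    and HL: "uniformly_Lindelof_group (G\<lparr>carrier := H\<rparr>) (subtopology T H)"
  shows "uniformly_Lindelof (topspace X) (subgroup_uniformity X \<mu> act H)"
  unfolding uniformly_Lindelof_subgroup_iff
proof
  fix e assume "e \<in> \<mu>"
  then obtain d where d: "d \<in> \<mu>" "sym d" "d O d O d \<subseteq> e"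
    using uniform_structure_third[OF uniform] by blast
  obtain U where U: "openin T U" "\<one>\<^bsub>G\<^esub> \<in> U" "\<And>u x. u \<in> U \<Longrightarrow> x \<in> topspace X \<Longrightarrow> (act u x, x) \<in> d"
    using uniform_nbhd_one[OF d(1)] by blast
  have HG: "H \<subseteq> carrier G" using H by (rule subgroup.subset)
  \<comment> \<open>Inverting a factorisation of the inverse of \<open>h\<close> as \<open>c\<close>
    times \<open>v\<close> puts the small factor on the left, where it acts last; hence it is the
    inverses of \<open>V\<close> that must lie in \<open>U\<close>.\<close>
  define V where "V = {v \<in> H. inv\<^bsub>G\<^esub> v \<in> U}"
  have "openin T {v \<in> topspace T. inv\<^bsub>G\<^esub> v \<in> U}"
    using top_group U(1) unfolding topological_group_def by (blast intro: openin_continuous_map_preimage)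
  then have "openin (subtopology T H) V"
    using HG by (auto simp: openin_subtopology V_def)
  moreover have "\<one>\<^bsub>G\<^esub> \<in> V" using U H by (auto simp: V_def subgroup.one_closed group.is_monoid[OF group] monoid.inv_one)
  moreover have "V \<subseteq> H" by (auto simp: V_def)
  ultimately have "\<exists>C. countable C \<and> C \<subseteq> H \<and> H = C <#>\<^bsub>G\<lparr>carrier := H\<rparr>\<^esub> V"
    using HL[unfolded uniformly_Lindelof_group_def, rule_format, of V] by auto
  then obtain C where C: "countable C" "C \<subseteq> H" "H = C <#>\<^bsub>G\<lparr>carrier := H\<rparr>\<^esub> V" by blast
  define K where "K = generate G C"
  have CG: "C \<subseteq> carrier G" using C HG by blast
  have "subgroup K G" "countable K" unfolding K_def
    using group.generate_is_subgroup[OF group, OF CG] group.countable_generate[OF group, OF C(1) CG] by auto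
  then obtain D where D: "countable D" "D \<subseteq> topspace X" "topspace X \<subseteq> (\<Union>y\<in>D. H_small K d `` {y})"
    using L d(1) unfolding Lindelof_countable_def uniformly_Lindelof_subgroup_iff by meson
  have "H_small K d \<subseteq> H_small H e"
  proof clarify
    fix x y assume xy: "(x, y) \<in> H_small K d"
    have X: "x \<in> topspace X" "y \<in> topspace X" using xy by (auto simp: H_small_def)
    have "(act h x, act h y) \<in> e" if h: "h \<in> H" for h
    proof -
      have "inv\<^bsub>G\<^esub> h \<in> C <#>\<^bsub>G\<lparr>carrier := H\<rparr>\<^esub> V" using C(3) H h by (metis subgroup.m_inv_closed)
      then obtain c v where cv: "c \<in> C" "v \<in> V" "inv\<^bsub>G\<^esub> h = c \<otimes>\<^bsub>G\<^esub> v" by (auto simp: set_mult_def)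
      have G': "c \<in> carrier G" "v \<in> carrier G" "h \<in> carrier G" using cv HG C(2) h by (auto simp: V_def)
      let ?c = "inv\<^bsub>G\<^esub> c" and ?u = "inv\<^bsub>G\<^esub> v"
      have "h = ?u \<otimes>\<^bsub>G\<^esub> ?c" using cv(3) G' by (metis group.inv_inv[OF group] group.inv_mult_group[OF group])
      then have eq: "act h z = act ?u (act ?c z)" if "z \<in> topspace X" for z
        using that G' by (simp add: act_mult)
      have "?c \<in> K" unfolding K_def using cv(1) by (rule generate.inv)
      then have 1: "(act ?c x, act ?c y) \<in> d" using xy by (auto simp: H_small_def)
      have "?u \<in> U" using cv by (auto simp: V_def)
      then have 2: "(act ?u (act ?c z), act ?c z) \<in> d" if "z \<in> topspace X" for z
        using U(3) that G' by simp
      have "(act ?c y, act ?u (act ?c y)) \<in> d" using 2[OF X(2)] d(2) by (meson symD)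
      then have "(act ?u (act ?c x), act ?u (act ?c y)) \<in> d O d O d" using 1 2[OF X(1)] by blast
      then show ?thesis using d(3) eq[OF X(1)] eq[OF X(2)] by auto
    qed
    then show "(x, y) \<in> H_small H e" using X by (auto simp: H_small_def)
  qed
  then show "\<exists>C. countable C \<and> C \<subseteq> topspace X \<and> topspace X \<subseteq> (\<Union>y\<in>C. H_small H e `` {y})"
    using D by (intro exI[of _ D]) blast
qed

lemma countable_imp_uniformly_Lindelof_group:
  assumes "subgroup H G" "countable H"
  shows "uniformly_Lindelof_group (G\<lparr>carrier := H\<rparr>) T'"
  unfolding uniformly_Lindelof_group_def
proof (intro allI impI, elim conjE exE)
  have carr: "carrier (G\<lparr>carrier := H\<rparr>) = H" by simp
  fix U W assume U: "U \<subseteq> carrier (G\<lparr>carrier := H\<rparr>)" "\<one>\<^bsub>G\<lparr>carrier := H\<rparr>\<^esub> \<in> W" "W \<subseteq> U"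
  have "H \<subseteq> H <#>\<^bsub>G\<lparr>carrier := H\<rparr>\<^esub> U"
  proof
    fix h assume "h \<in> H"
    moreover have "h = h \<otimes>\<^bsub>G\<^esub> \<one>\<^bsub>G\<^esub>" using \<open>h \<in> H\<close> assms(1) by (simp add: group.is_monoid[OF group] monoid.r_one subgroup.mem_carrier)
    ultimately show "h \<in> H <#>\<^bsub>G\<lparr>carrier := H\<rparr>\<^esub> U" using U by (force simp: set_mult_def)
  qed
  moreover have "H <#>\<^bsub>G\<lparr>carrier := H\<rparr>\<^esub> U \<subseteq> H"
    using U assms(1) by (auto simp: set_mult_def subgroup.m_closed subset_iff)
  ultimately have "H = H <#>\<^bsub>G\<lparr>carrier := H\<rparr>\<^esub> U" by (rule subset_antisym)
  then show "\<exists>C. countable C \<and> C \<subseteq> carrier (G\<lparr>carrier := H\<rparr>) \<and>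
      carrier (G\<lparr>carrier := H\<rparr>) = C <#>\<^bsub>G\<lparr>carrier := H\<rparr>\<^esub> U"
    unfolding carr using assms(2) by blast
qed

lemma Lindelof_countable_iff:
  "Lindelof_countable \<longleftrightarrow> (\<forall>H. subgroup H G \<and> uniformly_Lindelof_group (G\<lparr>carrier := H\<rparr>) (subtopology T H) \<longrightarrow>
         uniformly_Lindelof (topspace X) (subgroup_uniformity X \<mu> act H))"
proof (intro iffI allI impI)
  fix H assume Lindelof_countable
    "subgroup H G \<and> uniformly_Lindelof_group (G\<lparr>carrier := H\<rparr>) (subtopology T H)"
  then show "uniformly_Lindelof (topspace X) (subgroup_uniformity X \<mu> act H)"
    using Lindelof_countable_imp_uniformly_Lindelof by simp
next
  assume R: "\<forall>H. subgroup H G \<and> uniformly_Lindelof_group (G\<lparr>carrier := H\<rparr>) (subtopology T H) \<longrightarrow>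
    uniformly_Lindelof (topspace X) (subgroup_uniformity X \<mu> act H)"
  show Lindelof_countable
    unfolding Lindelof_countable_def
  proof (intro allI impI, elim conjE)
    fix H assume "subgroup H G" "countable H"
    then show "uniformly_Lindelof (topspace X) (subgroup_uniformity X \<mu> act H)"
      by (intro R[rule_format] conjI countable_imp_uniformly_Lindelof_group)
  qed
qed

end

section \<open>From fragmentability to the Lindelof property\<close>

text \<open>The Heine-Cantor theorem in terms of entourages.\<close>

lemma uniform_continuity_compact:
  fixes f :: "'x \<Rightarrow> real"
  assumes "compact_space X" "compatible_uniformity X \<mu>" "continuous_map X euclideanreal f" "r > 0"
  shows "{(x, y) \<in> topspace X \<times> topspace X. \<bar>f x - f y\<bar> < r} \<in> \<mu>" (is "?E \<in> \<mu>")
proof -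
  have us: "uniform_structure (topspace X) \<mu>" and op: "openin X = uniform_openin (topspace X) \<mu>"
    using assms(2) by (auto simp: compatible_uniformity_def)
  have local: "\<exists>V. openin X V \<and> x \<in> V \<and> (\<exists>d\<in>\<mu>. \<forall>y\<in>V. \<forall>z. (y, z) \<in> d \<longrightarrow> \<bar>f y - f z\<bar> < r)"
    if x: "x \<in> topspace X" for x
  proof -
    define U where "U = {y \<in> topspace X. f y \<in> ball (f x) (r/2)}"
    have "openin X U" unfolding U_def
      by (rule openin_continuous_map_preimage[OF assms(3)]) simp
    then have "uniform_openin (topspace X) \<mu> U" by (simp add: op)
    moreover have "x \<in> U" using x assms(4) by (simp add: U_def)
    ultimately obtain d where d: "d \<in> \<mu>" "d `` {x} \<subseteq> U" unfolding uniform_openin_def by blast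
    obtain d' where d': "d' \<in> \<mu>" "sym d'" "d' O d' \<subseteq> d" by (rule uniform_structure_half[OF us d(1)])
    obtain V where V: "openin X V" "x \<in> V" "V \<subseteq> d' `` {x}" by (rule compatible_uniformity_nbhd[OF assms(2) d'(1) x])
    have "\<bar>f y - f z\<bar> < r" if y: "y \<in> V" and yz: "(y, z) \<in> d'" for y z
    proof -
      have xy: "(x, y) \<in> d'" using V(3) y by auto
      have "(y, y) \<in> d'" using uniform_structure_refl[OF us d'(1)] uniform_structure_subset[OF us d'(1)] yz by blast
      then have "(x, y) \<in> d" "(x, z) \<in> d" using d'(3) xy yz by auto
      then have "y \<in> U" "z \<in> U" using d(2) by auto
      then have "dist (f x) (f y) < r/2" "dist (f x) (f z) < r/2" by (simp_all add: U_def)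
      then show ?thesis unfolding dist_real_def by linarith
    qed
    then show ?thesis using V(1,2) d'(1) by (intro exI[of _ V] conjI bexI[of _ d']) auto
  qed
  obtain F V where F: "finite F" "F \<subseteq> topspace X" "topspace X = (\<Union>x\<in>F. V x)"
    "\<And>x. x \<in> F \<Longrightarrow> openin X (V x)" "\<And>x. x \<in> F \<Longrightarrow> x \<in> V x"
    "\<And>x. x \<in> F \<Longrightarrow> \<exists>d\<in>\<mu>. \<forall>y\<in>V x. \<forall>z. (y, z) \<in> d \<longrightarrow> \<bar>f y - f z\<bar> < r"
    using compact_space_finite_subcover[OF assms(1) local] by metis
  obtain d where d: "\<And>x. x \<in> F \<Longrightarrow> d x \<in> \<mu>"
      "\<And>x y z. x \<in> F \<Longrightarrow> y \<in> V x \<Longrightarrow> (y, z) \<in> d x \<Longrightarrow> \<bar>f y - f z\<bar> < r"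
    using F(6) by metis
  \<comment> \<open>An auxiliary entourage confines \<open>D\<close> to pairs of points of
    \<open>X\<close> and serves alone when \<open>F\<close> is empty.\<close>
  obtain e0 where e0: "e0 \<in> \<mu>" using conjunct1[OF us[unfolded uniform_structure_def]] by blast
  define D where "D = e0 \<inter> (\<Inter>x\<in>F. d x)"
  have "D \<in> \<mu>"
  proof (cases "F = {}")
    case True then show ?thesis using e0 by (simp add: D_def)
  next
    case False
    then show ?thesis unfolding D_def
      using uniform_structure_Int[OF us e0 uniform_structure_INT[OF us F(1) False d(1)]] by simp
  qed
  moreover have "D \<subseteq> ?E"
  proof clarify
    fix y z assume yz: "(y, z) \<in> D"
    then have yzX: "y \<in> topspace X" "z \<in> topspace X"
      using uniform_structure_subset[OF us e0] by (auto simp: D_def)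
    then obtain x where "x \<in> F" "y \<in> V x" using F(3) by auto
    then show "(y, z) \<in> topspace X \<times> topspace X \<and> \<bar>f y - f z\<bar> < r"
      using d(2)[of x y z] yz yzX by (auto simp: D_def)
  qed
  ultimately show ?thesis by (rule uniform_structure_mono[OF us]) auto
qed

text \<open>Compactness of the square of \<open>X\<close>. Near the diagonal pairs lie in
  \<open>e\<close> without any test; near a pair off the diagonal some \<open>f\<close> keeps values
  more than half of their original gap apart, so the premise with that \<open>\<delta>\<close>
  fails. Finitely many local tests are combined, with the least of their constants.\<close>

lemma separating_family_entourage:
  fixes \<F> :: "('x \<Rightarrow> real) set"
  assumes "compact_space X" and comp: "compatible_uniformity X \<mu>" and "e \<in> \<mu>"
    and cont: "\<And>f. f \<in> \<F> \<Longrightarrow> continuous_map X euclideanreal f"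
    and sep: "\<And>x y. x \<in> topspace X \<Longrightarrow> y \<in> topspace X \<Longrightarrow> x \<noteq> y \<Longrightarrow> \<exists>f\<in>\<F>. f x \<noteq> f y"
  obtains F \<delta> where "finite F" "F \<subseteq> \<F>" "\<delta> > (0::real)"
    "\<forall>x\<in>topspace X. \<forall>y\<in>topspace X. (\<forall>f\<in>F. \<bar>f x - f y\<bar> < \<delta>) \<longrightarrow> (x, y) \<in> e"
proof -
  have us: "uniform_structure (topspace X) \<mu>"
    using comp by (auto simp: compatible_uniformity_def)
  let ?XX = "prod_topology X X"
  define W where "W U F \<delta> \<longleftrightarrow> finite F \<and> F \<subseteq> \<F> \<and> \<delta> > (0::real) \<and>
      (\<forall>(a, b)\<in>U. (\<forall>f\<in>F. \<bar>f a - f b\<bar> < \<delta>) \<longrightarrow> (a, b) \<in> e)" for U F \<delta>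
  define P where "P = (\<lambda>(p :: 'x \<times> 'x) U. \<exists>F \<delta>. W U F \<delta>)"
  have local: "\<exists>U. openin ?XX U \<and> p \<in> U \<and> P p U" if p: "p \<in> topspace ?XX" for p
  proof -
    obtain x y where xy: "p = (x, y)" "x \<in> topspace X" "y \<in> topspace X" using p by auto
    show ?thesis
    proof (cases "x = y")
      case True
      obtain d where d: "d \<in> \<mu>" "sym d" "d O d \<subseteq> e" by (rule uniform_structure_half[OF us assms(3)])
      obtain V where V: "openin X V" "x \<in> V" "V \<subseteq> d `` {x}"
        by (rule compatible_uniformity_nbhd[OF comp d(1) xy(2)])
      have "(a, b) \<in> e" if "a \<in> V" "b \<in> V" for a b
      proof -
        have 1: "(x, a) \<in> d" and 2: "(x, b) \<in> d" using V(3) that by auto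
        show ?thesis by (rule subsetD[OF d(3) relcompI[OF symD[OF d(2) 1] 2]])
      qed
      then have "P p (V \<times> V)" unfolding P_def W_def
        by (intro exI[of _ "{}"] exI[of _ "1::real"]) auto
      moreover have "openin ?XX (V \<times> V)" using V(1) by (simp add: openin_prod_Times_iff)
      ultimately show ?thesis using V(2) True xy(1) by blast
    next
      case False
      then obtain f where f: "f \<in> \<F>" "f x \<noteq> f y" using sep xy by blast
      define \<delta> where "\<delta> = \<bar>f x - f y\<bar> / 2"
      have "\<delta> > 0" using f by (simp add: \<delta>_def)
      define U where "U = {p \<in> topspace ?XX. \<bar>f (fst p) - f (snd p)\<bar> \<in> {\<delta><..}}"
      have "continuous_map ?XX euclideanreal (\<lambda>p. \<bar>f (fst p) - f (snd p)\<bar>)"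
        using continuous_map_compose[OF continuous_map_fst cont[OF f(1)], of X]
          continuous_map_compose[OF continuous_map_snd cont[OF f(1)], of X]
        by (intro continuous_map_real_abs continuous_map_diff) (simp_all add: o_def)
      then have "openin ?XX U" unfolding U_def by (rule openin_continuous_map_preimage) simp
      moreover have "p \<in> U" using xy \<open>\<delta> > 0\<close> by (simp add: U_def \<delta>_def)
      moreover have "P p U" unfolding P_def W_def
        using f(1) \<open>\<delta> > 0\<close> by (intro exI[of _ "{f}"] exI[of _ \<delta>]) (auto simp: U_def)
      ultimately show ?thesis by blast
    qed
  qed
  have "compact_space ?XX" using assms(1) by (simp add: compact_space_prod_topology)
  then obtain Q U where Q: "finite Q" "Q \<subseteq> topspace ?XX" "topspace ?XX = (\<Union>x\<in>Q. U x)"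
    "\<And>x. x \<in> Q \<Longrightarrow> openin ?XX (U x)" "\<And>x. x \<in> Q \<Longrightarrow> x \<in> U x" "\<And>x. x \<in> Q \<Longrightarrow> P x (U x)"
    using compact_space_finite_subcover[OF _ local] by metis
  obtain F \<delta> where "\<And>p. p \<in> Q \<Longrightarrow> W (U p) (F p) (\<delta> p)"
    using Q(6) unfolding P_def by metis
  then have F: "\<And>p. p \<in> Q \<Longrightarrow> finite (F p)" "\<And>p. p \<in> Q \<Longrightarrow> F p \<subseteq> \<F>" "\<And>p. p \<in> Q \<Longrightarrow> \<delta> p > 0"
     "\<And>p. p \<in> Q \<Longrightarrow> \<forall>(a, b)\<in>U p. (\<forall>f\<in>F p. \<bar>f a - f b\<bar> < \<delta> p) \<longrightarrow> (a, b) \<in> e"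
    by (simp_all add: W_def)
  show ?thesis
  proof (rule that, goal_cases)
    case 1 show "finite (\<Union>p\<in>Q. F p)" using Q(1) F(1) by auto
  next
    case 2 show "(\<Union>p\<in>Q. F p) \<subseteq> \<F>" using F(2) by auto
  next
    case 3 show "Min (insert 1 (\<delta> ` Q)) > 0" using Q(1) F(3) by (subst Min_gr_iff) auto
  next
    case 4 show "\<forall>x\<in>topspace X. \<forall>y\<in>topspace X.
        (\<forall>f\<in>(\<Union>p\<in>Q. F p). \<bar>f x - f y\<bar> < Min (insert 1 (\<delta> ` Q))) \<longrightarrow> (x, y) \<in> e"
    proof (intro ballI impI)
      fix x y assume xy: "x \<in> topspace X" "y \<in> topspace X"
        and small: "\<forall>f\<in>(\<Union>p\<in>Q. F p). \<bar>f x - f y\<bar> < Min (insert 1 (\<delta> ` Q))"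
      have "(x, y) \<in> topspace ?XX" using xy by simp
      then have "(x, y) \<in> (\<Union>x\<in>Q. U x)" by (simp only: Q(3))
      then obtain p where p: "p \<in> Q" "(x, y) \<in> U p" by blast
      have le: "Min (insert 1 (\<delta> ` Q)) \<le> \<delta> p" using p(1) Q(1) by (intro Min_le) auto
      have "\<bar>f x - f y\<bar> < \<delta> p" if "f \<in> F p" for f
      proof -
        have "f \<in> (\<Union>p\<in>Q. F p)" using p(1) that by blast
        then show ?thesis using small le by (meson less_le_trans)
      qed
      then show "(x, y) \<in> e" using bspec[OF F(4)[OF p(1)] p(2)] by simp
    qed
  qed
qed

lemma continuous_functions_separate:
  assumes "compact_space X" "Hausdorff_space X" "x \<in> topspace X" "y \<in> topspace X" "x \<noteq> y"
  obtains f where "continuous_map X euclideanreal f" "f ` topspace X \<subseteq> {0..1::real}" "f x \<noteq> f y"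
proof -
  have "normal_space X"
    using assms(1,2) by (simp add: compact_Hausdorff_or_regular_imp_normal_space)
  moreover have "closedin X {x}" "closedin X {y}"
    using assms by (simp_all add: closedin_Hausdorff_singleton)
  ultimately obtain f where f: "continuous_map X (top_of_set {0..1::real}) f" "f ` {x} \<subseteq> {0}" "f ` {y} \<subseteq> {1}"
    using Urysohn_lemma[of X "{x}" "{y}" 0 1] assms(5) by auto
  show ?thesis
  proof
    show "continuous_map X euclideanreal f" "f ` topspace X \<subseteq> {0..1}"
      using f(1) by (auto simp: continuous_map_in_subtopology)
    show "f x \<noteq> f y" using f by auto
  qed
qed

text \<open>The uniform Lindelof property at scale \<open>r\<close> for the pseudometric given by
  the supremum over \<open>J\<close>. Small cells replace sections around centres, so that passing
  to subsets and countable unions needs no new centres.\<close>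

definition sigma_small :: "('i \<Rightarrow> 'x \<Rightarrow> real) \<Rightarrow> 'i set \<Rightarrow> real \<Rightarrow> 'x set \<Rightarrow> bool" where
  "sigma_small c J r P \<longleftrightarrow>
     (\<exists>\<A>. countable \<A> \<and> P \<subseteq> \<Union>\<A> \<and> (\<forall>A\<in>\<A>. \<forall>x\<in>A. \<forall>y\<in>A. \<forall>i\<in>J. \<bar>c i x - c i y\<bar> < r))"

lemma sigma_small_UN:
  assumes "countable I" "\<And>i. i \<in> I \<Longrightarrow> sigma_small c J r (P i)"
  shows "sigma_small c J r (\<Union>i\<in>I. P i)"
proof -
  obtain \<A> where "\<And>i. i \<in> I \<Longrightarrow> countable (\<A> i) \<and> P i \<subseteq> \<Union>(\<A> i) \<and>
      (\<forall>A\<in>\<A> i. \<forall>x\<in>A. \<forall>y\<in>A. \<forall>i\<in>J. \<bar>c i x - c i y\<bar> < r)"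
    using assms(2) unfolding sigma_small_def by metis
  note A = this
  show ?thesis unfolding sigma_small_def
  proof (intro exI[of _ "\<Union>i\<in>I. \<A> i"] conjI)
    show "countable (\<Union>i\<in>I. \<A> i)" using assms(1) A by (intro countable_UN) auto
    show "(\<Union>i\<in>I. P i) \<subseteq> \<Union> (\<Union>i\<in>I. \<A> i)" using A by fastforce
    show "\<forall>A\<in>\<Union>i\<in>I. \<A> i. \<forall>x\<in>A. \<forall>y\<in>A. \<forall>i\<in>J. \<bar>c i x - c i y\<bar> < r"
    proof
      fix B assume "B \<in> (\<Union>i\<in>I. \<A> i)"
      then obtain i where "i \<in> I" "B \<in> \<A> i" by auto
      then show "\<forall>x\<in>B. \<forall>y\<in>B. \<forall>i\<in>J. \<bar>c i x - c i y\<bar> < r" using A[of i] by simp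
    qed
  qed
qed

lemma sigma_small_subset: "sigma_small c J r P \<Longrightarrow> Q \<subseteq> P \<Longrightarrow> sigma_small c J r Q"
  unfolding sigma_small_def by (meson order_trans)

lemma sigma_small_single:
  "(\<And>x y i. x \<in> P \<Longrightarrow> y \<in> P \<Longrightarrow> i \<in> J \<Longrightarrow> \<bar>c i x - c i y\<bar> < r) \<Longrightarrow> sigma_small c J r P"
  unfolding sigma_small_def by (intro exI[of _ "{P}"]) auto

lemma sigma_small_Un:
  "sigma_small c J r P \<Longrightarrow> sigma_small c J r Q \<Longrightarrow> sigma_small c J r (P \<union> Q)"
  using sigma_small_UN[of "{True, False}" c J r "\<lambda>b. if b then P else Q"] by (simp add: Un_commute)

text \<open>Testing fragmentation on \<open>K\<close> transfers it from \<open>X\<close> to the image of \<open>X\<close> under \<open>c\<close>, which is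
  second countable for countable \<open>J\<close>.\<close>

lemma minimal_closed_meeting_fibres:
  fixes c :: "'i \<Rightarrow> 'x \<Rightarrow> real"
  assumes X: "compact_space X" and cont: "\<And>i. i \<in> J \<Longrightarrow> continuous_map X euclideanreal (c i)"
    and R: "closedin X R"
  obtains K where "closedin X K" "K \<subseteq> R" "\<forall>x\<in>R. \<exists>y\<in>K. \<forall>i\<in>J. c i x = c i y"
    "\<forall>S. openin X S \<and> S \<inter> K \<noteq> {} \<longrightarrow> (\<exists>x\<in>R. \<forall>y\<in>K. (\<forall>i\<in>J. c i x = c i y) \<longrightarrow> y \<in> S)"
proof -
  define Z where "Z x = {y \<in> R. \<forall>i\<in>J. c i x = c i y}" for x
  have Zc: "compactin X (Z x)" for x
  proof -
    have "closedin X {y \<in> topspace X. c i y \<in> {c i x}}" if "i \<in> J" for i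
      by (rule closedin_continuous_map_preimage[OF cont[OF that]]) simp
    then have "closedin X (\<Inter>(insert R ((\<lambda>i. {y \<in> topspace X. c i y \<in> {c i x}}) ` J)))"
      using R by (intro closedin_Inter) auto
    also have "\<Inter>(insert R ((\<lambda>i. {y \<in> topspace X. c i y \<in> {c i x}}) ` J)) = Z x"
      using closedin_subset[OF R] by (auto simp: Z_def)
    finally show ?thesis using X closedin_compact_space by blast
  qed
  \<comment> \<open>Open sets that contain no whole fibre; the complement in \<open>R\<close> of a
    maximal one is a minimal closed set meeting every fibre.\<close>
  define \<U> where "\<U> = {U. openin X U \<and> (\<forall>x\<in>R. \<not> Z x \<subseteq> U)}"
  have "\<exists>M\<in>\<U>. \<forall>U\<in>\<U>. M \<subseteq> U \<longrightarrow> U = M"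
  proof (rule subset_Zorn')
    fix C assume C: "subset.chain \<U> C"
    then have CU: "C \<subseteq> \<U>" by (simp add: subset.chain_def)
    have "\<not> Z x \<subseteq> \<Union>C" if x: "x \<in> R" for x
    proof
      assume "Z x \<subseteq> \<Union>C"
      \<comment> \<open>By compactness finitely many members of the chain would cover the fibre, and
        the largest of these would already contain it.\<close>
      then obtain \<F> where F: "finite \<F>" "\<F> \<subseteq> C" "Z x \<subseteq> \<Union>\<F>"
        using Zc[of x] CU unfolding compactin_def \<U>_def by (metis (no_types, lifting) mem_Collect_eq subsetD)
      have "x \<in> Z x" using x by (simp add: Z_def)
      then have "\<F> \<noteq> {}" using F(3) by auto
      moreover have "subset.chain \<U> \<F>" using C F(2) unfolding subset_chain_def by (meson order_trans subsetD)
      ultimately have "\<Union>\<F> \<in> \<F>" using F(1) by (intro Union_in_chain)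
      then have "\<Union>\<F> \<in> \<U>" using F(2) CU by auto
      then show False using F(3) x by (simp add: \<U>_def)
    qed
    then show "\<Union>C \<in> \<U>" using CU by (auto simp: \<U>_def)
  qed
  then obtain M where M: "M \<in> \<U>" "\<And>U. U \<in> \<U> \<Longrightarrow> M \<subseteq> U \<Longrightarrow> U = M" by metis
  show ?thesis
  proof
    have Mo: "openin X M" using M(1) by (simp add: \<U>_def)
    then show "closedin X (R - M)" using R by (simp add: closedin_diff)
    show "R - M \<subseteq> R" by auto
    show "\<forall>x\<in>R. \<exists>y\<in>R - M. \<forall>i\<in>J. c i x = c i y"
      using M(1) unfolding \<U>_def Z_def by blast
    show "\<forall>S. openin X S \<and> S \<inter> (R - M) \<noteq> {} \<longrightarrow>
      (\<exists>x\<in>R. \<forall>y\<in>R - M. (\<forall>i\<in>J. c i x = c i y) \<longrightarrow> y \<in> S)"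
    proof (intro allI impI, elim conjE, rule ccontr)
      fix S assume S: "openin X S" "S \<inter> (R - M) \<noteq> {}"
        and neg: "\<not> (\<exists>x\<in>R. \<forall>y\<in>R - M. (\<forall>i\<in>J. c i x = c i y) \<longrightarrow> y \<in> S)"
      \<comment> \<open>If no fibre had its part outside \<open>M\<close> inside \<open>S\<close>,
        then \<open>M \<union> S\<close> would still belong to \<open>\<U>\<close>, and maximality
        would force \<open>S\<close> into \<open>M\<close>.\<close>
      have "\<not> Z x \<subseteq> M \<union> S" if "x \<in> R" for x
        using neg that unfolding Z_def by blast
      then have "M \<union> S \<in> \<U>" using Mo S(1) by (simp add: \<U>_def openin_Un)
      then have "M \<union> S = M" by (rule M(2)) simp
      then show False using S(2) by auto
    qed
  qed
qed

text \<open>Removal in the manner of Cantor and Bendixson: \<open>U\<close> collects the countably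
  many rational boxes that are themselves \<open>sigma_small\<close>. If a remainder
  \<open>R\<close> were left, fragmentation of the set \<open>K\<close> would give a box around a
  point of \<open>R\<close> whose remaining part is a single small cell. This box would then belong
  to \<open>U\<close>, a contradiction.\<close>

lemma fragmented_imp_sigma_small:
  fixes c :: "'i \<Rightarrow> 'x \<Rightarrow> real"
  assumes X: "compact_space X" and J: "countable J"
    and cont: "\<And>i. i \<in> J \<Longrightarrow> continuous_map X euclideanreal (c i)"
    and frag: "\<And>A. A \<noteq> {} \<Longrightarrow> A \<subseteq> topspace X \<Longrightarrow>
       \<exists>S. openin X S \<and> S \<inter> A \<noteq> {} \<and> (\<forall>x\<in>S \<inter> A. \<forall>y\<in>S \<inter> A. \<forall>i\<in>J. \<bar>c i x - c i y\<bar> < r)"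
  shows "sigma_small c J r (topspace X)"
proof -
  define box where "box F = {x \<in> topspace X. \<forall>(i, s, t)\<in>F. s < c i x \<and> c i x < t}" for F
  define \<B> where "\<B> = box ` {F. finite F \<and> F \<subseteq> J \<times> \<rat> \<times> \<rat>}"
  have cB: "countable \<B>" unfolding \<B>_def
    using J countable_rat by (intro countable_image countable_Collect_finite_subset) auto
  have oB: "openin X (box F)" if "finite F" "F \<subseteq> J \<times> \<rat> \<times> \<rat>" for F
  proof -
    have "openin X {x \<in> topspace X. c i x \<in> {s<..<t}}" if "i \<in> J" for i s t
      by (rule openin_continuous_map_preimage[OF cont[OF that]]) simp
    then have "openin X (topspace X \<inter> \<Inter> ((\<lambda>(i, s, t). {x \<in> topspace X. c i x \<in> {s<..<t}}) ` F))"
      using that by (cases "F = {}") (auto intro!: openin_Int_Inter)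
    also have "topspace X \<inter> \<Inter> ((\<lambda>(i, s, t). {x \<in> topspace X. c i x \<in> {s<..<t}}) ` F) = box F"
      by (auto simp: box_def split: prod.splits)
    finally show ?thesis .
  qed
  define U where "U = \<Union>{B \<in> \<B>. sigma_small c J r B}"
  have "sigma_small c J r (\<Union>B\<in>{B \<in> \<B>. sigma_small c J r B}. B)"
    by (rule sigma_small_UN) (auto intro: countable_subset[OF _ cB])
  then have sU: "sigma_small c J r U" by (simp only: U_def image_ident)
  define R where "R = topspace X - U"
  have "openin X U" unfolding U_def using oB by (intro openin_Union) (auto simp: \<B>_def)
  then have R: "closedin X R" unfolding R_def by (intro closedin_diff closedin_topspace)
  have "R = {}"
  proof (rule ccontr)
    assume "R \<noteq> {}"
    obtain K where K: "closedin X K" "K \<subseteq> R" "\<forall>x\<in>R. \<exists>y\<in>K. \<forall>i\<in>J. c i x = c i y"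
      "\<forall>S. openin X S \<and> S \<inter> K \<noteq> {} \<longrightarrow> (\<exists>x\<in>R. \<forall>y\<in>K. (\<forall>i\<in>J. c i x = c i y) \<longrightarrow> y \<in> S)"
      by (rule minimal_closed_meeting_fibres[OF X cont R])
    have "K \<noteq> {}" using K(3) \<open>R \<noteq> {}\<close> by auto
    obtain S where S: "openin X S" "S \<inter> K \<noteq> {}"
        "\<forall>x\<in>S \<inter> K. \<forall>y\<in>S \<inter> K. \<forall>i\<in>J. \<bar>c i x - c i y\<bar> < r"
      using frag[OF \<open>K \<noteq> {}\<close> closedin_subset[OF K(1)]] by (elim exE conjE)
    obtain x where x: "x \<in> R" "\<And>y. y \<in> K \<Longrightarrow> (\<forall>i\<in>J. c i x = c i y) \<Longrightarrow> y \<in> S"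
      using K(4)[rule_format, OF conjI[OF S(1,2)]] by auto
    define L where "L = K - S"
    have Lc: "compactin X L" unfolding L_def
      using X K(1) S(1) by (intro closedin_compact_space closedin_diff)
    \<comment> \<open>The part of \<open>K\<close> over the image of \<open>x\<close> lies in
      \<open>S\<close>, so no point of the compact set \<open>L\<close> has the same image as
      \<open>x\<close>. Finitely many rational conditions therefore give a box around
      \<open>x\<close> that misses \<open>L\<close>.\<close>
    have local: "\<exists>i s t. i \<in> J \<and> s \<in> \<rat> \<and> t \<in> \<rat> \<and> s < c i x \<and> c i x < t \<and> c i y \<notin> {s..t}" if "y \<in> L" for y
    proof -
      have "\<exists>i\<in>J. c i x \<noteq> c i y" using x(2)[of y] that by (auto simp: L_def)
      then obtain i where i: "i \<in> J" "c i x \<noteq> c i y" by blast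
      let ?a = "\<bar>c i x - c i y\<bar>"
      have "?a > 0" using i by simp
      obtain s where "s \<in> \<rat>" "c i x - ?a < s" "s < c i x" using Rats_dense_in_real[of "c i x - ?a" "c i x"] \<open>?a > 0\<close> by auto
      moreover obtain t where "t \<in> \<rat>" "c i x < t" "t < c i x + ?a" using Rats_dense_in_real[of "c i x" "c i x + ?a"] \<open>?a > 0\<close> by auto
      ultimately show ?thesis using i(1) by (intro exI[of _ i] exI[of _ s] exI[of _ t]) auto
    qed
    define Q where "Q = {(i, s, t). i \<in> J \<and> s \<in> \<rat> \<and> t \<in> \<rat> \<and> s < c i x \<and> c i x < t}"
    define out where "out = (\<lambda>(i, s, t). {y \<in> topspace X. c i y \<in> - {s..t}})"
    have "\<forall>V\<in>out ` Q. openin X V"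
    proof clarify
      fix i s t assume "(i, s, t) \<in> Q"
      then have "i \<in> J" by (simp add: Q_def)
      show "openin X (out (i, s, t))" unfolding out_def prod.case
        by (rule openin_continuous_map_preimage[OF cont[OF \<open>i \<in> J\<close>]]) auto
    qed
    moreover have "L \<subseteq> \<Union>(out ` Q)"
    proof
      fix y assume y: "y \<in> L"
      then obtain i s t where "i \<in> J \<and> s \<in> \<rat> \<and> t \<in> \<rat> \<and> s < c i x \<and> c i x < t \<and> c i y \<notin> {s..t}"
        using local by blast
      moreover have "y \<in> topspace X" using y closedin_subset[OF K(1)] by (auto simp: L_def)
      ultimately have "(i, s, t) \<in> Q" "y \<in> out (i, s, t)" by (simp_all add: Q_def out_def)
      then show "y \<in> \<Union>(out ` Q)" by blast
    qed
    ultimately obtain \<F> where "finite \<F>" "\<F> \<subseteq> out ` Q" "L \<subseteq> \<Union>\<F>"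
      using Lc unfolding compactin_def by metis
    then obtain F where F: "finite F" "F \<subseteq> Q" "L \<subseteq> \<Union>(out ` F)" using finite_subset_image by metis
    have xB: "x \<in> box F" using F(2) x(1) by (auto simp: box_def Q_def R_def)
    have FB: "box F \<in> \<B>" unfolding \<B>_def using F(1,2) by (auto simp: Q_def)
    have disj: "y \<notin> L" if "y \<in> box F" for y
    proof
      assume "y \<in> L"
      then obtain i s t where "(i, s, t) \<in> F" "y \<in> out (i, s, t)" using F(3) by fastforce
      then show False using that by (auto simp: box_def out_def)
    qed
    \<comment> \<open>A box is described by values of \<open>c\<close> alone, so a point of
      \<open>R\<close> in it may be exchanged for a point of \<open>K\<close> with the same values.
      This one avoids \<open>L\<close> and hence lies in \<open>S\<close>.\<close>
    have toK: "\<exists>z\<in>S \<inter> K. \<forall>i\<in>J. c i y = c i z" if y: "y \<in> box F \<inter> R" for y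
    proof -
      obtain z where z: "z \<in> K" "\<forall>i\<in>J. c i y = c i z" using K(3) y by auto
      have "z \<in> box F" using y z F(2) closedin_subset[OF K(1)] by (fastforce simp: box_def Q_def)
      then show ?thesis using disj[of z] z by (auto simp: L_def)
    qed
    have "sigma_small c J r (box F \<inter> R)"
    proof (rule sigma_small_single)
      fix y y' i assume y: "y \<in> box F \<inter> R" "y' \<in> box F \<inter> R" and i: "i \<in> J"
      obtain z where "z \<in> S \<inter> K" "\<forall>i\<in>J. c i y = c i z" using toK[OF y(1)] by blast
      moreover obtain z' where "z' \<in> S \<inter> K" "\<forall>i\<in>J. c i y' = c i z'" using toK[OF y(2)] by blast
      ultimately show "\<bar>c i y - c i y'\<bar> < r" using S(3) i by simp
    qed
    then have "sigma_small c J r (U \<union> (box F \<inter> R))" using sU by (intro sigma_small_Un)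
    moreover have "box F \<subseteq> U \<union> (box F \<inter> R)" by (auto simp: box_def R_def)
    ultimately have "sigma_small c J r (box F)" by (rule sigma_small_subset)
    then have "box F \<subseteq> U" using FB unfolding U_def by auto
    then show False using xB x(1) by (auto simp: R_def)
  qed
  then have "topspace X \<subseteq> U" by (auto simp: R_def)
  then show ?thesis using sU sigma_small_subset by metis
qed

context compact_system
begin

text \<open>Finitely many functions decide the entourage \<open>e\<close>. Cells on which all their
  compositions with \<open>H\<close> oscillate by less than \<open>\<delta>\<close> lie in one
  section each, and a point chosen from each cell that meets \<open>X\<close> serves as
  centre.\<close>

lemma Lindelof_of_sigma_small:
  assumes e: "e \<in> \<mu>" and \<F>: "\<And>f. f \<in> \<F> \<Longrightarrow> continuous_map X euclideanreal f"
    and sep: "\<And>x y. x \<in> topspace X \<Longrightarrow> y \<in> topspace X \<Longrightarrow> x \<noteq> y \<Longrightarrow> \<exists>f\<in>\<F>. f x \<noteq> f y"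
    and small: "\<And>F r. finite F \<Longrightarrow> F \<subseteq> \<F> \<Longrightarrow> r > 0 \<Longrightarrow>
        sigma_small (\<lambda>(h, f) x. f (act h x)) (H \<times> F) r (topspace X)"
    and H: "H \<subseteq> carrier G"
  shows "\<exists>C. countable C \<and> C \<subseteq> topspace X \<and> topspace X \<subseteq> (\<Union>y\<in>C. H_small H e `` {y})"
proof -
  obtain F \<delta> where F: "finite F" "F \<subseteq> \<F>" "\<delta> > (0::real)"
    "\<forall>x\<in>topspace X. \<forall>y\<in>topspace X. (\<forall>f\<in>F. \<bar>f x - f y\<bar> < \<delta>) \<longrightarrow> (x, y) \<in> e"
    by (rule separating_family_entourage[OF compact compat e \<F> sep])
  obtain \<A> where A: "countable \<A>" "topspace X \<subseteq> \<Union>\<A>"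
    "\<And>A x y h f. A \<in> \<A> \<Longrightarrow> x \<in> A \<Longrightarrow> y \<in> A \<Longrightarrow> h \<in> H \<Longrightarrow> f \<in> F \<Longrightarrow> \<bar>f (act h x) - f (act h y)\<bar> < \<delta>"
    using small[OF F(1-3)] unfolding sigma_small_def by fastforce
  define p where "p A = (SOME x. x \<in> A \<inter> topspace X)" for A
  define C where "C = p ` {A \<in> \<A>. A \<inter> topspace X \<noteq> {}}"
  have p: "p A \<in> A \<inter> topspace X" if "A \<inter> topspace X \<noteq> {}" for A
    unfolding p_def by (rule someI_ex) (use that in auto)
  show ?thesis
  proof (intro exI[of _ C] conjI subsetI)
    show "countable C" unfolding C_def using A(1) by auto
    show "x \<in> topspace X" if "x \<in> C" for x using that p unfolding C_def by auto
    fix x assume x: "x \<in> topspace X"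
    then obtain A where A': "A \<in> \<A>" "x \<in> A" using A(2) by auto
    have "A \<inter> topspace X \<noteq> {}" using A' x by auto
    then have pA: "p A \<in> A" "p A \<in> topspace X" "p A \<in> C" using p A'(1) by (auto simp: C_def)
    have "(act h (p A), act h x) \<in> e" if "h \<in> H" for h
      using that H pA x A' by (intro F(4)[rule_format] A(3)[of A]) auto
    then have "(p A, x) \<in> H_small H e" using pA x by (auto simp: H_small_def)
    then show "x \<in> (\<Union>y\<in>C. H_small H e `` {y})" using pA(3) by auto
  qed
qed

lemma continuous_act_compose:
  "g \<in> carrier G \<Longrightarrow> continuous_map X euclideanreal f \<Longrightarrow> continuous_map X euclideanreal (\<lambda>x. f (act g x))"
  by (rule continuous_map_compose[OF continuous_act, unfolded o_def])

text \<open>Fragmentation along the whole group, applied to an entourage on which finitely many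
  functions vary little, bounds the oscillation of all their translates at once. Countability of
  \<open>H\<close> enters through the index set \<open>H \<times> F\<close>.\<close>

lemma fragmented_imp_Lindelof:
  assumes "fragmented_family X \<mu> (act ` carrier G)"
  shows Lindelof_countable
  unfolding Lindelof_countable_def uniformly_Lindelof_subgroup_iff
proof (intro allI impI ballI, elim conjE)
  fix H e assume H: "subgroup H G" "countable H" and e: "e \<in> \<mu>"
  have HG: "H \<subseteq> carrier G" using H(1) by (rule subgroup.subset)
  show "\<exists>C. countable C \<and> C \<subseteq> topspace X \<and> topspace X \<subseteq> (\<Union>y\<in>C. H_small H e `` {y})"
  proof (rule Lindelof_of_sigma_small[OF e _ _ _ HG])
    let ?\<F> = "{f. continuous_map X euclideanreal f}"
    show "continuous_map X euclideanreal f" if "f \<in> ?\<F>" for f using that by simp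
    show "\<exists>f\<in>?\<F>. f x \<noteq> f y" if xy: "x \<in> topspace X" "y \<in> topspace X" "x \<noteq> y" for x y
    proof -
      obtain f where "continuous_map X euclideanreal f" "f ` topspace X \<subseteq> {0..1::real}" "f x \<noteq> f y"
        by (rule continuous_functions_separate[OF compact Hausdorff xy])
      then show ?thesis by auto
    qed
    fix F and r :: real assume F: "finite F" "F \<subseteq> ?\<F>" "r > 0"
    show "sigma_small (\<lambda>(h, f) x. f (act h x)) (H \<times> F) r (topspace X)"
    proof (rule fragmented_imp_sigma_small[OF compact])
      show "countable (H \<times> F)" using H(2) F(1) by (auto intro: countable_finite)
      show "continuous_map X euclideanreal ((\<lambda>(h, f) x. f (act h x)) i)" if "i \<in> H \<times> F" for i
        using that HG F(2) by (auto intro!: continuous_act_compose)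
      fix A assume A: "A \<noteq> {}" "A \<subseteq> topspace X"
      define E where "E f = {(x, y) \<in> topspace X \<times> topspace X. \<bar>f x - f y\<bar> < r}" for f :: "'x \<Rightarrow> real"
      have "E f \<in> \<mu>" if "f \<in> F" for f unfolding E_def
        using F(2,3) that by (intro uniform_continuity_compact[OF compact compat]) auto
      then have "e \<inter> (\<Inter>f\<in>F. E f) \<in> \<mu>"
        using uniform_structure_Int[OF uniform e uniform_structure_INT[OF uniform F(1)]] e
        by (cases "F = {}") auto
      then obtain S where S: "openin X S" "S \<inter> A \<noteq> {}"
        "\<forall>f\<in>act ` carrier G. small (e \<inter> (\<Inter>f\<in>F. E f)) (f ` (S \<inter> A))"
        using assms A unfolding fragmented_family_def by metis
      have "\<bar>f (act h x) - f (act h y)\<bar> < r" if "x \<in> S \<inter> A" "y \<in> S \<inter> A" "h \<in> H" "f \<in> F" for x y h f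
      proof -
        have "small (e \<inter> (\<Inter>f\<in>F. E f)) (act h ` (S \<inter> A))" using S(3) that(3) HG by auto
        then have "(act h x, act h y) \<in> e \<inter> (\<Inter>f\<in>F. E f)" using that(1,2) by (auto simp: small_def)
        then have "(act h x, act h y) \<in> E f" using that(4) by auto
        then show ?thesis by (simp add: E_def)
      qed
      then show "\<exists>S. openin X S \<and> S \<inter> A \<noteq> {} \<and> (\<forall>x\<in>S \<inter> A. \<forall>y\<in>S \<inter> A. \<forall>i\<in>H \<times> F.
         \<bar>(case i of (h, f) \<Rightarrow> \<lambda>x. f (act h x)) x - (case i of (h, f) \<Rightarrow> \<lambda>x. f (act h x)) y\<bar> < r)"
        using S(1,2) by (intro exI[of _ S] conjI) auto
    qed
  qed
qed

end

section \<open>Sublinear functionals and means\<close>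

text \<open>Homogeneity is stated as an inequality because infima inherit it directly; rescaling by
  the inverse of \<open>c\<close> turns it into an equality.\<close>

definition sublinear :: "('a::real_vector \<Rightarrow> real) \<Rightarrow> bool" where
  "sublinear p \<longleftrightarrow> p 0 = 0 \<and> (\<forall>x y. p (x + y) \<le> p x + p y) \<and> (\<forall>c>0. \<forall>x. p (c *\<^sub>R x) \<le> c * p x)"

lemma sublinear_neg_le: "sublinear p \<Longrightarrow> - p (- x) \<le> p x"
  unfolding sublinear_def by (metis add.right_inverse add_le_cancel_left neg_le_iff_le add.commute
      diff_ge_0_iff_ge le_diff_eq minus_le_iff add.left_neutral)

text \<open>The infimum over \<open>t \<ge> 0\<close> of
  \<open>m (x + t *\<^sub>R y) - t * m y\<close> is finite, being at least \<open>- m (- x)\<close>,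
  and is again sublinear and below \<open>m\<close>. Minimality makes it equal to \<open>m\<close>,
  and then \<open>t = 1\<close> yields superadditivity.\<close>

lemma minimal_sublinear_linear:
  assumes m: "sublinear m" and min: "\<And>q. sublinear q \<Longrightarrow> (\<And>x. q x \<le> m x) \<Longrightarrow> q = m"
  shows "linear m"
proof -
  have m0: "m 0 = 0" and madd: "\<And>x y. m (x + y) \<le> m x + m y"
    and mscale: "\<And>c x. c > 0 \<Longrightarrow> m (c *\<^sub>R x) \<le> c * m x"
    using m by (simp_all add: sublinear_def)
  have meq: "m (c *\<^sub>R x) = c * m x" if "c > 0" for c x
  proof (rule antisym[OF mscale[OF that]])
    have "m ((1/c) *\<^sub>R (c *\<^sub>R x)) \<le> (1/c) * m (c *\<^sub>R x)" using that by (intro mscale) simp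
    then show "c * m x \<le> m (c *\<^sub>R x)" using that by (simp add: field_simps)
  qed
  have super: "m x + m y \<le> m (x + y)" for x y
  proof -
    define q where "q x = (INF t\<in>{0..}. m (x + t *\<^sub>R y) - t * m y)" for x
    have lower: "- m (- x) \<le> m (x + t *\<^sub>R y) - t * m y" if "t \<ge> 0" for x t
    proof -
      have "m (t *\<^sub>R y) = t * m y" using meq m0 that by (cases "t = 0") auto
      moreover have "m (t *\<^sub>R y) \<le> m (x + t *\<^sub>R y) + m (- x)" using madd[of "x + t *\<^sub>R y" "- x"] by simp
      ultimately show ?thesis by simp
    qed
    have bdd: "bdd_below ((\<lambda>t. m (x + t *\<^sub>R y) - t * m y) ` {0..})" for x
      using lower by (intro bdd_belowI2) auto
    have qle: "q x \<le> m (x + t *\<^sub>R y) - t * m y" if "t \<ge> 0" for x t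
      unfolding q_def using that by (intro cINF_lower[OF bdd]) simp
    have qm: "q x \<le> m x" for x using qle[of 0 x] by simp
    have "sublinear q"
      unfolding sublinear_def
    proof (intro conjI allI impI)
      show "q 0 = 0"
      proof (rule antisym)
        show "q 0 \<le> 0" using qm[of 0] m0 by simp
        show "0 \<le> q 0" unfolding q_def using lower[of _ 0] m0 by (intro cINF_greatest) auto
      qed
    next
      fix a b
      have "q (a + b) - (m (b + s *\<^sub>R y) - s * m y) \<le> m (a + t *\<^sub>R y) - t * m y"
        if "t \<ge> 0" "s \<ge> 0" for t s
      proof -
        have "q (a + b) \<le> m (a + b + (t + s) *\<^sub>R y) - (t + s) * m y" using that by (intro qle) simp
        also have "m (a + b + (t + s) *\<^sub>R y) \<le> m (a + t *\<^sub>R y) + m (b + s *\<^sub>R y)"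
          using madd[of "a + t *\<^sub>R y" "b + s *\<^sub>R y"] by (simp add: scaleR_left_distrib algebra_simps)
        finally show ?thesis by (simp add: algebra_simps)
      qed
      then have "q (a + b) - (m (b + s *\<^sub>R y) - s * m y) \<le> q a" if "s \<ge> 0" for s
        unfolding q_def[of a] using that by (intro cINF_greatest) auto
      then have "q (a + b) - q a \<le> m (b + s *\<^sub>R y) - s * m y" if "s \<ge> 0" for s
        using that by (simp add: algebra_simps)
      then have "q (a + b) - q a \<le> q b" unfolding q_def[of b] by (intro cINF_greatest) auto
      then show "q (a + b) \<le> q a + q b" by simp
    next
      fix c :: real and a assume c: "c > 0"
      have "q (c *\<^sub>R a) / c \<le> m (a + t *\<^sub>R y) - t * m y" if "t \<ge> 0" for t
      proof -
        have "q (c *\<^sub>R a) \<le> m (c *\<^sub>R a + (c * t) *\<^sub>R y) - (c * t) * m y" using that c by (intro qle) simp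
        also have "c *\<^sub>R a + (c * t) *\<^sub>R y = c *\<^sub>R (a + t *\<^sub>R y)" by (simp add: scaleR_right_distrib)
        also have "m (c *\<^sub>R (a + t *\<^sub>R y)) = c * m (a + t *\<^sub>R y)" by (rule meq[OF c])
        finally show ?thesis using c by (simp add: field_simps)
      qed
      then have "q (c *\<^sub>R a) / c \<le> q a" unfolding q_def[of a] by (intro cINF_greatest) auto
      then show "q (c *\<^sub>R a) \<le> c * q a" using c by (simp add: field_simps)
    qed
    then have "q = m" using qm by (rule min)
    then show ?thesis using qle[of 1 x] by simp
  qed
  have add: "m (x + y) = m x + m y" for x y using super madd by (metis antisym)
  have neg: "m (- x) = - m x" for x using add[of x "- x"] m0 by simp
  have "m (c *\<^sub>R x) = c * m x" for c x
  proof (cases "c = 0 \<or> c > 0")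
    case True then show ?thesis using meq m0 by auto
  next
    case False
    then have "m ((- c) *\<^sub>R x) = - c * m x" by (intro meq) simp
    then show ?thesis using neg[of "c *\<^sub>R x"] by simp
  qed
  then show ?thesis using add by (intro linearI) simp_all
qed

text \<open>By Zorn there is a minimal sublinear function below \<open>p\<close>, and minimal ones
  are linear. The infimum of a chain is finite because every member is bounded below by
  \<open>- p (- x)\<close>.\<close>

theorem Hahn_Banach_sublinear:
  assumes p: "sublinear p"
  obtains L where "linear L" "\<forall>x. L x \<le> p x"
proof -
  define A where "A = {q. sublinear q \<and> (\<forall>x. q x \<le> p x)}"
  define P where "P a b \<longleftrightarrow> (\<forall>x. b x \<le> a x)" for a b :: "'a \<Rightarrow> real"
  have "\<exists>m\<in>A. \<forall>a\<in>A. P m a \<longrightarrow> a = m"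
  proof (rule predicate_Zorn)
    show "partial_order_on A (relation_of P A)"
      by (rule partial_order_on_relation_ofI) (auto simp: P_def fun_eq_iff intro: order_trans antisym)
    fix C assume C: "C \<in> Chains (relation_of P A)"
    have CA: "C \<subseteq> A" using C by (auto simp: Chains_def relation_of_def)
    have comp: "P a b \<or> P b a" if "a \<in> C" "b \<in> C" for a b
      using C that by (auto simp: Chains_def relation_of_def)
    show "\<exists>u\<in>A. \<forall>a\<in>C. P a u"
    proof (cases "C = {}")
      case True
      then show ?thesis using p by (auto simp: A_def)
    next
      case False
      define u where "u x = (INF q\<in>C. q x)" for x
      have lower: "- p (- x) \<le> q x" if "q \<in> C" for q x
      proof -
        have "sublinear q" "q (- x) \<le> p (- x)" using that CA by (auto simp: A_def)
        then show ?thesis using sublinear_neg_le[of q x] by simp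
      qed
      have bdd: "bdd_below ((\<lambda>q. q x) ` C)" for x using lower by (intro bdd_belowI2) auto
      have ule: "u x \<le> q x" if "q \<in> C" for q x unfolding u_def using that by (intro cINF_lower[OF bdd])
      have "sublinear u"
        unfolding sublinear_def
      proof (intro conjI allI impI)
        have "q 0 = 0" if "q \<in> C" for q using that CA by (auto simp: A_def sublinear_def)
        then have "u 0 = (INF q\<in>C. 0)" unfolding u_def by (intro INF_cong) auto
        then show "u 0 = 0" using False by simp
      next
        fix x y
        have "u (x + y) - q' y \<le> q x" if qq: "q \<in> C" "q' \<in> C" for q q'
        proof -
          \<comment> \<open>The smaller of two members of a chain serves both arguments, which makes
            the infimum subadditive.\<close>
          obtain r where r: "r \<in> C" "r x \<le> q x" "r y \<le> q' y"
            using comp[OF qq] qq unfolding P_def by blast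
          have "r (x + y) \<le> r x + r y" using r(1) CA by (auto simp: A_def sublinear_def)
          then show ?thesis using ule[OF r(1), of "x + y"] r by simp
        qed
        then have "u (x + y) - q' y \<le> u x" if "q' \<in> C" for q'
          unfolding u_def[of x] using that by (intro cINF_greatest[OF False]) auto
        then have "u (x + y) - u x \<le> q' y" if "q' \<in> C" for q' using that by (simp add: algebra_simps)
        then have "u (x + y) - u x \<le> u y" unfolding u_def[of y] by (intro cINF_greatest[OF False]) auto
        then show "u (x + y) \<le> u x + u y" by simp
      next
        fix c :: real and x assume c: "c > 0"
        have "u (c *\<^sub>R x) / c \<le> q x" if "q \<in> C" for q
        proof -
          have "q (c *\<^sub>R x) \<le> c * q x" using that CA c by (auto simp: A_def sublinear_def)
          then have "u (c *\<^sub>R x) \<le> c * q x" using ule[OF that, of "c *\<^sub>R x"] by simp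
          then show ?thesis using c by (simp add: field_simps)
        qed
        then have "u (c *\<^sub>R x) / c \<le> u x" unfolding u_def[of x] by (intro cINF_greatest[OF False]) auto
        then show "u (c *\<^sub>R x) \<le> c * u x" using c by (simp add: field_simps)
      qed
      moreover have "u x \<le> p x" for x
      proof -
        obtain q where "q \<in> C" using False by blast
        moreover then have "q x \<le> p x" using CA by (auto simp: A_def)
        ultimately show ?thesis using ule[of q x] by simp
      qed
      ultimately have "u \<in> A" by (simp add: A_def)
      then show ?thesis using ule by (auto simp: P_def)
    qed
  qed
  then obtain m where m: "m \<in> A" "\<And>a. a \<in> A \<Longrightarrow> P m a \<Longrightarrow> a = m" by metis
  have "linear m"
  proof (rule minimal_sublinear_linear)
    show "sublinear m" using m(1) by (simp add: A_def)
    fix q assume q: "sublinear q" "\<And>x. q x \<le> m x"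
    have "q x \<le> p x" for x using q(2)[of x] m(1) by (auto simp: A_def intro: order_trans)
    then show "q = m" using q by (intro m(2)) (auto simp: A_def P_def)
  qed
  then show ?thesis using m(1) that by (auto simp: A_def)
qed

text \<open>On the discrete copy of \<open>'x\<close> every function is continuous, so this is the Banach space of all
  bounded functions on \<open>'x\<close>.\<close>

type_synonym 'x bfun = "'x discrete \<Rightarrow>\<^sub>C real"

text \<open>Meant for bounded \<open>g\<close>: outside \<open>bcontfun\<close> the value of
  \<open>Bcontfun\<close> is unspecified, so evaluation goes through \<open>fn_bf\<close>.\<close>

definition bf :: "('x \<Rightarrow> real) \<Rightarrow> 'x bfun" where
  "bf g = Bcontfun (\<lambda>d. g (of_discrete d))"

definition fn :: "'x bfun \<Rightarrow> 'x \<Rightarrow> real" where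
  "fn v x = apply_bcontfun v (discrete x)"

lemma fn_simps [simp]:
  "fn (u + v) x = fn u x + fn v x" "fn (u - v) x = fn u x - fn v x" "fn (- v) x = - fn v x"
  "fn (c *\<^sub>R v) x = c * fn v x" "fn 0 x = 0"
  by (simp_all add: fn_def)

lemma fn_sum: "fn (\<Sum>i\<in>I. v i) x = (\<Sum>i\<in>I. fn (v i) x)"
  by (induction I rule: infinite_finite_induct) simp_all

lemma fn_bf:
  assumes "\<And>x. \<bar>g x\<bar> \<le> b" shows "fn (bf g) x = g x"
proof -
  have "(\<lambda>d. g (of_discrete d)) \<in> bcontfun"
    using assms by (intro bcontfun_normI[where b = b]) (auto intro!: continuous_on_open_vimage simp: open_discrete continuous_on_open_vimage)
  then show ?thesis by (simp add: fn_def bf_def Bcontfun_inverse discrete_inverse)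
qed

lemma fn_bf01: "(\<And>x. 0 \<le> g x \<and> g x \<le> 1) \<Longrightarrow> fn (bf g) x = g x"
  by (rule fn_bf[where b = 1]) (simp add: abs_le_iff order_trans[of _ 0])

lemma bfun_eqI: "(\<And>x. fn u x = fn v x) \<Longrightarrow> u = v"
  by (rule bcontfun_eqI) (metis fn_def of_discrete_inverse)

lemma abs_fn_le: "\<bar>fn v x\<bar> \<le> norm v"
  unfolding fn_def using norm_bounded[of v "discrete x"] by simp

lemma norm_bfun_le: "(\<And>x. \<bar>fn v x\<bar> \<le> b) \<Longrightarrow> norm v \<le> b"
  by (rule norm_bound) (metis fn_def of_discrete_inverse real_norm_def)

text \<open>Hahn-Banach for the infimum over \<open>w \<in> Q\<close> of the supremum of
  \<open>u + w\<close> on \<open>P\<close>. The supremum condition on \<open>Q\<close> keeps this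
  finite and makes it vanish at 0. A functional below it is bounded by suprema over \<open>P\<close>
  and cannot be negative on the cone.\<close>

lemma mean_nonneg_on_cone:
  fixes Q :: "'x bfun set"
  assumes Q0: "0 \<in> Q" and Qadd: "\<And>u v. u \<in> Q \<Longrightarrow> v \<in> Q \<Longrightarrow> u + v \<in> Q"
    and Qscale: "\<And>c u. c > 0 \<Longrightarrow> u \<in> Q \<Longrightarrow> c *\<^sub>R u \<in> Q"
    and Qsup: "\<And>w M. w \<in> Q \<Longrightarrow> (\<And>x. x \<in> P \<Longrightarrow> fn w x \<le> M) \<Longrightarrow> 0 \<le> M"
  obtains L :: "'x bfun \<Rightarrow> real" where "linear L" "\<And>u M. (\<And>x. x \<in> P \<Longrightarrow> fn u x \<le> M) \<Longrightarrow> L u \<le> M"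
    "\<And>w. w \<in> Q \<Longrightarrow> 0 \<le> L w"
proof -
  define B where "B u = {M. \<exists>w\<in>Q. \<forall>x\<in>P. fn u x + fn w x \<le> M}" for u
  define p where "p u = Inf (B u)" for u
  have lower: "- norm u \<le> M" if M: "M \<in> B u" for u M
  proof -
    obtain w where w: "w \<in> Q" "\<forall>x\<in>P. fn u x + fn w x \<le> M" using M by (auto simp: B_def)
    have "fn w x \<le> M + norm u" if "x \<in> P" for x
      using w(2) that abs_fn_le[of u x] by fastforce
    then have "0 \<le> M + norm u" by (rule Qsup[OF w(1)])
    then show ?thesis by simp
  qed
  have bdd: "bdd_below (B u)" for u using lower by (rule bdd_belowI)
  have ple: "p u \<le> M" if "w \<in> Q" "\<And>x. x \<in> P \<Longrightarrow> fn u x + fn w x \<le> M" for u w M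
    unfolding p_def using that by (intro cInf_lower[OF _ bdd]) (auto simp: B_def)
  have ne: "B u \<noteq> {}" for u
  proof -
    have "fn u x + fn 0 x \<le> norm u" for x using abs_fn_le[of u x] by simp
    then have "norm u \<in> B u" unfolding B_def using Q0 by blast
    then show ?thesis by auto
  qed
  have "sublinear p"
    unfolding sublinear_def
  proof (intro conjI allI impI)
    have "0 \<in> B 0" unfolding B_def using Q0 by (auto intro!: bexI[of _ 0])
    then have "p 0 \<le> 0" unfolding p_def by (intro cInf_lower[OF _ bdd])
    moreover have "0 \<le> p 0" unfolding p_def using lower[of _ 0] by (intro cInf_greatest[OF ne]) auto
    ultimately show "p 0 = 0" by simp
  next
    fix u v
    have "p (u + v) - N \<le> M" if MN: "M \<in> B u" "N \<in> B v" for M N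
    proof -
      obtain w where w: "w \<in> Q" "\<forall>x\<in>P. fn u x + fn w x \<le> M" using MN by (auto simp: B_def)
      obtain w' where w': "w' \<in> Q" "\<forall>x\<in>P. fn v x + fn w' x \<le> N" using MN by (auto simp: B_def)
      have "p (u + v) \<le> M + N"
        by (rule ple[OF Qadd[OF w(1) w'(1)]]) (use w(2) w'(2) in \<open>fastforce simp: algebra_simps\<close>)
      then show ?thesis by simp
    qed
    then have "p (u + v) - N \<le> p u" if "N \<in> B v" for N
      unfolding p_def[of u] using that by (intro cInf_greatest[OF ne]) auto
    then have "p (u + v) - p u \<le> N" if "N \<in> B v" for N using that by (simp add: algebra_simps)
    then have "p (u + v) - p u \<le> p v" unfolding p_def[of v] by (intro cInf_greatest[OF ne]) auto
    then show "p (u + v) \<le> p u + p v" by simp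
  next
    fix c :: real and u assume c: "c > 0"
    have "p (c *\<^sub>R u) / c \<le> M" if M: "M \<in> B u" for M
    proof -
      obtain w where w: "w \<in> Q" "\<forall>x\<in>P. fn u x + fn w x \<le> M" using M by (auto simp: B_def)
      have "fn (c *\<^sub>R u) x + fn (c *\<^sub>R w) x \<le> c * M" if "x \<in> P" for x
        using mult_left_mono[OF bspec[OF w(2) that], of c] c by (simp add: algebra_simps)
      then have "p (c *\<^sub>R u) \<le> c * M" by (rule ple[OF Qscale[OF c w(1)]])
      then show ?thesis using c by (simp add: field_simps)
    qed
    then have "p (c *\<^sub>R u) / c \<le> p u" unfolding p_def[of u] by (intro cInf_greatest[OF ne]) auto
    then show "p (c *\<^sub>R u) \<le> c * p u" using c by (simp add: field_simps)
  qed
  then obtain L where L: "linear L" "\<forall>u. L u \<le> p u" by (rule Hahn_Banach_sublinear)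
  show ?thesis
  proof (rule that[OF L(1)])
    show "L u \<le> M" if "\<And>x. x \<in> P \<Longrightarrow> fn u x \<le> M" for u M
    proof -
      have "p u \<le> M" by (rule ple[OF Q0]) (use that in simp)
      then show ?thesis using spec[OF L(2), of u] by simp
    qed
    show "0 \<le> L w" if "w \<in> Q" for w
    proof -
      \<comment> \<open>The vector \<open>w\<close> is its own competitor, as \<open>- w + w\<close>
        vanishes.\<close>
      have "p (- w) \<le> 0" by (rule ple[OF that]) simp
      then show ?thesis using spec[OF L(2), of "- w"] linear_neg[OF L(1), of w] by simp
    qed
  qed
qed

section \<open>Dini's theorem and bounded convergence for means\<close>

lemma Dini_compact:
  fixes h :: "nat \<Rightarrow> 'x \<Rightarrow> real"
  assumes X: "compact_space X" and cont: "\<And>m. continuous_map X euclideanreal (h m)"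
    and dec: "\<And>m x. h (Suc m) x \<le> h m x" and lim: "\<And>x. x \<in> topspace X \<Longrightarrow> (\<lambda>m. h m x) \<longlonglongrightarrow> 0" and r: "r > 0"
  shows "\<exists>m. \<forall>x\<in>topspace X. h m x < r"
proof (rule ccontr)
  assume neg: "\<not> ?thesis"
  define C where "C m = {x \<in> topspace X. h m x \<in> {r..}}" for m
  have "\<Inter>(range C) \<noteq> {}"
  proof (rule compact_space_imp_nest[OF X])
    show "closedin X (C n)" for n unfolding C_def
      by (rule closedin_continuous_map_preimage[OF cont]) simp
    show "C n \<noteq> {}" for n using neg by (force simp: C_def not_less)
    show "decseq C" using dec by (intro decseq_SucI) (auto simp: C_def intro: order_trans)
  qed
  then obtain x where x: "\<And>m. x \<in> C m" by auto
  then have "x \<in> topspace X" by (simp add: C_def)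
  then have "eventually (\<lambda>m. h m x < r) sequentially" using lim r by (intro order_tendstoD) auto
  then obtain m where "h m x < r" by (auto simp: eventually_sequentially)
  then show False using x[of m] by (simp add: C_def)
qed

text \<open>The block has \<open>k + 1\<close> members, from \<open>u m\<close> to
  \<open>u (m + k)\<close>, so no value for an empty maximum is required.\<close>

fun block_max :: "(nat \<Rightarrow> 'x \<Rightarrow> real) \<Rightarrow> nat \<Rightarrow> nat \<Rightarrow> 'x \<Rightarrow> real" where
  "block_max u m 0 = u m"
| "block_max u m (Suc k) = (\<lambda>x. max (block_max u m k x) (u (m + Suc k) x))"

lemma block_max_mono: "k \<le> k' \<Longrightarrow> block_max u m k x \<le> block_max u m k' x"
  by (induction rule: dec_induct) auto

lemma block_max_shift: "block_max u (Suc m) k x \<le> block_max u m (Suc k) x"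
  by (induction k) (auto simp: max_def)

lemma block_max_less: "(\<And>j. j \<ge> m \<Longrightarrow> u j x < r) \<Longrightarrow> block_max u m k x < r"
  by (induction k) auto

lemma block_max_range: "(\<And>j. 0 \<le> u j x \<and> u j x \<le> 1) \<Longrightarrow> 0 \<le> block_max u m k x \<and> block_max u m k x \<le> 1"
  by (induction k) (auto simp: max_def)

lemma block_max_continuous:
  "(\<And>j. continuous_map X euclideanreal (u j)) \<Longrightarrow> continuous_map X euclideanreal (block_max u m k)"
  by (induction k) (auto intro: continuous_map_real_max)

text \<open>Bounded convergence without measures: nearly maximal suprema \<open>g m\<close> of late blocks satisfy
  \<open>L (max (g m) (g (m+1))) \<le> L (g m) + \<epsilon> / 2 ^ (m + 2)\<close>, so their running minima \<open>h m\<close> stay large,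
  contradicting Dini's theorem.\<close>

lemma mean_bounded_convergence:
  fixes L :: "'x bfun \<Rightarrow> real"
  assumes X: "compact_space X" and L: "linear L"
    and Lsup: "\<And>u M. (\<And>x. x \<in> topspace X \<Longrightarrow> fn u x \<le> M) \<Longrightarrow> L u \<le> M"
    and cont: "\<And>m. continuous_map X euclideanreal (u m)"
    and range: "\<And>m x. 0 \<le> u m x \<and> u m x \<le> 1"
    and lim: "\<And>x. x \<in> topspace X \<Longrightarrow> (\<lambda>m. u m x) \<longlonglongrightarrow> 0" and e: "\<epsilon> > 0"
  shows "\<exists>m. L (bf (u m)) < \<epsilon>"
proof (rule ccontr)
  assume "\<not> ?thesis"
  then have big: "\<epsilon> \<le> L (bf (u m))" for m by (simp add: not_less)
  have mono: "L v \<le> L w" if "\<And>x. x \<in> topspace X \<Longrightarrow> fn v x \<le> fn w x" for v w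
    using Lsup[of "v - w" 0] that linear_diff[OF L, of v w] by simp
  define V where "V m k = bf (block_max u m k)" for m k
  have fV: "fn (V m k) x = block_max u m k x" for m k x
    unfolding V_def by (rule fn_bf01) (rule block_max_range, rule range)
  define \<alpha> where "\<alpha> m = (SUP k. L (V m k))" for m
  have bdd: "bdd_above (range (\<lambda>k. L (V m k)))" for m
    by (rule bdd_aboveI2[where M = 1]) (auto intro!: Lsup simp: fV block_max_range range)
  have le_\<alpha>: "L (V m k) \<le> \<alpha> m" for m k unfolding \<alpha>_def by (rule cSUP_upper[OF _ bdd]) simp
  have "\<exists>k. \<alpha> m - \<epsilon> / 2 ^ (m + 2) < L (V m k)" for m
  proof -
    have "\<alpha> m - \<epsilon> / 2 ^ (m + 2) < \<alpha> m" using e by simp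
    then show ?thesis unfolding \<alpha>_def using less_cSUP_iff[OF _ bdd[of m]] by auto
  qed
  then obtain k where k: "\<And>m. \<alpha> m - \<epsilon> / 2 ^ (m + 2) < L (V m (k m))" by metis
  define g where "g m = block_max u m (k m)" for m
  define h where "h m = rec_nat (g 0) (\<lambda>m h x. min (h x) (g (Suc m) x)) m" for m
  have h0: "h 0 = g 0" and hSuc: "h (Suc m) = (\<lambda>x. min (h m x) (g (Suc m) x))" for m
    by (simp_all add: h_def)
  have hg: "h m x \<le> g m x" for m x by (cases m) (auto simp: h0 hSuc)
  have g01: "0 \<le> g m x \<and> g m x \<le> 1" for m x unfolding g_def by (rule block_max_range) (rule range)
  have h01: "0 \<le> h m x \<and> h m x \<le> 1" for m x
    using g01 by (induction m) (auto simp: h0 hSuc min_def)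
  have gV: "bf (g m) = V m (k m)" for m by (simp add: g_def V_def)
  have fg: "fn (bf (g m)) x = g m x" for m x using fV[of m "k m"] by (simp add: g_def V_def)
  have fh: "fn (bf (h m)) x = h m x" for m x by (rule fn_bf01) (rule h01)
  have step: "L (bf (h (Suc m))) - L (bf (g (Suc m))) \<ge> L (bf (h m)) - L (bf (g m)) - \<epsilon> / 2 ^ (m + 2)" for m
  proof -
    \<comment> \<open>Long enough for one block from \<open>m\<close> to contain both chosen blocks;
      the second starts one index later, hence the successor.\<close>
    let ?K = "max (k m) (Suc (k (Suc m)))"
    \<comment> \<open>A sum is minimum plus maximum. The minimum is \<open>h (Suc m) x\<close>, and
      the maximum lies below the long block because \<open>h m\<close> lies below
      \<open>g m\<close>.\<close>
    have 1: "h m x + g (Suc m) x \<le> h (Suc m) x + block_max u m ?K x" for x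
    proof -
      have "g m x \<le> block_max u m ?K x" unfolding g_def by (rule block_max_mono) simp
      moreover have "g (Suc m) x \<le> block_max u m ?K x"
        unfolding g_def by (rule order_trans[OF block_max_shift block_max_mono]) simp
      ultimately show ?thesis using hg[of m x] by (simp add: hSuc min_def)
    qed
    have "L (bf (h m) + bf (g (Suc m))) \<le> L (bf (h (Suc m)) + V m ?K)"
      by (rule mono) (simp add: fh fg fV 1)
    then have "L (bf (h m)) + L (bf (g (Suc m))) \<le> L (bf (h (Suc m))) + L (V m ?K)"
      by (simp add: linear_add[OF L])
    moreover have "L (V m ?K) \<le> L (bf (g m)) + \<epsilon> / 2 ^ (m + 2)"
      using le_\<alpha>[of m ?K] k[of m] by (simp add: gV)
    ultimately show ?thesis by linarith
  qed
  \<comment> \<open>The errors \<open>\<epsilon> / 2 ^ (m + 2)\<close> add up to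
    \<open>\<epsilon> / 2\<close>, so half of the lower bound \<open>\<epsilon>\<close> survives all
    the minima.\<close>
  have diff: "L (bf (h m)) - L (bf (g m)) \<ge> - \<epsilon> / 2 + \<epsilon> / 2 ^ (m + 1)" for m
  proof (induction m)
    case 0 show ?case by (simp add: h0)
  next
    case (Suc m)
    have "\<epsilon> / 2 ^ (m + 1) - \<epsilon> / 2 ^ (m + 2) = \<epsilon> / 2 ^ (Suc m + 1)" by (simp add: field_simps)
    then show ?case using step[of m] Suc.IH by linarith
  qed
  have hbig: "L (bf (h m)) \<ge> \<epsilon> / 2" for m
  proof -
    have "L (bf (u m)) \<le> L (bf (g m))"
    proof (rule mono)
      have "fn (bf (u m)) x = u m x" for x by (rule fn_bf01) (rule range)
      moreover have "u m x \<le> g m x" for x unfolding g_def using block_max_mono[of 0 "k m" u m x] by simp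
      ultimately show "fn (bf (u m)) x \<le> fn (bf (g m)) x" for x by (simp add: fg)
    qed
    moreover have "\<epsilon> / 2 ^ (m + 1) > 0" using e by simp
    ultimately show ?thesis using diff[of m] big[of m] by linarith
  qed
  have "\<exists>m. \<forall>x\<in>topspace X. h m x < \<epsilon> / 4"
  proof (rule Dini_compact[OF X])
    have gc: "continuous_map X euclideanreal (g m)" for m unfolding g_def by (rule block_max_continuous[OF cont])
    show "continuous_map X euclideanreal (h m)" for m
      by (induction m) (auto simp: h0 hSuc intro: gc continuous_map_real_min)
    show "h (Suc m) x \<le> h m x" for m x by (simp add: hSuc)
    fix x assume x: "x \<in> topspace X"
    show "(\<lambda>m. h m x) \<longlonglongrightarrow> 0"
    proof (rule LIMSEQ_I)
      fix r :: real assume "r > 0"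
      then obtain M where M: "\<And>j. j \<ge> M \<Longrightarrow> u j x < r"
        using order_tendstoD(2)[OF lim[OF x]] unfolding eventually_sequentially by blast
      have "norm (h m x - 0) < r" if "m \<ge> M" for m
      proof -
        have "g m x < r" unfolding g_def by (rule block_max_less) (use M that in auto)
        then show ?thesis using hg[of m x] h01[of m x] by simp
      qed
      then show "\<exists>no. \<forall>n\<ge>no. norm (h n x - 0) < r" by blast
    qed
  qed (use e in simp)
  then obtain m where "\<And>x. x \<in> topspace X \<Longrightarrow> h m x < \<epsilon> / 4" by blast
  then have "L (bf (h m)) \<le> \<epsilon> / 4" by (intro Lsup) (simp add: fh less_imp_le)
  then show False using e hbig[of m] by simp
qed

section \<open>Functionals on spaces of continuous functions\<close>

text \<open>A form of Mazur's theorem for bounded pointwise convergence. If every convex combination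
  reached \<open>\<epsilon>\<close> somewhere, a mean would be nonnegative on the cone generated by
  the functions \<open>u i - \<epsilon>\<close>. It would be at least \<open>\<epsilon>\<close> on
  every \<open>u m\<close>, against bounded convergence.\<close>

lemma convex_combination_small:
  fixes u :: "nat \<Rightarrow> 'x \<Rightarrow> real"
  assumes X: "compact_space X"
    and cont: "\<And>m. continuous_map X euclideanreal (u m)"
    and range: "\<And>m x. 0 \<le> u m x \<and> u m x \<le> 1"
    and lim: "\<And>x. x \<in> topspace X \<Longrightarrow> (\<lambda>m. u m x) \<longlonglongrightarrow> 0" and e: "\<epsilon> > 0"
  obtains k t where "\<forall>i. 0 \<le> t i" "(\<Sum>i<k. t i) = (1::real)" "\<forall>x\<in>topspace X. (\<Sum>i<(k::nat). t i * u i x) < \<epsilon>"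
proof (rule ccontr)
  assume neg: "\<not> thesis"
  have big: "\<exists>x\<in>topspace X. \<epsilon> \<le> (\<Sum>i<k. t i * u i x)" if "\<forall>i. 0 \<le> t i" "(\<Sum>i<k. t i) = 1" for k t
  proof (rule ccontr)
    assume "\<not> ?thesis"
    then have "\<forall>x\<in>topspace X. (\<Sum>i<k. t i * u i x) < \<epsilon>" by (simp add: not_le)
    then show False using neg \<open>\<And>t k. \<forall>i. 0 \<le> t i \<Longrightarrow> (\<Sum>i<k. t i) = 1 \<Longrightarrow> \<forall>x\<in>topspace X. (\<Sum>i<k. t i * u i x) < \<epsilon> \<Longrightarrow> thesis\<close>[OF that] by simp
  qed
  have fu: "fn (bf (u i)) x = u i x" for i x by (rule fn_bf01) (rule range)
  define c where "c = bf (\<lambda>_::'x. \<epsilon>)"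
  have fc: "fn c x = \<epsilon>" for x unfolding c_def by (rule fn_bf[where b = \<epsilon>]) (use e in simp)
  define comb where "comb k t = (\<Sum>i<k. t i *\<^sub>R (bf (u i) - c))" for k :: nat and t
  define Q where "Q = {comb k t | k t. \<forall>i. 0 \<le> t i}"
  have QI: "comb k t \<in> Q" if "\<forall>i. 0 \<le> t i" for k t unfolding Q_def using that by blast
  obtain L :: "'x bfun \<Rightarrow> real" where L: "linear L" "\<And>u M. (\<And>x. x \<in> topspace X \<Longrightarrow> fn u x \<le> M) \<Longrightarrow> L u \<le> M"
    "\<And>w. w \<in> Q \<Longrightarrow> 0 \<le> L w"
  proof (rule mean_nonneg_on_cone[of Q "topspace X"])
    show "0 \<in> Q" using QI[of "\<lambda>_. 0" 0] by (simp add: comb_def)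
  next
    fix v w assume "v \<in> Q" "w \<in> Q"
    then obtain k t k' t' where t: "v = comb k t" "\<forall>i. 0 \<le> t i" "w = comb k' t'" "\<forall>i. 0 \<le> t' i"
      unfolding Q_def by auto
    define s where "s i = (if i < k then t i else 0)" for i
    define s' where "s' i = (if i < k' then t' i else 0)" for i
    have "comb k t = comb (max k k') s" unfolding comb_def s_def
      by (rule sum.mono_neutral_cong_left) auto
    moreover have "comb k' t' = comb (max k k') s'" unfolding comb_def s'_def
      by (rule sum.mono_neutral_cong_left) auto
    moreover have "comb (max k k') s + comb (max k k') s' = comb (max k k') (\<lambda>i. s i + s' i)"
      by (simp add: comb_def sum.distrib scaleR_left_distrib)
    ultimately have "v + w = comb (max k k') (\<lambda>i. s i + s' i)" using t by simp
    moreover have "\<forall>i. 0 \<le> s i + s' i" using t by (simp add: s_def s'_def)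
    ultimately show "v + w \<in> Q" unfolding Q_def by blast
  next
    fix a :: real and v assume a: "a > 0" "v \<in> Q"
    then obtain k t where t: "v = comb k t" "\<forall>i. 0 \<le> t i" unfolding Q_def by auto
    have "a *\<^sub>R v = comb k (\<lambda>i. a * t i)" by (simp add: t comb_def scaleR_sum_right)
    moreover have "\<forall>i. 0 \<le> a * t i" using a t by simp
    ultimately show "a *\<^sub>R v \<in> Q" unfolding Q_def by blast
  next
    fix w M assume "w \<in> Q" and M: "\<And>x. x \<in> topspace X \<Longrightarrow> fn w x \<le> M"
    then obtain k t where t: "w = comb k t" "\<forall>i. 0 \<le> t i" unfolding Q_def by auto
    have fw: "fn w x = (\<Sum>i<k. t i * u i x) - (\<Sum>i<k. t i) * \<epsilon>" for x
      by (simp add: t(1) comb_def fn_sum fu fc algebra_simps sum_subtractf sum_distrib_left)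
    define s where "s = (\<Sum>i<k. t i)"
    have s0: "s \<ge> 0" unfolding s_def using t by (intro sum_nonneg) auto
    show "0 \<le> M"
    proof (cases "s = 0")
      case True
      \<comment> \<open>A one-term combination supplies a point of \<open>X\<close>; when the
        weights sum to zero, \<open>w\<close> is nonnegative at any point.\<close>
      obtain x where x: "x \<in> topspace X" using big[of "\<lambda>_. 1" 1] by auto
      have "(\<Sum>i<k. t i * u i x) \<ge> 0" using t range by (intro sum_nonneg) auto
      then show ?thesis using M[OF x] fw[of x] True by (simp add: s_def)
    next
      case False
      then have "s > 0" using s0 by simp
      have "(\<Sum>i<k. t i / s) = 1" using False by (simp add: sum_divide_distrib[symmetric] s_def)
      then obtain x where x: "x \<in> topspace X" "\<epsilon> \<le> (\<Sum>i<k. t i / s * u i x)"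
        using big[of "\<lambda>i. t i / s" k] t s0 by auto
      have eq: "(\<Sum>i<k. t i / s * u i x) = (\<Sum>i<k. t i * u i x) / s" by (simp add: sum_divide_distrib)
      have "s * \<epsilon> \<le> (\<Sum>i<k. t i * u i x)"
        using x(2) \<open>s > 0\<close> unfolding eq by (simp add: pos_le_divide_eq mult.commute)
      then show ?thesis using M[OF x(1)] fw[of x] by (simp add: s_def)
    qed
  next
    fix L :: "'x bfun \<Rightarrow> real"
    assume "linear L" "\<And>u M. (\<And>x. x \<in> topspace X \<Longrightarrow> fn u x \<le> M) \<Longrightarrow> L u \<le> M" "\<And>w. w \<in> Q \<Longrightarrow> 0 \<le> L w"
    then show ?thesis by (rule that)
  qed
  obtain m where m: "L (bf (u m)) < \<epsilon>"
    using mean_bounded_convergence[OF X L(1,2) cont range lim e] by blast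
  \<comment> \<open>Unit mass at index \<open>m\<close> puts \<open>u m - \<epsilon>\<close> into
    the cone.\<close>
  have "comb (Suc m) (\<lambda>i. if i = m then 1 else 0) = bf (u m) - c"
    by (simp add: comb_def if_distrib[of "\<lambda>r. r *\<^sub>R _"] cong: if_cong)
  then have "bf (u m) - c \<in> Q" using QI[of "\<lambda>i. if i = m then 1 else 0" "Suc m"] by simp
  then have "0 \<le> L (bf (u m)) - L c" using L(3)[of "bf (u m) - c"] linear_diff[OF L(1)] by simp
  moreover have "L (- c) \<le> - \<epsilon>" by (rule L(2)) (simp add: fc)
  ultimately show False using m linear_neg[OF L(1), of c] by simp
qed

text \<open>\<open>S\<close> stands for a subspace of an interpolation space and \<open>N\<close>
  for its norm. Vanishing off \<open>X\<close> makes the norm over the whole type the sup norm over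
  \<open>X\<close>.\<close>

locale function_norm =
  fixes X :: "'x topology" and S :: "'x bfun set" and N :: "'x bfun \<Rightarrow> real"
  assumes X: "compact_space X" and S: "subspace S"
    and S_cont: "v \<in> S \<Longrightarrow> continuous_map X euclideanreal (fn v)"
    and S_supp: "v \<in> S \<Longrightarrow> x \<notin> topspace X \<Longrightarrow> fn v x = 0"
    and N_add: "u \<in> S \<Longrightarrow> v \<in> S \<Longrightarrow> N (u + v) \<le> N u + N v"
    and N_scale: "v \<in> S \<Longrightarrow> N (c *\<^sub>R v) = \<bar>c\<bar> * N v"
    and norm_le_N: "v \<in> S \<Longrightarrow> norm v \<le> N v"
begin

lemma N_nonneg: "v \<in> S \<Longrightarrow> 0 \<le> N v"
  using norm_le_N[of v] norm_ge_zero[of v] by linarith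

lemma N_sum:
  assumes "finite I" "\<And>i. i \<in> I \<Longrightarrow> v i \<in> S"
  shows "N (\<Sum>i\<in>I. v i) \<le> (\<Sum>i\<in>I. N (v i))"
  using assms
proof (induction I rule: finite_induct)
  case empty
  have "N (0 *\<^sub>R 0) = 0" using N_scale[of 0 0] subspace_0[OF S] by simp
  then show ?case by simp
next
  case (insert a I)
  then have "N (v a + (\<Sum>i\<in>I. v i)) \<le> N (v a) + N (\<Sum>i\<in>I. v i)"
    by (intro N_add subspace_sum[OF S]) auto
  then show ?case using insert by fastforce
qed

text \<open>If no finite set of centres sufficed, there would be vectors of \<open>N\<close>-norm 1
  with \<open>\<phi>\<close> at least \<open>\<eta>\<close> whose values at the first
  \<open>m\<close> centres fade away. Since centres approximate all points, a convex combination of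
  these vectors is uniformly small, has \<open>N\<close> at most 1 and still satisfies
  \<open>\<phi> v \<ge> \<eta>\<close>. This contradicts the bound by a small multiple of
  \<open>N\<close> plus a multiple of the sup norm.\<close>

lemma pointwise_control:
  assumes \<phi>_add: "\<And>u v. u \<in> S \<Longrightarrow> v \<in> S \<Longrightarrow> \<phi> (u + v) = \<phi> u + \<phi> v"
    and \<phi>_scale: "\<And>c v. v \<in> S \<Longrightarrow> \<phi> (c *\<^sub>R v) = c * \<phi> v"
    and \<phi>_bound: "\<And>v. v \<in> S \<Longrightarrow> \<bar>\<phi> v\<bar> \<le> C * N v"
    and hump: "\<And>\<eta>. \<eta> > 0 \<Longrightarrow> \<exists>R. \<forall>v\<in>S. \<bar>\<phi> v\<bar> \<le> \<eta> * N v + R * norm v"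
    and cells: "\<And>\<eta>. \<eta> > 0 \<Longrightarrow> \<exists>y :: nat \<Rightarrow> 'x. range y \<subseteq> Q \<and>
        (\<forall>x\<in>topspace X. \<exists>i. \<forall>v\<in>S. \<bar>fn v x - fn v (y i)\<bar> \<le> \<eta> * N v)"
    and \<eta>: "\<eta> > 0"
  obtains F R where "finite F" "F \<subseteq> Q" "\<forall>v\<in>S. \<bar>\<phi> v\<bar> \<le> \<eta> * N v + R * (\<Sum>x\<in>F. \<bar>fn v x\<bar>)"
proof -
  obtain R0 where R0: "\<forall>v\<in>S. \<bar>\<phi> v\<bar> \<le> \<eta> / 4 * N v + R0 * norm v" using hump[of "\<eta>/4"] \<eta> by auto
  define R where "R = max R0 1"
  have R1: "R \<ge> 1" by (simp add: R_def)
  have R: "\<bar>\<phi> v\<bar> \<le> \<eta> / 4 * N v + R * norm v" if "v \<in> S" for v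
  proof -
    have "R0 * norm v \<le> R * norm v" by (rule mult_right_mono) (simp_all add: R_def)
    then show ?thesis using R0 that by fastforce
  qed
  \<comment> \<open>Then \<open>R * (3 * \<delta>)\<close> is \<open>3 / 8 * \<eta>\<close>, which
    together with \<open>\<eta> / 4\<close> stays below \<open>\<eta>\<close>.\<close>
  define \<delta> where "\<delta> = \<eta> / (8 * R)"
  have \<delta>: "\<delta> > 0" using \<eta> R1 by (simp add: \<delta>_def)
  obtain y :: "nat \<Rightarrow> 'x" where y: "range y \<subseteq> Q"
      "\<forall>x\<in>topspace X. \<exists>i. \<forall>v\<in>S. \<bar>fn v x - fn v (y i)\<bar> \<le> \<delta> * N v"
    using cells[OF \<delta>] by auto
  \<comment> \<open>Because of the growing factor \<open>Suc m\<close> a counterexample, normalised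
    to \<open>N w = 1\<close>, is at most \<open>C / Suc m\<close> at the first \<open>m\<close>
    centres.\<close>
  have "\<exists>m. \<forall>v\<in>S. \<bar>\<phi> v\<bar> \<le> \<eta> * N v + real (Suc m) * (\<Sum>x\<in>y ` {..<m}. \<bar>fn v x\<bar>)"
  proof (rule ccontr)
    assume neg: "\<not> ?thesis"
    have "\<exists>w\<in>S. N w = 1 \<and> \<phi> w \<ge> \<eta> \<and> (\<forall>i<m. \<bar>fn w (y i)\<bar> \<le> C / real (Suc m))" for m
    proof -
      obtain v where v: "v \<in> S" "\<bar>\<phi> v\<bar> > \<eta> * N v + real (Suc m) * (\<Sum>x\<in>y ` {..<m}. \<bar>fn v x\<bar>)"
        using neg by (auto simp: not_le)
      have sum0: "0 \<le> (\<Sum>x\<in>y ` {..<m}. \<bar>fn v x\<bar>)" by (intro sum_nonneg) auto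
      have "N v \<noteq> 0"
      proof
        assume "N v = 0"
        then have "\<bar>\<phi> v\<bar> \<le> 0" using \<phi>_bound[OF v(1)] by simp
        moreover have "0 \<le> real (Suc m) * (\<Sum>x\<in>y ` {..<m}. \<bar>fn v x\<bar>)" using sum0 by simp
        moreover have "\<eta> * N v = 0" using \<open>N v = 0\<close> by simp
        ultimately show False using v(2) by linarith
      qed
      then have Nv: "N v > 0" using N_nonneg[OF v(1)] by simp
      define w where "w = (sgn (\<phi> v) / N v) *\<^sub>R v"
      have wS: "w \<in> S" unfolding w_def using v(1) by (rule subspace_scale[OF S])
      have "\<phi> v \<noteq> 0" using v(2) sum0 Nv \<eta> by (smt (verit) mult_nonneg_nonneg of_nat_0_le_iff)
      have Nw: "N w = 1" unfolding w_def using N_scale[OF v(1)] Nv \<open>\<phi> v \<noteq> 0\<close> by (simp add: abs_sgn_eq)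
      have \<phi>w: "\<phi> w = \<bar>\<phi> v\<bar> / N v" unfolding w_def using \<phi>_scale[OF v(1)] by (simp add: abs_sgn)
      have fw: "\<bar>fn w x\<bar> = \<bar>fn v x\<bar> / N v" for x
        unfolding w_def using Nv \<open>\<phi> v \<noteq> 0\<close> by (simp add: abs_mult abs_sgn_eq)
      have "\<phi> w \<ge> \<eta>"
      proof -
        have "\<eta> * N v \<le> \<bar>\<phi> v\<bar>" using v(2) sum0 by (smt (verit) mult_nonneg_nonneg of_nat_0_le_iff)
        then show ?thesis using Nv by (simp add: \<phi>w field_simps)
      qed
      moreover have "\<bar>fn w (y i)\<bar> \<le> C / real (Suc m)" if "i < m" for i
      proof -
        have "\<bar>fn v (y i)\<bar> \<le> (\<Sum>x\<in>y ` {..<m}. \<bar>fn v x\<bar>)" using that by (intro member_le_sum) auto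
        then have "real (Suc m) * \<bar>fn v (y i)\<bar> \<le> real (Suc m) * (\<Sum>x\<in>y ` {..<m}. \<bar>fn v x\<bar>)" by (intro mult_left_mono) auto
        also have "\<dots> \<le> \<bar>\<phi> v\<bar>" using v(2) Nv \<eta> mult_pos_pos[OF \<eta> Nv] by linarith
        also have "\<dots> \<le> C * N v" by (rule \<phi>_bound[OF v(1)])
        finally have "real (Suc m) * \<bar>fn w (y i)\<bar> \<le> C" using Nv by (simp add: fw field_simps)
        then show ?thesis by (simp add: field_simps)
      qed
      ultimately show ?thesis using wS Nw by blast
    qed
    then obtain w where w: "\<And>m. w m \<in> S" "\<And>m. N (w m) = 1" "\<And>m. \<phi> (w m) \<ge> \<eta>"
       "\<And>m i. i < m \<Longrightarrow> \<bar>fn (w m) (y i)\<bar> \<le> C / real (Suc m)" by metis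
    \<comment> \<open>At any point \<open>\<bar>w m\<bar>\<close> is eventually at most
      \<open>2 * \<delta>\<close>: one \<open>\<delta>\<close> for moving to a centre, one for the
      value there. Truncation turns this into convergence to zero, which \<open>w m\<close> itself
      need not have.\<close>
    define u where "u m x = max 0 (\<bar>fn (w m) x\<bar> - 2 * \<delta>)" for m x
    obtain k t where t: "\<forall>i. 0 \<le> t i" "(\<Sum>i<k. t i) = (1::real)" "\<forall>x\<in>topspace X. (\<Sum>i<k. t i * u i x) < \<delta>"
    proof (rule convex_combination_small[OF X, of u \<delta>])
      show "continuous_map X euclideanreal (u m)" for m
        unfolding u_def using S_cont[OF w(1)]
        by (intro continuous_map_real_max continuous_map_diff continuous_map_real_abs) auto
      show "0 \<le> u m x \<and> u m x \<le> 1" for m x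
        using abs_fn_le[of "w m" x] norm_le_N[OF w(1), of m] w(2)[of m] \<delta> by (simp add: u_def)
      fix x assume x: "x \<in> topspace X"
      obtain i where i: "\<forall>v\<in>S. \<bar>fn v x - fn v (y i)\<bar> \<le> \<delta> * N v" using y(2) x by blast
      obtain M where M: "C / \<delta> \<le> real M" using real_arch_simple by blast
      have "u m x = 0" if "m \<ge> Suc i + M" for m
      proof -
        have "\<bar>fn (w m) x - fn (w m) (y i)\<bar> \<le> \<delta>" using bspec[OF i w(1)[of m]] w(2) by simp
        moreover have "C / real (Suc m) \<le> \<delta>"
        proof -
          have "C / \<delta> \<le> real (Suc m)" using M that by linarith
          then show ?thesis using \<delta> by (simp add: field_simps)
        qed
        then have "\<bar>fn (w m) (y i)\<bar> \<le> \<delta>" using w(4)[of i m] that by simp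
        ultimately show ?thesis by (simp add: u_def)
      qed
      then have "eventually (\<lambda>m. u m x = 0) sequentially" by (auto simp: eventually_sequentially)
      then show "(\<lambda>m. u m x) \<longlonglongrightarrow> 0" by (rule tendsto_eventually)
    qed (use \<delta> in auto)
    define v where "v = (\<Sum>i<k. t i *\<^sub>R w i)"
    have tw: "t i *\<^sub>R w i \<in> S" for i using w(1) by (rule subspace_scale[OF S])
    then have vS: "v \<in> S" unfolding v_def by (intro subspace_sum[OF S])
    have "N v \<le> (\<Sum>i<k. N (t i *\<^sub>R w i))" unfolding v_def using tw by (intro N_sum) auto
    also have "\<dots> = 1" using t(1,2) w(2) N_scale[OF w(1)] by simp
    finally have Nv: "N v \<le> 1" .
    have \<phi>sum: "\<phi> (\<Sum>i\<in>I. t i *\<^sub>R w i) = (\<Sum>i\<in>I. t i * \<phi> (w i))" if "finite I" for I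
      using that
    proof (induction I rule: finite_induct)
      case empty
      show ?case using \<phi>_scale[OF subspace_0[OF S], of 0] by simp
    next
      case (insert a I)
      have "\<phi> (t a *\<^sub>R w a + (\<Sum>i\<in>I. t i *\<^sub>R w i)) = \<phi> (t a *\<^sub>R w a) + \<phi> (\<Sum>i\<in>I. t i *\<^sub>R w i)"
        by (rule \<phi>_add[OF tw subspace_sum[OF S tw]])
      then show ?case using insert \<phi>_scale[OF w(1), of "t a" a] by simp
    qed
    have "\<eta> = (\<Sum>i<k. t i * \<eta>)" using t(2) by (simp add: sum_distrib_right[symmetric])
    also have "\<dots> \<le> (\<Sum>i<k. t i * \<phi> (w i))" using t(1) w(3) by (intro sum_mono mult_left_mono) auto
    also have "\<dots> = \<phi> v" unfolding v_def by (rule \<phi>sum[symmetric]) simp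
    finally have \<phi>v: "\<eta> \<le> \<phi> v" .
    have "\<bar>fn v x\<bar> \<le> 3 * \<delta>" for x
    proof (cases "x \<in> topspace X")
      case True
      have "\<bar>fn v x\<bar> \<le> (\<Sum>i<k. t i * \<bar>fn (w i) x\<bar>)" unfolding v_def
        using t(1) by (simp add: fn_sum) (rule order_trans[OF sum_abs], simp add: abs_mult)
      also have "\<dots> \<le> (\<Sum>i<k. t i * (u i x + 2 * \<delta>))" using t(1)
        by (intro sum_mono mult_left_mono) (auto simp: u_def)
      also have "\<dots> = (\<Sum>i<k. t i * u i x) + 2 * \<delta>" using t(2)
        by (simp add: distrib_left sum.distrib sum_distrib_right[symmetric])
      finally show ?thesis using bspec[OF t(3) True] by simp
    next
      case False then show ?thesis using S_supp[OF vS] \<delta> by simp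
    qed
    then have "norm v \<le> 3 * \<delta>" by (rule norm_bfun_le)
    then have "R * norm v \<le> R * (3 * \<delta>)" using R1 by (intro mult_left_mono) auto
    also have "\<dots> = 3 / 8 * \<eta>" using R1 by (simp add: \<delta>_def)
    finally have "\<phi> v \<le> \<eta> / 4 * N v + 3 / 8 * \<eta>" using R[OF vS] by simp
    moreover have "\<eta> / 4 * N v \<le> \<eta> / 4" using Nv \<eta> by simp
    ultimately show False using \<phi>v \<eta> by simp
  qed
  then obtain m where "\<forall>v\<in>S. \<bar>\<phi> v\<bar> \<le> \<eta> * N v + real (Suc m) * (\<Sum>x\<in>y ` {..<m}. \<bar>fn v x\<bar>)" by blast
  moreover have "y ` {..<m} \<subseteq> Q" using y(1) by auto
  ultimately show ?thesis by (intro that[of "y ` {..<m}" "real (Suc m)"]) auto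
qed

text \<open>Hahn-Banach for the infimal convolution \<open>q\<close> of
  \<open>\<eta> * N - \<phi>\<close> with the seminorm \<open>\<sigma>\<close> of values on
  \<open>F\<close>. From \<open>q \<le> \<sigma>\<close> the functional \<open>L\<close> sees only
  the values on \<open>F\<close>. Taking \<open>v\<close> as competitor in \<open>q (- v)\<close>
  cancels \<open>\<sigma>\<close> and leaves
  \<open>\<phi> v - L v \<le> \<eta> * N v\<close>.\<close>

lemma point_mass_approximation:
  assumes \<phi>_add: "\<And>u v. u \<in> S \<Longrightarrow> v \<in> S \<Longrightarrow> \<phi> (u + v) = \<phi> u + \<phi> v"
    and \<phi>_scale: "\<And>c v. v \<in> S \<Longrightarrow> \<phi> (c *\<^sub>R v) = c * \<phi> v"
    and F: "finite F" and \<eta>: "\<eta> \<ge> 0"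
    and le: "\<forall>v\<in>S. \<bar>\<phi> v\<bar> \<le> \<eta> * N v + R0 * (\<Sum>x\<in>F. \<bar>fn v x\<bar>)"
  obtains a where "\<forall>v\<in>S. \<bar>\<phi> v - (\<Sum>x\<in>F. a x * fn v x)\<bar> \<le> \<eta> * N v"
proof -
  define R where "R = max R0 0"
  have R0: "R \<ge> 0" by (simp add: R_def)
  have R: "\<bar>\<phi> v\<bar> \<le> \<eta> * N v + R * (\<Sum>x\<in>F. \<bar>fn v x\<bar>)" if "v \<in> S" for v
  proof -
    have "R0 * (\<Sum>x\<in>F. \<bar>fn v x\<bar>) \<le> R * (\<Sum>x\<in>F. \<bar>fn v x\<bar>)"
      by (rule mult_right_mono) (auto simp: R_def intro: sum_nonneg)
    then show ?thesis using le that by fastforce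
  qed
  define \<sigma> where "\<sigma> t = R * (\<Sum>x\<in>F. \<bar>fn t x\<bar>)" for t
  have \<sigma>_tri: "\<sigma> (s + t) \<le> \<sigma> s + \<sigma> t" for s t
    unfolding \<sigma>_def distrib_left[symmetric] sum.distrib[symmetric] using R0
    by (intro mult_left_mono sum_mono) auto
  have \<sigma>_scale: "\<sigma> (c *\<^sub>R t) = \<bar>c\<bar> * \<sigma> t" for c t
    by (simp add: \<sigma>_def abs_mult sum_distrib_left mult_ac)
  define J where "J t v = \<eta> * N v - \<phi> v + \<sigma> (t + v)" for t v
  define q where "q t = (INF v\<in>S. J t v)" for t
  have lower: "- \<sigma> t \<le> J t v" if "v \<in> S" for t v
  proof -
    have "\<phi> v \<le> \<eta> * N v + \<sigma> v" using R[OF that] by (simp add: \<sigma>_def)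
    moreover have "\<sigma> v \<le> \<sigma> (t + v) + \<sigma> t" using \<sigma>_tri[of "t + v" "- t"] \<sigma>_scale[of "-1" t] by simp
    ultimately show ?thesis by (simp add: J_def)
  qed
  have bdd: "bdd_below (J t ` S)" for t using lower by (intro bdd_belowI2) auto
  have qle: "q t \<le> J t v" if "v \<in> S" for t v unfolding q_def using that by (intro cINF_lower[OF bdd])
  have S0: "0 \<in> S" and Sne: "S \<noteq> {}" using subspace_0[OF S] by auto
  have N0: "N 0 = 0" using N_scale[OF S0, of 0] by simp
  have \<phi>0: "\<phi> 0 = 0" using \<phi>_scale[OF S0, of 0] by simp
  have q\<sigma>: "q t \<le> \<sigma> t" for t using qle[OF S0, of t] by (simp add: J_def N0 \<phi>0)
  have "sublinear q"
    unfolding sublinear_def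
  proof (intro conjI allI impI)
    have "0 \<le> q 0" unfolding q_def using lower[of _ 0] by (intro cINF_greatest[OF Sne]) (simp add: \<sigma>_def)
    moreover have "q 0 \<le> 0" using q\<sigma>[of 0] by (simp add: \<sigma>_def)
    ultimately show "q 0 = 0" by simp
  next
    fix s t
    have "q (s + t) - J t v' \<le> J s v" if "v \<in> S" "v' \<in> S" for v v'
    proof -
      have "q (s + t) \<le> J (s + t) (v + v')" using that by (intro qle subspace_add[OF S])
      also have "\<dots> \<le> J s v + J t v'"
      proof -
        have "\<sigma> (s + t + (v + v')) \<le> \<sigma> (s + v) + \<sigma> (t + v')" using \<sigma>_tri[of "s + v" "t + v'"] by (simp add: algebra_simps)
        moreover have "\<eta> * N (v + v') \<le> \<eta> * N v + \<eta> * N v'"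
          using mult_left_mono[OF N_add[OF that] \<eta>] by (simp add: distrib_left)
        ultimately show ?thesis using \<phi>_add[OF that] by (simp add: J_def)
      qed
      finally show ?thesis by simp
    qed
    then have "q (s + t) - J t v' \<le> q s" if "v' \<in> S" for v'
      unfolding q_def[of s] using that by (intro cINF_greatest[OF Sne]) auto
    then have "q (s + t) - q s \<le> J t v'" if "v' \<in> S" for v' using that by (simp add: algebra_simps)
    then have "q (s + t) - q s \<le> q t" unfolding q_def[of t] by (intro cINF_greatest[OF Sne]) auto
    then show "q (s + t) \<le> q s + q t" by simp
  next
    fix c :: real and t assume c: "c > 0"
    have "q (c *\<^sub>R t) / c \<le> J t v" if "v \<in> S" for v
    proof -
      have "q (c *\<^sub>R t) \<le> J (c *\<^sub>R t) (c *\<^sub>R v)" using that by (intro qle subspace_scale[OF S])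
      also have "\<dots> = c * J t v" using c N_scale[OF that, of c] \<phi>_scale[OF that, of c] \<sigma>_scale[of c "t + v"]
        by (simp add: J_def scaleR_right_distrib algebra_simps)
      finally show ?thesis using c by (simp add: field_simps)
    qed
    then have "q (c *\<^sub>R t) / c \<le> q t" unfolding q_def[of t] by (intro cINF_greatest[OF Sne]) auto
    then show "q (c *\<^sub>R t) \<le> c * q t" using c by (simp add: field_simps)
  qed
  then obtain L where L: "linear L" "\<forall>t. L t \<le> q t" by (rule Hahn_Banach_sublinear)
  have L0: "L t = 0" if "\<And>x. x \<in> F \<Longrightarrow> fn t x = 0" for t
  proof -
    have "\<sigma> t = 0" "\<sigma> (- t) = 0" using that by (simp_all add: \<sigma>_def)
    then have "L t \<le> 0" "L (- t) \<le> 0" using L(2) q\<sigma> by (metis order_trans)+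
    then show ?thesis using linear_neg[OF L(1), of t] by simp
  qed
  \<comment> \<open>Indicators of points need not be continuous, which is a reason to extend
    functionals to all bounded functions: they turn \<open>L\<close> into a finite sum of
    evaluations.\<close>
  define e where "e x = bf (\<lambda>z. if z = x then 1 else 0)" for x :: 'x
  have fe: "fn (e x) z = (if z = x then 1 else 0)" for x z unfolding e_def by (rule fn_bf01) auto
  have L_eq: "L v = (\<Sum>x\<in>F. L (e x) * fn v x)" for v
  proof -
    have "fn (v - (\<Sum>x\<in>F. fn v x *\<^sub>R e x)) z = 0" if "z \<in> F" for z
    proof -
      have "(\<Sum>x\<in>F. fn v x * (if z = x then 1 else 0)) = fn v z" using F that
        by (simp add: if_distrib[of "\<lambda>r. _ * r"] sum.delta cong: if_cong)
      then show ?thesis by (simp add: fn_sum fe)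
    qed
    then have "L (v - (\<Sum>x\<in>F. fn v x *\<^sub>R e x)) = 0" by (rule L0)
    then show ?thesis using L(1) by (simp add: linear_diff linear_sum linear_scale mult.commute)
  qed
  have one: "\<phi> v - (\<Sum>x\<in>F. L (e x) * fn v x) \<le> \<eta> * N v" if "v \<in> S" for v
  proof -
    have "L (- v) \<le> J (- v) v" using spec[OF L(2), of "- v"] qle[OF that, of "- v"] by simp
    also have "\<dots> = \<eta> * N v - \<phi> v" by (simp add: J_def \<sigma>_def)
    finally show ?thesis using linear_neg[OF L(1), of v] L_eq[of v] by simp
  qed
  show ?thesis
  proof (rule that, intro ballI)
    fix v assume v: "v \<in> S"
    have "- v \<in> S" "N (- v) = N v" "\<phi> (- v) = - \<phi> v"
      using subspace_neg[OF S v] N_scale[OF v, of "-1"] \<phi>_scale[OF v, of "-1"] by simp_all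
    then show "\<bar>\<phi> v - (\<Sum>x\<in>F. L (e x) * fn v x)\<bar> \<le> \<eta> * N v"
      using one[OF v] one[of "- v"] by (simp add: sum_negf abs_le_iff)
  qed
qed

end

section \<open>Interpolation spaces\<close>

locale atoms =
  fixes W :: "'v::{real_normed_vector, complete_space} set"
  assumes W_ne: "W \<noteq> {}" and W_convex: "convex W" and W_neg: "w \<in> W \<Longrightarrow> - w \<in> W"
    and W_le_1: "w \<in> W \<Longrightarrow> norm w \<le> 1"
begin

text \<open>The cost of splitting \<open>v\<close> into a multiple of an element of \<open>W\<close>
  and a remainder. As \<open>n\<close> grows, the multiple gets cheap and the remainder
  expensive.\<close>

definition K_values :: "nat \<Rightarrow> 'v \<Rightarrow> real set" where
  "K_values n v = {t / 2 ^ n + 2 ^ n * norm (v - t *\<^sub>R w) | t w. 0 \<le> t \<and> w \<in> W}"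

text \<open>The interpolation functional of Davis, Figiel, Johnson and Pelczynski, equivalent to the gauge of
  \<open>2 ^ n W + 2 ^ -n B\<close> with \<open>B\<close> the unit ball.\<close>

definition K :: "nat \<Rightarrow> 'v \<Rightarrow> real" where "K n v = Inf (K_values n v)"

lemma K_values_nonneg: "r \<in> K_values n v \<Longrightarrow> 0 \<le> r"
  unfolding K_values_def by auto

lemma K_values_bdd: "bdd_below (K_values n v)" using K_values_nonneg by (rule bdd_belowI)

lemma K_values_ne: "K_values n v \<noteq> {}"
proof -
  obtain w where "w \<in> W" using W_ne by auto
  then have "0 / 2 ^ n + 2 ^ n * norm (v - 0 *\<^sub>R w) \<in> K_values n v" unfolding K_values_def by blast
  then show ?thesis by blast
qed

lemma K_nonneg: "0 \<le> K n v"
  unfolding K_def using K_values_nonneg by (intro cInf_greatest[OF K_values_ne]) auto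

lemma K_upper: "0 \<le> t \<Longrightarrow> w \<in> W \<Longrightarrow> K n v \<le> t / 2 ^ n + 2 ^ n * norm (v - t *\<^sub>R w)"
  unfolding K_def by (intro cInf_lower[OF _ K_values_bdd]) (auto simp: K_values_def)

lemma K_near:
  assumes "K n v < r"
  obtains t w where "0 \<le> t" "w \<in> W" "t / 2 ^ n + 2 ^ n * norm (v - t *\<^sub>R w) < r"
proof -
  obtain s where "s \<in> K_values n v" "s < r"
    using assms cInf_lessD[OF K_values_ne, of n v r] by (auto simp: K_def)
  then show ?thesis using that by (auto simp: K_values_def)
qed

lemma K_le_norm: "K n v \<le> 2 ^ n * norm v"
proof -
  obtain w where "w \<in> W" using W_ne by auto
  then show ?thesis using K_upper[of 0 w n v] by simp
qed

lemma K_W: "w \<in> W \<Longrightarrow> K n w \<le> 1 / 2 ^ n"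
  using K_upper[of 1 w n w] by simp

lemma norm_le_K0: "norm v \<le> K 0 v"
  unfolding K_def
proof (rule cInf_greatest[OF K_values_ne])
  fix r assume "r \<in> K_values 0 v"
  then obtain t w where tw: "0 \<le> t" "w \<in> W" "r = t + norm (v - t *\<^sub>R w)" by (auto simp: K_values_def)
  have "norm v \<le> norm (t *\<^sub>R w) + norm (v - t *\<^sub>R w)" using norm_triangle_ineq[of "t *\<^sub>R w" "v - t *\<^sub>R w"] by simp
  also have "norm (t *\<^sub>R w) \<le> t" using tw W_le_1[OF tw(2)] by (simp add: mult_left_le)
  finally show "norm v \<le> r" using tw(3) by simp
qed

text \<open>Convexity of \<open>W\<close> merges \<open>t *\<^sub>R w\<close> and
  \<open>t' *\<^sub>R w'\<close> into one multiple with coefficient \<open>t + t'\<close>, so the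
  costs of two splittings add.\<close>

lemma K_triangle: "K n (u + v) \<le> K n u + K n v"
proof -
  have "K n (u + v) - s \<le> r" if r: "r \<in> K_values n u" and s: "s \<in> K_values n v" for r s
  proof -
    obtain t w where tw: "0 \<le> t" "w \<in> W" "r = t / 2 ^ n + 2 ^ n * norm (u - t *\<^sub>R w)" using r by (auto simp: K_values_def)
    obtain t' w' where tw': "0 \<le> t'" "w' \<in> W" "s = t' / 2 ^ n + 2 ^ n * norm (v - t' *\<^sub>R w')" using s by (auto simp: K_values_def)
    obtain w2 where w2: "w2 \<in> W" "(t + t') *\<^sub>R w2 = t *\<^sub>R w + t' *\<^sub>R w'"
    proof (cases "t + t' = 0")
      case True then show ?thesis using that tw tw' by (simp add: add_nonneg_eq_0_iff)
    next
      case False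
      then have pos: "t + t' > 0" using tw tw' by simp
      have "(t / (t + t')) *\<^sub>R w + (t' / (t + t')) *\<^sub>R w' \<in> W"
        using W_convex tw tw' pos by (intro convexD) (auto simp: add_divide_distrib[symmetric])
      moreover have "(t + t') *\<^sub>R ((t / (t + t')) *\<^sub>R w + (t' / (t + t')) *\<^sub>R w') = t *\<^sub>R w + t' *\<^sub>R w'"
        using pos by (simp add: scaleR_right_distrib)
      ultimately show ?thesis using that by blast
    qed
    have "K n (u + v) \<le> (t + t') / 2 ^ n + 2 ^ n * norm (u + v - (t + t') *\<^sub>R w2)"
      using tw tw' w2 by (intro K_upper) auto
    also have "norm (u + v - (t + t') *\<^sub>R w2) \<le> norm (u - t *\<^sub>R w) + norm (v - t' *\<^sub>R w')"
      unfolding w2(2) using norm_triangle_ineq[of "u - t *\<^sub>R w" "v - t' *\<^sub>R w'"] by (simp add: algebra_simps)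
    finally show ?thesis using tw(3) tw'(3) by (simp add: add_divide_distrib distrib_left)
  qed
  then have "K n (u + v) - s \<le> K n u" if "s \<in> K_values n v" for s
    unfolding K_def[of n u] using that by (intro cInf_greatest[OF K_values_ne]) auto
  then have "K n (u + v) - K n u \<le> s" if "s \<in> K_values n v" for s using that by (simp add: algebra_simps)
  then have "K n (u + v) - K n u \<le> K n v" unfolding K_def[of n v] by (intro cInf_greatest[OF K_values_ne]) auto
  then show ?thesis by simp
qed

lemma K_scale_le: "K n (c *\<^sub>R v) \<le> \<bar>c\<bar> * K n v" if c: "c \<noteq> 0"
proof -
  have "K n (c *\<^sub>R v) / \<bar>c\<bar> \<le> r" if r: "r \<in> K_values n v" for r
  proof -
    obtain t w where tw: "0 \<le> t" "w \<in> W" "r = t / 2 ^ n + 2 ^ n * norm (v - t *\<^sub>R w)" using r by (auto simp: K_values_def)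
    define w' where "w' = (if c > 0 then w else - w)"
    have "w' \<in> W" using tw W_neg by (simp add: w'_def)
    then have "K n (c *\<^sub>R v) \<le> (\<bar>c\<bar> * t) / 2 ^ n + 2 ^ n * norm (c *\<^sub>R v - (\<bar>c\<bar> * t) *\<^sub>R w')"
      using tw by (intro K_upper) auto
    also have "c *\<^sub>R v - (\<bar>c\<bar> * t) *\<^sub>R w' = c *\<^sub>R (v - t *\<^sub>R w)"
      using c by (simp add: w'_def scaleR_diff_right abs_if)
    finally have "K n (c *\<^sub>R v) \<le> \<bar>c\<bar> * r" by (simp add: tw(3) distrib_left mult_ac)
    then show ?thesis using c by (simp add: field_simps)
  qed
  then have "K n (c *\<^sub>R v) / \<bar>c\<bar> \<le> K n v" unfolding K_def[of n v] by (intro cInf_greatest[OF K_values_ne]) auto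
  then show ?thesis using c by (simp add: field_simps)
qed

lemma K_0 [simp]: "K n 0 = 0" using K_le_norm[of n 0] K_nonneg[of n 0] by simp

lemma K_scale: "K n (c *\<^sub>R v) = \<bar>c\<bar> * K n v"
proof (cases "c = 0")
  case False
  have "K n ((1 / c) *\<^sub>R (c *\<^sub>R v)) \<le> \<bar>1 / c\<bar> * K n (c *\<^sub>R v)" using False by (intro K_scale_le) simp
  then have "\<bar>c\<bar> * K n v \<le> K n (c *\<^sub>R v)" using False by (simp add: field_simps)
  then show ?thesis using K_scale_le[OF False, of n v] by simp
qed simp

lemma K_minus: "K n (- v) = K n v" using K_scale[of n "-1" v] by simp

lemma K_diff_commute: "K n (u - v) = K n (v - u)" using K_minus[of n "u - v"] by simp

text \<open>The variant of type c_0: the levels have to tend to zero, which is stronger than being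
  bounded.\<close>

definition E :: "'v set" where "E = {v. (\<lambda>n. K n v) \<longlonglongrightarrow> 0}"

text \<open>Meant for vectors of \<open>E\<close>, whose levels are bounded.\<close>

definition N :: "'v \<Rightarrow> real" where "N v = (SUP n. K n v)"

lemma subspace_E: "subspace E"
proof (rule subspaceI)
  show "0 \<in> E" by (simp add: E_def)
  fix u v assume "u \<in> E" "v \<in> E"
  then have "(\<lambda>n. K n u + K n v) \<longlonglongrightarrow> 0" using tendsto_add[of "\<lambda>n. K n u" 0 _ "\<lambda>n. K n v" 0] by (simp add: E_def)
  then have "(\<lambda>n. K n (u + v)) \<longlonglongrightarrow> 0"
    by (rule tendsto_sandwich[rotated 3, where f = "\<lambda>_. 0"]) (auto simp: K_nonneg K_triangle)
  then show "u + v \<in> E" by (simp add: E_def)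
next
  fix c :: real and v assume "v \<in> E"
  then show "c *\<^sub>R v \<in> E" unfolding E_def using tendsto_mult_right_zero by (auto simp: K_scale)
qed

lemma W_subset_E: "W \<subseteq> E"
proof
  fix w assume w: "w \<in> W"
  have "(\<lambda>n. (1/2::real) ^ n) \<longlonglongrightarrow> 0" by (rule LIMSEQ_power_zero) simp
  then have "(\<lambda>n. K n w) \<longlonglongrightarrow> 0"
    by (rule tendsto_sandwich[rotated 3, where f = "\<lambda>_. 0"])
      (auto simp: K_nonneg K_W[OF w] power_one_over)
  then show "w \<in> E" by (simp add: E_def)
qed

lemma K_bdd: "v \<in> E \<Longrightarrow> bdd_above (range (\<lambda>n. K n v))"
  unfolding E_def by (metis (mono_tags, lifting) Bseq_bdd_above convergentI convergent_imp_Bseq mem_Collect_eq)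

lemma K_le_N: "v \<in> E \<Longrightarrow> K n v \<le> N v"
  unfolding N_def by (rule cSUP_upper[OF _ K_bdd]) auto

lemma N_le: "(\<And>n. K n v \<le> r) \<Longrightarrow> N v \<le> r"
  unfolding N_def by (rule cSUP_least) auto

lemma norm_le_N: "v \<in> E \<Longrightarrow> norm v \<le> N v"
  using norm_le_K0[of v] K_le_N[of v 0] by simp

lemma N_triangle: "u \<in> E \<Longrightarrow> v \<in> E \<Longrightarrow> N (u + v) \<le> N u + N v"
  by (rule N_le) (meson K_le_N K_triangle add_mono order_trans)

lemma N_0 [simp]: "N 0 = 0" by (simp add: N_def)

lemma N_scale: assumes v: "v \<in> E" shows "N (c *\<^sub>R v) = \<bar>c\<bar> * N v"
proof -
  have le: "N (c *\<^sub>R v) \<le> \<bar>c\<bar> * N v" if "v \<in> E" for c v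
    by (rule N_le) (auto simp: K_scale intro!: mult_left_mono K_le_N[OF that])
  show ?thesis
  proof (cases "c = 0")
    case False
    have "N ((1 / c) *\<^sub>R (c *\<^sub>R v)) \<le> \<bar>1 / c\<bar> * N (c *\<^sub>R v)" by (rule le) (rule subspace_scale[OF subspace_E v])
    then have "\<bar>c\<bar> * N v \<le> N (c *\<^sub>R v)" using False by (simp add: field_simps)
    then show ?thesis using le[OF v, of c] by simp
  qed simp
qed

lemma N_nonneg: "v \<in> E \<Longrightarrow> 0 \<le> N v" using norm_le_N[of v] norm_ge_zero[of v] by linarith

lemma N_eq_0: "v \<in> E \<Longrightarrow> N v = 0 \<longleftrightarrow> v = 0"
  using norm_le_N[of v] by auto

text \<open>A sequence that is Cauchy for \<open>N\<close> is Cauchy in norm. Each single level is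
  continuous in norm because \<open>K n v\<close> is at most \<open>2 ^ n * norm v\<close>, so
  bounds on the levels pass to the limit uniformly in \<open>n\<close>. A sequence member close to
  the limit makes the levels of the limit tend to zero.\<close>

lemma E_complete:
  fixes s :: "nat \<Rightarrow> 'v"
  assumes s: "\<And>k. s k \<in> E" and Cauchy: "\<And>e. e > 0 \<Longrightarrow> \<exists>M. \<forall>k\<ge>M. \<forall>l\<ge>M. N (s k - s l) < e"
  obtains v where "v \<in> E" "\<And>e. e > 0 \<Longrightarrow> \<exists>M. \<forall>k\<ge>M. N (s k - v) < e"
proof -
  have sE: "s k - s l \<in> E" for k l using s by (intro subspace_diff[OF subspace_E])
  have "Cauchy s"
    unfolding Cauchy_def dist_norm using Cauchy norm_le_N[OF sE] by (meson le_less_trans)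
  then obtain v where v: "s \<longlonglongrightarrow> v" using Cauchy_convergent convergent_def by blast
  have Kle: "K n (s k - v) \<le> e" if M: "\<forall>k\<ge>M. \<forall>l\<ge>M. N (s k - s l) < e" and k: "k \<ge> M" for n k e M
  proof (rule field_le_epsilon)
    fix r :: real assume r: "r > 0"
    obtain l0 where l0: "\<And>l. l \<ge> l0 \<Longrightarrow> norm (s l - v) < r / 2 ^ n"
      using LIMSEQ_D[OF v, of "r / 2 ^ n"] r by auto
    define l where "l = max l0 M"
    have "K n (s k - v) \<le> K n (s k - s l) + K n (s l - v)" using K_triangle[of n "s k - s l" "s l - v"] by simp
    also have "K n (s k - s l) \<le> e"
    proof -
      have "N (s k - s l) < e" using M k by (simp add: l_def)
      then show ?thesis using K_le_N[OF sE, of n k l] by simp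
    qed
    also have "K n (s l - v) \<le> 2 ^ n * norm (s l - v)" by (rule K_le_norm)
    also have "\<dots> \<le> r" using l0[of l] by (simp add: l_def field_simps)
    finally show "K n (s k - v) \<le> e + r" by simp
  qed
  have "v \<in> E"
    unfolding E_def
  proof (intro CollectI LIMSEQ_I)
    fix r :: real assume r: "r > 0"
    obtain M where M: "\<forall>k\<ge>M. \<forall>l\<ge>M. N (s k - s l) < r / 2" using Cauchy[of "r/2"] r by auto
    obtain n0 where n0: "\<And>n. n \<ge> n0 \<Longrightarrow> norm (K n (s M) - 0) < r / 2"
      using LIMSEQ_D[of "\<lambda>n. K n (s M)" 0 "r/2"] s[of M] r unfolding E_def by auto
    have "norm (K n v - 0) < r" if "n \<ge> n0" for n
    proof -
      have "K n v \<le> K n (s M) + K n (v - s M)" using K_triangle[of n "s M" "v - s M"] by simp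
      also have "K n (v - s M) \<le> r / 2" using Kle[OF M order_refl, of n] by (simp add: K_diff_commute)
      finally show ?thesis using n0[OF that] K_nonneg[of n v] by simp
    qed
    then show "\<exists>no. \<forall>n\<ge>no. norm (K n v - 0) < r" by blast
  qed
  moreover have "\<exists>M. \<forall>k\<ge>M. N (s k - v) < e" if e: "e > 0" for e
  proof -
    obtain M where M: "\<forall>k\<ge>M. \<forall>l\<ge>M. N (s k - s l) < e / 2" using Cauchy[of "e/2"] e by auto
    have "N (s k - v) \<le> e / 2" if "k \<ge> M" for k by (rule N_le) (rule Kle[OF M that])
    then show ?thesis using e by (intro exI[of _ M]) fastforce
  qed
  ultimately show ?thesis using that by blast
qed

text \<open>Gliding hump: a sum of vectors on which \<open>\<phi>\<close> is at least \<open>\<eta>\<close> has \<open>N\<close>-norm below 2 if each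
  summand is small in norm compared with its predecessors.\<close>

lemma small_norm_part:
  assumes S: "subspace S" "S \<subseteq> E"
    and \<phi>_add: "\<And>u v. u \<in> S \<Longrightarrow> v \<in> S \<Longrightarrow> \<phi> (u + v) = \<phi> u + \<phi> v"
    and \<phi>_scale: "\<And>c v. v \<in> S \<Longrightarrow> \<phi> (c *\<^sub>R v) = c * \<phi> v"
    and \<phi>_bound: "\<And>v. v \<in> S \<Longrightarrow> \<bar>\<phi> v\<bar> \<le> C * N v" and \<eta>: "\<eta> > 0"
  shows "\<exists>R. \<forall>v\<in>S. \<bar>\<phi> v\<bar> \<le> \<eta> * N v + R * norm v"
proof (rule ccontr)
  assume neg: "\<not> ?thesis"
  have small: "\<exists>w\<in>S. N w \<le> 1 \<and> \<phi> w \<ge> \<eta> \<and> norm w \<le> r" if r: "r > 0" for r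
  proof -
    \<comment> \<open>A failure for this \<open>R\<close> has \<open>R * norm v\<close> at most
      \<open>\<bar>C\<bar> * N v\<close>, so its norm is at most \<open>r\<close> after
      normalisation.\<close>
    define R where "R = \<bar>C\<bar> / r"
    obtain v where v: "v \<in> S" "\<bar>\<phi> v\<bar> > \<eta> * N v + R * norm v" using neg by (auto simp: not_le)
    have vE: "v \<in> E" using v S by auto
    have R0: "R \<ge> 0" using r by (simp add: R_def)
    have "N v \<noteq> 0"
    proof
      assume "N v = 0"
      then have "v = 0" using N_eq_0[OF vE] by simp
      then show False using v(2) \<phi>_scale[OF v(1), of 0] by simp
    qed
    then have Nv: "N v > 0" using N_nonneg[OF vE] by simp
    have Rn: "0 \<le> R * norm v" using R0 by simp
    have \<phi>v: "\<phi> v \<noteq> 0" using v(2) mult_pos_pos[OF \<eta> Nv] Rn by auto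
    define w where "w = (sgn (\<phi> v) / N v) *\<^sub>R v"
    have "w \<in> S" unfolding w_def using v(1) by (rule subspace_scale[OF S(1)])
    moreover have "N w \<le> 1" unfolding w_def using N_scale[OF vE] Nv \<phi>v by (simp add: abs_sgn_eq)
    moreover have "\<phi> w \<ge> \<eta>"
    proof -
      have "\<phi> w = \<bar>\<phi> v\<bar> / N v" unfolding w_def using \<phi>_scale[OF v(1)] by (simp add: abs_sgn)
      moreover have "\<eta> * N v \<le> \<bar>\<phi> v\<bar>" using v(2) Rn by linarith
      then have "\<eta> \<le> \<bar>\<phi> v\<bar> / N v" using Nv by (simp add: pos_le_divide_eq)
      ultimately show ?thesis by simp
    qed
    moreover have "norm w \<le> r"
    proof -
      have nw: "norm w = norm v / N v" unfolding w_def using Nv \<phi>v by (simp add: abs_sgn_eq)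
      have "R * norm v \<le> \<bar>\<phi> v\<bar>" using v(2) mult_pos_pos[OF \<eta> Nv] by linarith
      also have "\<dots> \<le> \<bar>C\<bar> * N v" using \<phi>_bound[OF v(1)] mult_right_mono[OF abs_ge_self[of C], of "N v"] Nv by linarith
      finally have le: "\<bar>C\<bar> * norm v \<le> \<bar>C\<bar> * N v * r" using r by (simp add: R_def field_simps)
      have "C \<noteq> 0" using \<phi>_bound[OF v(1)] \<phi>v by auto
      then have "norm v \<le> N v * r" using le by simp
      then show ?thesis using Nv by (simp add: nw field_simps)
    qed
    ultimately show ?thesis by blast
  qed
  \<comment> \<open>Each step raises \<open>\<phi>\<close> by \<open>\<eta>\<close> and spends
    \<open>1 / 2 ^ Suc k\<close> of the room left below 2.\<close>
  have "\<exists>s\<in>S. N s \<le> 2 - 1 / 2 ^ k \<and> \<phi> s \<ge> real k * \<eta>" for k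
  proof (induction k)
    case 0
    show ?case using subspace_0[OF S(1)] \<phi>_scale[OF subspace_0[OF S(1)], of 0] by (intro bexI[of _ 0]) auto
  next
    case (Suc k)
    then obtain s where s: "s \<in> S" "N s \<le> 2 - 1 / 2 ^ k" "\<phi> s \<ge> real k * \<eta>" by blast
    have sE: "s \<in> E" using s S by auto
    obtain n0 where n0: "\<And>n. n \<ge> n0 \<Longrightarrow> norm (K n s - 0) < 1 / 2"
      using LIMSEQ_D[of "\<lambda>n. K n s" 0 "1/2"] sE unfolding E_def by auto
    \<comment> \<open>From \<open>n0\<close> on the levels of \<open>s\<close> are below 1/2 and
      those of \<open>w\<close> at most 1. Before \<open>n0\<close> the small norm keeps the levels
      of \<open>w\<close> within \<open>1 / 2 ^ Suc k\<close>.\<close>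
    obtain w where w: "w \<in> S" "N w \<le> 1" "\<phi> w \<ge> \<eta>" "norm w \<le> 1 / (2 ^ n0 * 2 ^ Suc k)"
      using small[of "1 / (2 ^ n0 * 2 ^ Suc k)"] by auto
    have wE: "w \<in> E" using w S by auto
    have half: "1 / 2 ^ Suc k \<le> (1/2 :: real)" using one_le_power[of "2::real" k] by (simp add: field_simps)
    have "K n (s + w) \<le> 2 - 1 / 2 ^ Suc k" for n
    proof (cases "n \<ge> n0")
      case True
      have "K n (s + w) \<le> K n s + K n w" by (rule K_triangle)
      moreover have "K n s \<le> 1/2" using n0[OF True] by simp
      moreover have "K n w \<le> 1" using K_le_N[OF wE, of n] w(2) by simp
      ultimately show ?thesis using half by linarith
    next
      case False
      have "K n (s + w) \<le> K n s + K n w" by (rule K_triangle)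
      moreover have "K n s \<le> 2 - 1 / 2 ^ k" using K_le_N[OF sE, of n] s(2) by simp
      moreover have "K n w \<le> 1 / 2 ^ Suc k"
      proof -
        have "K n w \<le> 2 ^ n * norm w" by (rule K_le_norm)
        also have "\<dots> \<le> 2 ^ n0 * (1 / (2 ^ n0 * 2 ^ Suc k))" using False w(4)
          by (intro mult_mono power_increasing) auto
        finally show ?thesis by simp
      qed
      moreover have "1 / 2 ^ k = 1 / 2 ^ Suc k + 1 / (2 ^ Suc k :: real)" by (simp add: field_simps)
      ultimately show ?thesis by linarith
    qed
    then have "N (s + w) \<le> 2 - 1 / 2 ^ Suc k" by (rule N_le)
    moreover have "\<phi> (s + w) \<ge> real (Suc k) * \<eta>" using \<phi>_add[OF s(1) w(1)] s(3) w(3) by (simp add: algebra_simps)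
    ultimately show ?case using subspace_add[OF S(1) s(1) w(1)] by blast
  qed
  note hump = this
  obtain k :: nat where k: "2 * \<bar>C\<bar> / \<eta> < real k" using reals_Archimedean2 by blast
  obtain s where s: "s \<in> S" "N s \<le> 2 - 1 / 2 ^ k" "\<phi> s \<ge> real k * \<eta>" using hump[of k] by blast
  have "N s \<ge> 0" using N_nonneg s(1) S(2) by blast
  have "\<phi> s \<le> C * N s" using \<phi>_bound[OF s(1)] by simp
  also have "\<dots> \<le> \<bar>C\<bar> * N s" using \<open>N s \<ge> 0\<close> by (intro mult_right_mono) auto
  also have "\<dots> \<le> \<bar>C\<bar> * 2"
  proof (rule mult_left_mono)
    have "1 / (2::real) ^ k \<ge> 0" by simp
    then show "N s \<le> 2" using s(2) by linarith
  qed simp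
  finally show False using s(3) k \<eta> by (simp add: field_simps)
qed

text \<open>If \<open>K n v\<close> is below \<open>e\<close>, some multiple of an element of
  \<open>W\<close> lies within \<open>e\<close> of \<open>v\<close>, since the remainder carries a
  weight of at least 1.\<close>

lemma E_subset_closed_subspace:
  assumes "subspace M" "closed M" "W \<subseteq> M" shows "E \<subseteq> M"
proof
  fix v assume v: "v \<in> E"
  have "\<exists>u\<in>M. dist u v < e" if e: "e > 0" for e
  proof -
    obtain n where "norm (K n v - 0) < e" using LIMSEQ_D[of "\<lambda>n. K n v" 0 e] v e unfolding E_def by blast
    then have "K n v < e" by simp
    then obtain t w where tw: "0 \<le> t" "w \<in> W" "t / 2 ^ n + 2 ^ n * norm (v - t *\<^sub>R w) < e" by (rule K_near)
    have "norm (v - t *\<^sub>R w) \<le> 2 ^ n * norm (v - t *\<^sub>R w)"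
      using mult_right_mono[OF one_le_power[of "2::real" n], of "norm (v - t *\<^sub>R w)"] by simp
    also have "\<dots> < e" using tw(1,3) by (smt (verit) divide_nonneg_nonneg zero_le_power)
    finally have "dist (t *\<^sub>R w) v < e" by (simp add: dist_norm norm_minus_commute)
    moreover have "t *\<^sub>R w \<in> M" using tw(2) assms by (intro subspace_scale) auto
    ultimately show ?thesis by blast
  qed
  then have "v \<in> closure M" by (simp add: closure_approachable)
  then show "v \<in> M" using assms(2) by simp
qed

text \<open>As \<open>T\<close> preserves \<open>W\<close>, splittings of \<open>v\<close>
  correspond to splittings of \<open>T v\<close> at the same cost.\<close>

lemma K_isometry:
  assumes "linear T" "\<And>v. norm (T v) = norm v" "T ` W = W"
  shows "K n (T v) = K n v"
proof -
  have "K_values n (T v) = K_values n v"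
  proof (rule Set.set_eqI)
    fix r
    have eq: "norm (T v - t *\<^sub>R T w) = norm (v - t *\<^sub>R w)" for t w
      using assms(1,2) by (metis linear_diff linear_scale)
    have "r \<in> K_values n (T v) \<longleftrightarrow> (\<exists>t. \<exists>w\<in>T ` W. 0 \<le> t \<and> r = t / 2 ^ n + 2 ^ n * norm (T v - t *\<^sub>R w))"
      unfolding assms(3) K_values_def by auto
    also have "\<dots> \<longleftrightarrow> r \<in> K_values n v" unfolding K_values_def by (auto simp: eq)
    finally show "r \<in> K_values n (T v) \<longleftrightarrow> r \<in> K_values n v" .
  qed
  then show ?thesis by (simp add: K_def)
qed

end

section \<open>Separable subspaces of normed spaces\<close>

lemma real_ring_simps [simp]:
  "carrier real_ring = UNIV" "x \<oplus>\<^bsub>real_ring\<^esub> y = x + y" "x \<otimes>\<^bsub>real_ring\<^esub> y = x * y"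
  "\<one>\<^bsub>real_ring\<^esub> = 1" "\<zero>\<^bsub>real_ring\<^esub> = 0"
  by (simp_all add: real_ring_def)

lemma cring_real_ring: "cring real_ring"
proof (rule cringI)
  show "abelian_group real_ring"
  proof (rule abelian_groupI)
    show "\<exists>y\<in>carrier real_ring. y \<oplus>\<^bsub>real_ring\<^esub> x = \<zero>\<^bsub>real_ring\<^esub>" for x
      by (intro bexI[of _ "- x"]) auto
  qed auto
  show "Group.comm_monoid real_ring" by (rule comm_monoidI) auto
qed (auto simp: distrib_right)

lemma (in Metric_space) separable_space_mtopology_iff:
  "separable_space mtopology \<longleftrightarrow> (\<exists>C. countable C \<and> C \<subseteq> M \<and> (\<forall>x\<in>M. \<forall>r>0. \<exists>y\<in>C. d x y < r))"
proof -
  have eq: "mtopology closure_of C = M \<longleftrightarrow> (\<forall>x\<in>M. \<forall>r>0. \<exists>y\<in>C. d x y < r)" if C: "C \<subseteq> M" for C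
  proof
    assume L: "mtopology closure_of C = M"
    show "\<forall>x\<in>M. \<forall>r>0. \<exists>y\<in>C. d x y < r"
    proof (intro ballI allI impI)
      fix x and r :: real assume "x \<in> M" "r > 0"
      then have "x \<in> mtopology closure_of C" by (simp only: L)
      then have "\<exists>y\<in>C. y \<in> mball x r" using \<open>r > 0\<close> by (simp only: metric_closure_of mem_Collect_eq)
      then show "\<exists>y\<in>C. d x y < r" by auto
    qed
  next
    assume R: "\<forall>x\<in>M. \<forall>r>0. \<exists>y\<in>C. d x y < r"
    have "\<exists>y\<in>C. y \<in> mball x r" if x: "x \<in> M" and r: "r > 0" for x r
    proof -
      obtain y where "y \<in> C" "d x y < r" using R x r by auto
      then show ?thesis using x C by (intro bexI[of _ y]) auto
    qed
    then show "mtopology closure_of C = M" by (auto simp: metric_closure_of simp del: in_mball)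
  qed
  show ?thesis unfolding separable_space_def topspace_mtopology using eq by (intro ex_cong1) auto
qed

locale normed_carrier =
  fixes V :: "'v normed" (structure)
  assumes normed: "normed_space V"
begin

sublocale module real_ring V
  using normed by (simp add: normed_space_def)

lemma nrm_eq_0: "v \<in> carrier V \<Longrightarrow> nrm V v = 0 \<longleftrightarrow> v = \<zero>"
  and nrm_smult: "v \<in> carrier V \<Longrightarrow> nrm V (c \<odot> v) = \<bar>c\<bar> * nrm V v"
  and nrm_add: "v \<in> carrier V \<Longrightarrow> w \<in> carrier V \<Longrightarrow> nrm V (v \<oplus> w) \<le> nrm V v + nrm V w"
  using normed by (simp_all add: normed_space_def)

lemma smult_cl [simp]: "v \<in> carrier V \<Longrightarrow> c \<odot> v \<in> carrier V"
  by (rule smult_closed) auto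

lemma neg_eq: "v \<in> carrier V \<Longrightarrow> \<ominus> v = (- 1) \<odot> v"
proof -
  assume v: "v \<in> carrier V"
  have "(-1) \<odot> v \<oplus> v = ((-1) \<oplus>\<^bsub>real_ring\<^esub> 1) \<odot> v"
    using smult_l_distr[of "-1" 1 v] smult_one[OF v] v by simp
  also have "\<dots> = \<zero>" using smult_l_null[OF v] by simp
  finally show "\<ominus> v = (- 1) \<odot> v" using v by (intro M.minus_equality) auto
qed

lemma nrm_neg: "v \<in> carrier V \<Longrightarrow> nrm V (\<ominus> v) = nrm V v"
  by (simp add: neg_eq nrm_smult)

lemma nrm_zero [simp]: "nrm V \<zero> = 0"
  using nrm_eq_0[of \<zero>] by simp

lemma nrm_nonneg: "v \<in> carrier V \<Longrightarrow> 0 \<le> nrm V v"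
  using nrm_add[of v "\<ominus> v"] nrm_neg[of v] by (simp add: M.r_neg)

lemma nrm_minus_commute:
  assumes "v \<in> carrier V" "w \<in> carrier V" shows "nrm V (v \<ominus> w) = nrm V (w \<ominus> v)"
proof -
  have "v \<ominus> w = \<ominus> (w \<ominus> v)" using assms by (simp add: M.minus_add M.minus_eq M.a_comm)
  then show ?thesis using assms nrm_neg[of "w \<ominus> v"] by simp
qed

lemma nrm_triangle:
  assumes "u \<in> carrier V" "v \<in> carrier V" "w \<in> carrier V"
  shows "nrm V (u \<ominus> w) \<le> nrm V (u \<ominus> v) + nrm V (v \<ominus> w)"
proof -
  have "u \<ominus> w = (u \<ominus> v) \<oplus> (v \<ominus> w)"
  proof -
    have "\<ominus> v \<oplus> (v \<oplus> \<ominus> w) = \<ominus> w" using assms by (simp add: M.r_neg1)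
    then show ?thesis using assms by (simp add: M.minus_eq M.a_assoc)
  qed
  then show ?thesis using assms nrm_add[of "u \<ominus> v" "v \<ominus> w"] by simp
qed

lemma metric: "Metric_space (carrier V) (norm_dist V)"
proof
  show "0 \<le> norm_dist V v w" for v w by (simp add: norm_dist_def nrm_nonneg)
  show "norm_dist V v w = norm_dist V w v" for v w by (simp add: norm_dist_def nrm_minus_commute)
  show "norm_dist V v w = 0 \<longleftrightarrow> v = w" if "v \<in> carrier V" "w \<in> carrier V" for v w
    using that by (simp add: norm_dist_def nrm_eq_0 M.minus_eq M.add.inv_solve_right' a_inv_def[symmetric])
  show "norm_dist V u w \<le> norm_dist V u v + norm_dist V v w" if "u \<in> carrier V" "v \<in> carrier V" "w \<in> carrier V" for u v w
    using that by (simp add: norm_dist_def nrm_triangle)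
qed

lemma separable_iff:
  "separable_space (norm_topology V) \<longleftrightarrow>
     (\<exists>C. countable C \<and> C \<subseteq> carrier V \<and> (\<forall>v\<in>carrier V. \<forall>r>0. \<exists>w\<in>C. nrm V (v \<ominus> w) < r))"
proof -
  have "norm_dist V v w = nrm V (v \<ominus> w)" if "v \<in> carrier V" "w \<in> carrier V" for v w
    using that by (simp add: norm_dist_def)
  then show ?thesis
    unfolding norm_topology_def Metric_space.separable_space_mtopology_iff[OF metric]
    by (intro ex_cong conj_cong refl ball_cong all_cong1 imp_cong bex_cong) (auto simp: subset_iff)
qed

section \<open>The dual norm as a metric\<close>

lemma dual_add: "\<phi> \<in> dual V \<Longrightarrow> v \<in> carrier V \<Longrightarrow> w \<in> carrier V \<Longrightarrow> \<phi> (v \<oplus> w) = \<phi> v + \<phi> w"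
  and dual_smult: "\<phi> \<in> dual V \<Longrightarrow> v \<in> carrier V \<Longrightarrow> \<phi> (c \<odot> v) = c * \<phi> v"
  and dual_bounded: "\<phi> \<in> dual V \<Longrightarrow> \<exists>K. \<forall>v\<in>carrier V. \<bar>\<phi> v\<bar> \<le> K * nrm V v"
  by (auto simp: dual_def)

lemma dual_diff_bounded:
  assumes "\<phi> \<in> dual V" "\<psi> \<in> dual V"
  obtains K where "K \<ge> 0" "\<And>v. v \<in> carrier V \<Longrightarrow> \<bar>\<phi> v - \<psi> v\<bar> \<le> K * nrm V v"
proof -
  obtain K1 K2 where K: "\<forall>v\<in>carrier V. \<bar>\<phi> v\<bar> \<le> K1 * nrm V v" "\<forall>v\<in>carrier V. \<bar>\<psi> v\<bar> \<le> K2 * nrm V v"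
    using dual_bounded assms by metis
  show ?thesis
  proof (rule that[of "\<bar>K1\<bar> + \<bar>K2\<bar>"])
    fix v assume v: "v \<in> carrier V"
    have "K1 * nrm V v \<le> \<bar>K1\<bar> * nrm V v" "K2 * nrm V v \<le> \<bar>K2\<bar> * nrm V v"
      using nrm_nonneg[OF v] by (auto intro: mult_right_mono)
    then show "\<bar>\<phi> v - \<psi> v\<bar> \<le> (\<bar>K1\<bar> + \<bar>K2\<bar>) * nrm V v"
      using bspec[OF K(1) v] bspec[OF K(2) v] by (simp add: distrib_right)
  qed simp
qed

lemma dual_dist_le:
  assumes "\<phi> \<in> dual V" "\<psi> \<in> dual V" "0 \<le> e" "\<And>v. v \<in> carrier V \<Longrightarrow> \<bar>\<phi> v - \<psi> v\<bar> \<le> e * nrm V v"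
  shows "dual_dist V \<phi> \<psi> \<le> e"
proof -
  have "dual_norm V (\<lambda>v. \<phi> v - \<psi> v) \<le> e" unfolding dual_norm_def
  proof (rule cSUP_least)
    have "\<zero> \<in> {v \<in> carrier V. nrm V v \<le> 1}" by simp
    then show "{v \<in> carrier V. nrm V v \<le> 1} \<noteq> {}" by blast
    fix v assume v: "v \<in> {v \<in> carrier V. nrm V v \<le> 1}"
    have "\<bar>\<phi> v - \<psi> v\<bar> \<le> e * nrm V v" using assms(4) v by simp
    also have "\<dots> \<le> e" using v assms(3) by (simp add: mult_left_le)
    finally show "\<bar>\<phi> v - \<psi> v\<bar> \<le> e" .
  qed
  then show ?thesis using assms by (simp add: dual_dist_def)
qed

lemma dual_dist_bound:
  assumes "\<phi> \<in> dual V" "\<psi> \<in> dual V" "v \<in> carrier V"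
  shows "\<bar>\<phi> v - \<psi> v\<bar> \<le> dual_dist V \<phi> \<psi> * nrm V v"
proof (cases "nrm V v = 0")
  case True
  then show ?thesis using dual_diff_bounded[OF assms(1,2)] assms(3) by (metis mult_zero_right)
next
  case False
  then have pos: "nrm V v > 0" using nrm_nonneg[OF assms(3)] by simp
  obtain K where K: "K \<ge> 0" "\<And>v. v \<in> carrier V \<Longrightarrow> \<bar>\<phi> v - \<psi> v\<bar> \<le> K * nrm V v"
    using dual_diff_bounded[OF assms(1,2)] by metis
  define u where "u = (1 / nrm V v) \<odot> v"
  have u: "u \<in> carrier V" "nrm V u = 1" using assms(3) pos by (simp_all add: u_def nrm_smult)
  have "bdd_above ((\<lambda>v. \<bar>\<phi> v - \<psi> v\<bar>) ` {v \<in> carrier V. nrm V v \<le> 1})"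
  proof (rule bdd_aboveI2)
    fix v assume "v \<in> {v \<in> carrier V. nrm V v \<le> 1}"
    then have "\<bar>\<phi> v - \<psi> v\<bar> \<le> K * nrm V v" "K * nrm V v \<le> K" using K by (simp_all add: mult_left_le)
    then show "\<bar>\<phi> v - \<psi> v\<bar> \<le> K" by simp
  qed
  then have "\<bar>\<phi> u - \<psi> u\<bar> \<le> dual_norm V (\<lambda>v. \<phi> v - \<psi> v)" unfolding dual_norm_def
    by (intro cSUP_upper) (use u in auto)
  then have "\<bar>\<phi> u - \<psi> u\<bar> \<le> dual_dist V \<phi> \<psi>" using assms by (simp add: dual_dist_def)
  moreover have "\<phi> u - \<psi> u = (\<phi> v - \<psi> v) / nrm V v"
    using assms by (simp add: u_def dual_smult diff_divide_distrib)
  ultimately show ?thesis using pos by (simp add: abs_divide field_simps)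
qed

lemma dual_metric: "Metric_space (dual V) (dual_dist V)"
proof
  show nonneg: "0 \<le> dual_dist V \<phi> \<psi>" for \<phi> \<psi>
  proof (cases "\<phi> \<in> dual V \<and> \<psi> \<in> dual V")
    case True
    then obtain K where K: "K \<ge> 0" "\<And>v. v \<in> carrier V \<Longrightarrow> \<bar>\<phi> v - \<psi> v\<bar> \<le> K * nrm V v"
      using dual_diff_bounded by metis
    have "bdd_above ((\<lambda>v. \<bar>\<phi> v - \<psi> v\<bar>) ` {v \<in> carrier V. nrm V v \<le> 1})"
    proof (rule bdd_aboveI2)
      fix v assume "v \<in> {v \<in> carrier V. nrm V v \<le> 1}"
      then have "\<bar>\<phi> v - \<psi> v\<bar> \<le> K * nrm V v" "K * nrm V v \<le> K" using K by (simp_all add: mult_left_le)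
      then show "\<bar>\<phi> v - \<psi> v\<bar> \<le> K" by simp
    qed
    then have "\<bar>\<phi> \<zero> - \<psi> \<zero>\<bar> \<le> dual_norm V (\<lambda>v. \<phi> v - \<psi> v)" unfolding dual_norm_def
      by (intro cSUP_upper) auto
    then have "0 \<le> dual_norm V (\<lambda>v. \<phi> v - \<psi> v)" by (rule order_trans[OF abs_ge_zero])
    then show ?thesis by (simp add: dual_dist_def)
  qed (auto simp: dual_dist_def)
  show commute: "dual_dist V \<phi> \<psi> = dual_dist V \<psi> \<phi>" for \<phi> \<psi>
    by (simp add: dual_dist_def dual_norm_def abs_minus_commute)
  show "dual_dist V \<phi> \<psi> = 0 \<longleftrightarrow> \<phi> = \<psi>" if "\<phi> \<in> dual V" "\<psi> \<in> dual V" for \<phi> \<psi>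
  proof
    assume "dual_dist V \<phi> \<psi> = 0"
    then have eq: "\<phi> v = \<psi> v" if "v \<in> carrier V" for v using dual_dist_bound[OF \<open>\<phi> \<in> dual V\<close> \<open>\<psi> \<in> dual V\<close> that] by simp
    show "\<phi> = \<psi>"
      by (rule extensionalityI[of _ "carrier V"]) (use that eq in \<open>auto simp: dual_def\<close>)
  next
    assume "\<phi> = \<psi>"
    then have "dual_dist V \<phi> \<psi> \<le> 0" using that by (intro dual_dist_le) auto
    then show "dual_dist V \<phi> \<psi> = 0" using nonneg[of \<phi> \<psi>] by simp
  qed
  show "dual_dist V \<phi> \<xi> \<le> dual_dist V \<phi> \<psi> + dual_dist V \<psi> \<xi>"
    if d: "\<phi> \<in> dual V" "\<psi> \<in> dual V" "\<xi> \<in> dual V" for \<phi> \<psi> \<xi>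
  proof (rule dual_dist_le[OF d(1,3)])
    show "0 \<le> dual_dist V \<phi> \<psi> + dual_dist V \<psi> \<xi>" using nonneg by (simp add: add_nonneg_nonneg)
    show "\<bar>\<phi> v - \<xi> v\<bar> \<le> (dual_dist V \<phi> \<psi> + dual_dist V \<psi> \<xi>) * nrm V v" if "v \<in> carrier V" for v
      using dual_dist_bound[OF d(1,2) that] dual_dist_bound[OF d(2,3) that] by (simp add: distrib_right)
  qed
qed

lemma dual_separable_iff:
  "separable_space (dual_norm_topology V) \<longleftrightarrow>
     (\<exists>C. countable C \<and> C \<subseteq> dual V \<and> (\<forall>\<phi>\<in>dual V. \<forall>r>0. \<exists>\<psi>\<in>C. dual_dist V \<phi> \<psi> < r))"
  unfolding dual_norm_topology_def by (rule Metric_space.separable_space_mtopology_iff[OF dual_metric])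

lemma normed_carrier_submodule:
  assumes "submodule W real_ring V" shows "normed_carrier (V\<lparr>carrier := W\<rparr>)"
proof
  have WV: "W \<subseteq> carrier V" using submoduleE(1)[OF assms] .
  then show "normed_space (V\<lparr>carrier := W\<rparr>)"
    unfolding normed_space_def
    using submodule.submodule_is_module[OF assms module_axioms] nrm_eq_0 nrm_smult nrm_add
    by (auto simp: subset_iff)
qed

lemma minus_submodule:
  assumes "submodule W real_ring V" "v \<in> W" "w \<in> W"
  shows "v \<ominus>\<^bsub>V\<lparr>carrier := W\<rparr>\<^esub> w = v \<ominus> w"
proof -
  interpret W: normed_carrier "V\<lparr>carrier := W\<rparr>" by (rule normed_carrier_submodule[OF assms(1)])
  have "\<ominus>\<^bsub>V\<lparr>carrier := W\<rparr>\<^esub> w = \<ominus> w"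
    using W.neg_eq[of w] neg_eq[of w] assms submoduleE(1)[OF assms(1)] by auto
  then show ?thesis by (simp add: a_minus_def)
qed

text \<open>Rationality is imposed where the lists are drawn from \<open>\<rat> \<times> A\<close>.
  Lists make the combinations over a countable \<open>A\<close> visibly countable.\<close>

definition rat_comb :: "(real \<times> 'v) list \<Rightarrow> 'v" where
  "rat_comb l = foldr (\<lambda>(q, v) w. q \<odot> v \<oplus> w) l \<zero>"

lemma rat_comb_closed: "snd ` set l \<subseteq> carrier V \<Longrightarrow> rat_comb l \<in> carrier V"
  by (induction l) (auto simp: rat_comb_def)

lemma rat_comb_append:
  "snd ` set l \<subseteq> carrier V \<Longrightarrow> snd ` set l' \<subseteq> carrier V \<Longrightarrow> rat_comb (l @ l') = rat_comb l \<oplus> rat_comb l'"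
proof (induction l)
  case Nil
  then show ?case using rat_comb_closed[of l'] by (simp add: rat_comb_def)
next
  case (Cons a l)
  have "rat_comb l \<in> carrier V" "rat_comb l' \<in> carrier V" using Cons.prems by (auto intro!: rat_comb_closed)
  then show ?case using Cons by (cases a) (simp add: rat_comb_def M.a_assoc)
qed

lemma rat_comb_scale:
  "snd ` set l \<subseteq> carrier V \<Longrightarrow> rat_comb (map (\<lambda>(q, v). (c * q, v)) l) = c \<odot> rat_comb l"
proof (induction l)
  case Nil
  then show ?case using smult_r_null[of c] by (simp add: rat_comb_def)
next
  case (Cons a l)
  have "rat_comb l \<in> carrier V" using Cons.prems by (auto intro!: rat_comb_closed)
  then show ?case using Cons smult_assoc1[of c "fst a" "snd a"] smult_r_distr[of c "fst a \<odot> snd a" "rat_comb l"]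
    by (cases a) (simp add: rat_comb_def)
qed

text \<open>The norm closure of the rational span. Separability is then immediate for countable
  \<open>A\<close>, and closure under real scalars becomes the point to prove.\<close>

definition closed_span :: "'v set \<Rightarrow> 'v set" where
  "closed_span A = {w \<in> carrier V. \<forall>e>0. \<exists>l\<in>lists (\<rat> \<times> A). nrm V (w \<ominus> rat_comb l) < e}"

lemma closed_spanE:
  assumes "w \<in> closed_span A" "e > 0"
  obtains l where "l \<in> lists (\<rat> \<times> A)" "nrm V (w \<ominus> rat_comb l) < e"
  using assms unfolding closed_span_def by blast

context
  fixes A assumes A: "A \<subseteq> carrier V"
begin

lemma lists_closed: "l \<in> lists (\<rat> \<times> A) \<Longrightarrow> snd ` set l \<subseteq> carrier V"
  using A by (auto simp: lists_eq_set)

lemma rat_comb_in: "l \<in> lists (\<rat> \<times> A) \<Longrightarrow> rat_comb l \<in> closed_span A"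
  unfolding closed_span_def
  by (intro CollectI conjI rat_comb_closed lists_closed allI impI bexI[of _ l])
     (simp_all add: M.minus_eq M.r_neg rat_comb_closed[OF lists_closed])

lemma subset_closed_span: "A \<subseteq> closed_span A"
proof
  fix a assume a: "a \<in> A"
  have "rat_comb [(1, a)] \<in> closed_span A" using a by (intro rat_comb_in) auto
  then show "a \<in> closed_span A" using a A smult_one[of a] by (auto simp: rat_comb_def)
qed

lemma closed_span_add:
  assumes "v \<in> closed_span A" "w \<in> closed_span A" shows "v \<oplus> w \<in> closed_span A"
proof -
  have vw: "v \<in> carrier V" "w \<in> carrier V" using assms by (auto simp: closed_span_def)
  have "\<exists>l\<in>lists (\<rat> \<times> A). nrm V ((v \<oplus> w) \<ominus> rat_comb l) < e" if e: "e > 0" for e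
  proof -
    obtain l where l: "l \<in> lists (\<rat> \<times> A)" "nrm V (v \<ominus> rat_comb l) < e / 2"
      by (rule closed_spanE[OF assms(1), of "e / 2"]) (use e in simp)
    obtain l' where l': "l' \<in> lists (\<rat> \<times> A)" "nrm V (w \<ominus> rat_comb l') < e / 2"
      by (rule closed_spanE[OF assms(2), of "e / 2"]) (use e in simp)
    have cl: "rat_comb l \<in> carrier V" "rat_comb l' \<in> carrier V"
      using l l' by (auto intro!: rat_comb_closed lists_closed)
    have "(v \<oplus> w) \<ominus> rat_comb (l @ l') = (v \<ominus> rat_comb l) \<oplus> (w \<ominus> rat_comb l')"
      using vw cl l l' by (simp add: rat_comb_append lists_closed M.minus_eq M.minus_add M.a_ac)
    then have "nrm V ((v \<oplus> w) \<ominus> rat_comb (l @ l')) < e"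
      using nrm_add[of "v \<ominus> rat_comb l" "w \<ominus> rat_comb l'"] vw cl l l' by simp
    then show ?thesis using l l' by (intro bexI[of _ "l @ l'"]) auto
  qed
  then show ?thesis using vw by (simp add: closed_span_def)
qed

lemma closed_span_smult:
  assumes "v \<in> closed_span A" shows "c \<odot> v \<in> closed_span A"
proof -
  have v: "v \<in> carrier V" using assms by (auto simp: closed_span_def)
  have "\<exists>l\<in>lists (\<rat> \<times> A). nrm V (c \<odot> v \<ominus> rat_comb l) < e" if e: "e > 0" for e
  proof -
    have pos: "e / (2 * (\<bar>c\<bar> + 1)) > 0" using e by (intro divide_pos_pos) auto
    obtain l where l: "l \<in> lists (\<rat> \<times> A)" "nrm V (v \<ominus> rat_comb l) < e / (2 * (\<bar>c\<bar> + 1))"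
      by (rule closed_spanE[OF assms pos])
    have cl: "rat_comb l \<in> carrier V" using l by (auto intro!: rat_comb_closed lists_closed)
    let ?n = "nrm V (rat_comb l)"
    have n0: "?n \<ge> 0" by (rule nrm_nonneg[OF cl])
    define r where "r = e / (2 * (?n + 1))"
    have r: "r > 0" unfolding r_def using e n0 by (intro divide_pos_pos) auto
    \<comment> \<open>The rational \<open>q\<close> is chosen after \<open>l\<close>, because
      replacing \<open>c\<close> by \<open>q\<close> costs \<open>\<bar>c - q\<bar>\<close> times
      the norm of the combination already fixed.\<close>
    obtain q where q: "q \<in> \<rat>" "c < q" "q < c + r" using Rats_dense_in_real[of c "c + r"] r by auto
    define l' where "l' = map (\<lambda>(p, v). (q * p, v)) l"
    have l': "l' \<in> lists (\<rat> \<times> A)" using l(1) q(1) by (fastforce simp: l'_def lists_eq_set)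
    have rl': "rat_comb l' = q \<odot> rat_comb l" unfolding l'_def by (rule rat_comb_scale[OF lists_closed[OF l(1)]])
    have 1: "nrm V (c \<odot> v \<ominus> c \<odot> rat_comb l) < e / 2"
    proof -
      have "c \<odot> v \<ominus> c \<odot> rat_comb l = c \<odot> (v \<ominus> rat_comb l)"
        using v cl smult_r_distr[of c v "\<ominus> rat_comb l"] smult_r_minus[of c "rat_comb l"] by (simp add: M.minus_eq)
      then have "nrm V (c \<odot> v \<ominus> c \<odot> rat_comb l) = \<bar>c\<bar> * nrm V (v \<ominus> rat_comb l)"
        using nrm_smult v cl by simp
      also have "\<dots> \<le> (\<bar>c\<bar> + 1) * nrm V (v \<ominus> rat_comb l)" using nrm_nonneg v cl by (intro mult_right_mono) auto
      also have "\<dots> < e / 2" using l(2) by (simp add: field_simps)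
      finally show ?thesis .
    qed
    have 2: "nrm V (c \<odot> rat_comb l \<ominus> rat_comb l') \<le> e / 2"
    proof -
      have "c \<odot> rat_comb l \<ominus> rat_comb l' = (c - q) \<odot> rat_comb l"
        using smult_l_distr[of c "- q" "rat_comb l"] smult_assoc1[of "-1" q "rat_comb l"] cl
        by (simp add: rl' M.minus_eq neg_eq)
      then have "nrm V (c \<odot> rat_comb l \<ominus> rat_comb l') = \<bar>c - q\<bar> * ?n" using nrm_smult[OF cl] by simp
      also have "\<dots> \<le> r * (?n + 1)" using q n0 r by (intro mult_mono) auto
      also have "\<dots> = e / 2"
      proof -
        have "e / (2 * m) * m = e / 2" if "m > 0" for m using that by simp
        from this[of "?n + 1"] show ?thesis using n0 unfolding r_def by simp
      qed
      finally show ?thesis .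
    qed
    have "nrm V (c \<odot> v \<ominus> rat_comb l') < e"
      using nrm_triangle[of "c \<odot> v" "c \<odot> rat_comb l" "rat_comb l'"] 1 2 v cl by (simp add: rl')
    then show ?thesis using l' by blast
  qed
  then show ?thesis using v by (simp add: closed_span_def)
qed

lemma closed_span_submodule: "submodule (closed_span A) real_ring V"
proof (rule submoduleI)
  show "closed_span A \<subseteq> carrier V" by (auto simp: closed_span_def)
  have "rat_comb [] \<in> closed_span A" by (rule rat_comb_in) simp
  then show "\<zero> \<in> closed_span A" by (simp add: rat_comb_def)
  show "\<ominus> a \<in> closed_span A" if "a \<in> closed_span A" for a
  proof -
    have "a \<in> carrier V" using that by (simp add: closed_span_def)
    then show ?thesis using closed_span_smult[OF that, of "-1"] by (simp add: neg_eq)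
  qed
qed (auto intro: closed_span_add closed_span_smult)

lemma closed_span_closed: "closedin (norm_topology V) (closed_span A)"
proof -
  interpret M: Metric_space "carrier V" "norm_dist V" by (rule metric)
  have "M.mtopology closure_of (closed_span A) \<subseteq> closed_span A"
  proof
    fix v assume "v \<in> M.mtopology closure_of (closed_span A)"
    then have v: "v \<in> carrier V" and near: "\<And>r. r > 0 \<Longrightarrow> \<exists>w\<in>closed_span A. w \<in> M.mball v r"
      unfolding M.metric_closure_of by simp_all
    have "\<exists>l\<in>lists (\<rat> \<times> A). nrm V (v \<ominus> rat_comb l) < e" if e: "e > 0" for e
    proof -
      obtain w where w: "w \<in> closed_span A" "nrm V (v \<ominus> w) < e / 2"
        using near[of "e/2"] e by (auto simp: norm_dist_def)
      obtain l where l: "l \<in> lists (\<rat> \<times> A)" "nrm V (w \<ominus> rat_comb l) < e / 2"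
        by (rule closed_spanE[OF w(1), of "e / 2"]) (use e in simp)
      have "rat_comb l \<in> carrier V" "w \<in> carrier V"
        using l w by (auto intro!: rat_comb_closed lists_closed simp: closed_span_def)
      then have "nrm V (v \<ominus> rat_comb l) < e"
        using nrm_triangle[of v w "rat_comb l"] v w(2) l(2) by simp
      then show ?thesis using l(1) by blast
    qed
    then show "v \<in> closed_span A" using v by (simp add: closed_span_def)
  qed
  moreover have "closed_span A \<subseteq> topspace M.mtopology" by (auto simp: closed_span_def)
  ultimately show ?thesis unfolding norm_topology_def using closure_of_subset_eq by metis
qed

lemma closed_span_separable:
  assumes "countable A"
  shows "separable_space (norm_topology (V\<lparr>carrier := closed_span A\<rparr>))"
proof -
  interpret W: normed_carrier "V\<lparr>carrier := closed_span A\<rparr>"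
    by (rule normed_carrier_submodule[OF closed_span_submodule])
  show ?thesis
    unfolding W.separable_iff
  proof (intro exI[of _ "rat_comb ` lists (\<rat> \<times> A)"] conjI)
    show "countable (rat_comb ` lists (\<rat> \<times> A))" using assms countable_rat by auto
    show "rat_comb ` lists (\<rat> \<times> A) \<subseteq> carrier (V\<lparr>carrier := closed_span A\<rparr>)"
      using rat_comb_in by auto
    show "\<forall>v\<in>carrier (V\<lparr>carrier := closed_span A\<rparr>). \<forall>r>0. \<exists>w\<in>rat_comb ` lists (\<rat> \<times> A).
        nrm (V\<lparr>carrier := closed_span A\<rparr>) (v \<ominus>\<^bsub>V\<lparr>carrier := closed_span A\<rparr>\<^esub> w) < r"
    proof (intro ballI allI impI)
      fix v and r :: real assume v: "v \<in> carrier (V\<lparr>carrier := closed_span A\<rparr>)" and r: "r > 0"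
      then have "v \<in> closed_span A" by simp
      then obtain l where l: "l \<in> lists (\<rat> \<times> A)" "nrm V (v \<ominus> rat_comb l) < r"
        by (rule closed_spanE[OF _ r])
      have "v \<ominus>\<^bsub>V\<lparr>carrier := closed_span A\<rparr>\<^esub> rat_comb l = v \<ominus> rat_comb l"
        using v rat_comb_in[OF l(1)] by (intro minus_submodule[OF closed_span_submodule]) auto
      then show "\<exists>w\<in>rat_comb ` lists (\<rat> \<times> A).
        nrm (V\<lparr>carrier := closed_span A\<rparr>) (v \<ominus>\<^bsub>V\<lparr>carrier := closed_span A\<rparr>\<^esub> w) < r"
        using l(2) by (intro bexI[OF _ imageI[OF l(1)]]) simp
    qed
  qed
qed

end

lemma restrict_dual:
  assumes "submodule W real_ring V" "\<phi> \<in> dual V"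
  shows "restrict \<phi> W \<in> dual (V\<lparr>carrier := W\<rparr>)"
proof -
  have WV: "W \<subseteq> carrier V" using submoduleE(1)[OF assms(1)] .
  obtain K where K: "\<forall>v\<in>carrier V. \<bar>\<phi> v\<bar> \<le> K * nrm V v" using dual_bounded[OF assms(2)] by blast
  have cl: "v \<oplus> w \<in> W" "c \<odot> v \<in> W" if "v \<in> W" "w \<in> W" for v w c
    using that submoduleE(4,5)[OF assms(1)] by auto
  show ?thesis unfolding dual_def
  proof (intro CollectI conjI ballI allI)
    show "\<exists>K. \<forall>v\<in>carrier (V\<lparr>carrier := W\<rparr>). \<bar>restrict \<phi> W v\<bar> \<le> K * nrm (V\<lparr>carrier := W\<rparr>) v"
      using K WV by (intro exI[of _ K]) auto
  qed (use cl WV dual_add[OF assms(2)] dual_smult[OF assms(2)] in \<open>auto simp: subset_iff\<close>)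
qed

end

text \<open>The closed span of \<open>A\<close> is a separable subspace, so its dual has a countable
  dense set. Restricting functionals to the span and taking preimages of small balls gives the
  countable cover; boundedness of \<open>A\<close> turns dual distance into a uniform bound on
  \<open>A\<close>.\<close>

lemma asplund_dual_cover:
  assumes "asplund_space V" "countable A" "A \<subseteq> carrier V" "\<And>v. v \<in> A \<Longrightarrow> nrm V v \<le> c" and r: "r > 0"
  shows "\<exists>\<A>. countable \<A> \<and> dual V \<subseteq> \<Union>\<A> \<and> (\<forall>B\<in>\<A>. \<forall>\<phi>\<in>B. \<forall>\<psi>\<in>B. \<forall>v\<in>A. \<bar>\<phi> v - \<psi> v\<bar> < r)"
proof -
  interpret normed_carrier V
    using assms(1) by (simp add: asplund_space_def banach_space_def normed_carrier_def)
  let ?W = "closed_span A"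
  let ?V = "V\<lparr>carrier := ?W\<rparr>"
  have sub: "submodule ?W real_ring V" by (rule closed_span_submodule[OF assms(3)])
  interpret W: normed_carrier ?V by (rule normed_carrier_submodule[OF sub])
  have "separable_space (dual_norm_topology ?V)"
    using assms(1) sub closed_span_closed[OF assms(3)] closed_span_separable[OF assms(3,2)]
    unfolding asplund_space_def by simp
  then obtain C where C: "countable C" "C \<subseteq> dual ?V" "\<forall>\<phi>\<in>dual ?V. \<forall>r>0. \<exists>\<psi>\<in>C. dual_dist ?V \<phi> \<psi> < r"
    unfolding W.dual_separable_iff by blast
  \<comment> \<open>Functionals near the same centre differ on \<open>A\<close> by at most
    \<open>2 * s * \<bar>c\<bar>\<close>. The summand 1 avoids division by zero and makes the bound
    strict.\<close>
  define s where "s = r / (2 * (\<bar>c\<bar> + 1))"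
  have s: "s > 0" unfolding s_def using r by (intro divide_pos_pos) auto
  define B where "B \<xi> = {\<phi> \<in> dual V. dual_dist ?V (restrict \<phi> ?W) \<xi> < s}" for \<xi>
  have close: "\<bar>\<phi> v - \<xi> v\<bar> < r / 2" if "\<xi> \<in> C" "\<phi> \<in> B \<xi>" "v \<in> A" for \<phi> \<xi> v
  proof -
    have v: "v \<in> ?W" using subset_closed_span[OF assms(3)] that(3) by auto
    have "\<bar>restrict \<phi> ?W v - \<xi> v\<bar> \<le> dual_dist ?V (restrict \<phi> ?W) \<xi> * nrm V v"
      using W.dual_dist_bound[of "restrict \<phi> ?W" \<xi> v] restrict_dual[OF sub] that(1,2) C(2) v by (auto simp: B_def)
    also have "\<dots> \<le> s * (\<bar>c\<bar>)"
      using that(2) assms(4)[OF that(3)] s nrm_nonneg[of v] that(3) assms(3) by (intro mult_mono) (auto simp: B_def)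
    also have "\<dots> < s * (\<bar>c\<bar> + 1)" using s by simp
    also have "\<dots> = r / 2" by (simp add: s_def field_simps)
    finally show ?thesis using v by simp
  qed
  show ?thesis
  proof (intro exI[of _ "B ` C"] conjI ballI)
    show "countable (B ` C)" using C(1) by simp
    show "dual V \<subseteq> \<Union> (B ` C)"
    proof
      fix \<phi> assume \<phi>: "\<phi> \<in> dual V"
      then obtain \<xi> where "\<xi> \<in> C" "dual_dist ?V (restrict \<phi> ?W) \<xi> < s"
        using C(3) restrict_dual[OF sub \<phi>] s by blast
      then show "\<phi> \<in> \<Union> (B ` C)" using \<phi> by (auto simp: B_def)
    qed
    fix D \<phi> \<psi> v assume "D \<in> B ` C" "\<phi> \<in> D" "\<psi> \<in> D" "v \<in> A"
    then obtain \<xi> where "\<xi> \<in> C" "\<phi> \<in> B \<xi>" "\<psi> \<in> B \<xi>" by auto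
    then show "\<bar>\<phi> v - \<psi> v\<bar> < r" using close[of \<xi> \<phi> v] close[of \<xi> \<psi> v] \<open>v \<in> A\<close> by linarith
  qed
qed

section \<open>Subsystems of products of Radon-Nikodym systems\<close>

text \<open>Intersections of cells from two countable covers again form a countable cover.\<close>

lemma sigma_small_Un_index:
  assumes "sigma_small c J1 r P" "sigma_small c J2 r P"
  shows "sigma_small c (J1 \<union> J2) r P"
proof -
  obtain \<A> where A: "countable \<A>" "P \<subseteq> \<Union>\<A>" "\<forall>A\<in>\<A>. \<forall>x\<in>A. \<forall>y\<in>A. \<forall>i\<in>J1. \<bar>c i x - c i y\<bar> < r"
    using assms(1) unfolding sigma_small_def by (elim exE conjE)
  obtain \<B> where B: "countable \<B>" "P \<subseteq> \<Union>\<B>" "\<forall>A\<in>\<B>. \<forall>x\<in>A. \<forall>y\<in>A. \<forall>i\<in>J2. \<bar>c i x - c i y\<bar> < r"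
    using assms(2) unfolding sigma_small_def by (elim exE conjE)
  show ?thesis
    unfolding sigma_small_def
  proof (intro exI[of _ "(\<lambda>(A, B). A \<inter> B) ` (\<A> \<times> \<B>)"] conjI ballI)
    show "countable ((\<lambda>(A, B). A \<inter> B) ` (\<A> \<times> \<B>))" using A(1) B(1) by simp
    show "P \<subseteq> \<Union> ((\<lambda>(A, B). A \<inter> B) ` (\<A> \<times> \<B>))" using A(2) B(2) by fastforce
    fix C x y i assume "C \<in> (\<lambda>(A, B). A \<inter> B) ` (\<A> \<times> \<B>)" and xy: "x \<in> C" "y \<in> C" and i: "i \<in> J1 \<union> J2"
    then obtain A' B' where "A' \<in> \<A>" "B' \<in> \<B>" "C = A' \<inter> B'" by auto
    then have "x \<in> A'" "y \<in> A'" "x \<in> B'" "y \<in> B'" using xy by auto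
    then show "\<bar>c i x - c i y\<bar> < r" using i A(3) B(3) \<open>A' \<in> \<A>\<close> \<open>B' \<in> \<B>\<close> by (cases "i \<in> J1") auto
  qed
qed

lemma embedding_map_continuous: "embedding_map X Y f \<Longrightarrow> continuous_map X Y f"
  unfolding embedding_map_def by (meson continuous_map_in_subtopology homeomorphic_imp_continuous_map)

lemma continuous_map_weak_star_evaluation:
  assumes "continuous_map X (weak_star_topology V) \<alpha>" "v \<in> carrier V"
  shows "continuous_map X euclideanreal (\<lambda>x. \<alpha> x v)"
proof -
  have "continuous_map X (product_topology (\<lambda>_. euclideanreal) (carrier V)) \<alpha>"
    using assms(1) unfolding weak_star_topology_def by (simp add: continuous_map_in_subtopology)
  then show ?thesis using assms(2) by (auto simp: continuous_map_componentwise)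
qed

lemma topspace_weak_star: "topspace (weak_star_topology V) = dual V"
  by (auto simp: weak_star_topology_def dual_def PiE_def)

text \<open>The functions that evaluate a coordinate of the product at a vector of its Asplund space
  separate the points of \<open>X\<close>. Along \<open>H\<close> such a function becomes the
  evaluation of one functional on the countable orbit of a vector, which is bounded since
  \<open>G\<close> acts by isometries; a cover of the dual therefore pulls back to
  \<open>X\<close>.\<close>

lemma (in compact_system) RN_app_imp_Lindelof:
  fixes u :: "'u itself"
  assumes "RN_app u G T X act"
  shows Lindelof_countable
proof -
  obtain I and Xs :: "'u \<Rightarrow> 'u topology" and acts S
    where RN: "\<forall>i\<in>I. RN u G T (Xs i) (acts i)"
      and iso: "G_isomorphic G X act (subtopology (product_topology Xs I) S) (product_action I acts)"
    using assms unfolding RN_app_def by (elim exE conjE)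
  obtain f where f: "homeomorphic_map X (subtopology (product_topology Xs I) S) f"
    and feq: "\<forall>g\<in>carrier G. \<forall>x\<in>topspace X. f (act g x) = product_action I acts g (f x)"
    using iso unfolding G_isomorphic_def by (elim exE conjE)
  define D where "D i V h \<alpha> \<longleftrightarrow> asplund_space V \<and> cont_cohom G T V h \<and>
        embedding_map (Xs i) (weak_star_topology V) \<alpha> \<and>
        (\<forall>g\<in>carrier G. \<forall>x\<in>topspace (Xs i). \<forall>v\<in>carrier V. \<alpha> (acts i g x) v = \<alpha> x (h g v))"
    for i and V :: "'u normed" and h \<alpha>
  have "\<exists>V h \<alpha>. D i V h \<alpha>" if i: "i \<in> I" for i
  proof -
    have "RN u G T (Xs i) (acts i)" using RN i by simp
    then obtain V :: "'u normed" and h \<alpha> where "asplund_space V" "cont_cohom G T V h"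
        "embedding_map (Xs i) (weak_star_topology V) \<alpha>"
        "\<forall>g\<in>carrier G. \<forall>x\<in>topspace (Xs i). \<forall>v\<in>carrier V. \<alpha> (acts i g x) v = \<alpha> x (h g v)"
      unfolding RN_def by (elim exE conjE)
    then have "D i V h \<alpha>" by (simp add: D_def)
    then show ?thesis by blast
  qed
  then obtain V h \<alpha> where D: "\<And>i. i \<in> I \<Longrightarrow> D i (V i) (h i) (\<alpha> i)" by metis
  have fX: "f x \<in> PiE I (\<lambda>i. topspace (Xs i))" if "x \<in> topspace X" for x
    using homeomorphic_imp_surjective_map[OF f] that by auto
  define F where "F i v x = \<alpha> i (f x i) v" for i v x
  define \<F> where "\<F> = {F i v | i v. i \<in> I \<and> v \<in> carrier (V i)}"
  have proj: "continuous_map X (Xs i) (\<lambda>x. f x i)" if "i \<in> I" for i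
  proof -
    have "continuous_map X (product_topology Xs I) f"
      using homeomorphic_imp_continuous_map[OF f] by (simp add: continuous_map_in_subtopology)
    then show ?thesis using that by (auto simp: continuous_map_componentwise)
  qed
  have emb: "embedding_map (Xs i) (weak_star_topology (V i)) (\<alpha> i)" if "i \<in> I" for i
    using D[OF that] by (simp add: D_def)
  have dualV: "\<alpha> i (f x i) \<in> dual (V i)" if "i \<in> I" "x \<in> topspace X" for i x
  proof -
    have "f x i \<in> topspace (Xs i)" using fX[OF that(2)] that(1) by auto
    then show ?thesis using continuous_map_image_subset_topspace[OF embedding_map_continuous[OF emb[OF that(1)]]]
      unfolding topspace_weak_star by auto
  qed
  show ?thesis
    unfolding Lindelof_countable_def uniformly_Lindelof_subgroup_iff
  proof (intro allI impI ballI, elim conjE)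
    fix H e assume H: "subgroup H G" "countable H" and e: "e \<in> \<mu>"
    have HG: "H \<subseteq> carrier G" using H(1) by (rule subgroup.subset)
    show "\<exists>C. countable C \<and> C \<subseteq> topspace X \<and> topspace X \<subseteq> (\<Union>y\<in>C. H_small H e `` {y})"
    proof (rule Lindelof_of_sigma_small[OF e _ _ _ HG])
      show "continuous_map X euclideanreal k" if k: "k \<in> \<F>" for k
      proof -
        obtain i v where iv: "i \<in> I" "v \<in> carrier (V i)" "k = F i v" using k unfolding \<F>_def by auto
        have "continuous_map X (weak_star_topology (V i)) (\<alpha> i \<circ> (\<lambda>x. f x i))"
          by (rule continuous_map_compose[OF proj[OF iv(1)] embedding_map_continuous[OF emb[OF iv(1)]]])
        from continuous_map_weak_star_evaluation[OF this iv(2)]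
        show ?thesis by (simp add: iv(3) F_def[abs_def] o_def)
      qed
      show "\<exists>k\<in>\<F>. k x \<noteq> k y" if xy: "x \<in> topspace X" "y \<in> topspace X" "x \<noteq> y" for x y
      proof -
        have "f x \<noteq> f y" using homeomorphic_imp_injective_map[OF f] xy by (auto dest: inj_onD)
        then have "\<exists>i\<in>I. f x i \<noteq> f y i" using PiE_ext[OF fX[OF xy(1)] fX[OF xy(2)]] by blast
        then obtain i where i: "i \<in> I" "f x i \<noteq> f y i" by blast
        have "inj_on (\<alpha> i) (topspace (Xs i))"
          using emb[OF i(1)] unfolding embedding_map_def by (rule homeomorphic_imp_injective_map)
        moreover have "f x i \<in> topspace (Xs i)" "f y i \<in> topspace (Xs i)" using fX xy i(1) by auto
        ultimately have ne: "\<alpha> i (f x i) \<noteq> \<alpha> i (f y i)" using i(2) by (auto dest: inj_onD)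
        have "\<exists>v\<in>carrier (V i). \<alpha> i (f x i) v \<noteq> \<alpha> i (f y i) v"
        proof (rule ccontr)
          assume neg: "\<not> ?thesis"
          have "\<alpha> i (f x i) = \<alpha> i (f y i)"
            by (rule extensionalityI[of _ "carrier (V i)"])
              (use neg dualV[OF i(1) xy(1)] dualV[OF i(1) xy(2)] in \<open>auto simp: dual_def\<close>)
          then show False using ne by simp
        qed
        then obtain v where v: "v \<in> carrier (V i)" "F i v x \<noteq> F i v y" by (auto simp: F_def)
        have "F i v \<in> \<F>" unfolding \<F>_def using i(1) v(1) by blast
        then show ?thesis using v(2) by (intro bexI[of _ "F i v"])
      qed
      fix Fs and r :: real assume Fs: "finite Fs" "Fs \<subseteq> \<F>" and r: "r > 0"
      let ?c = "\<lambda>(h, k) x. k (act h x) :: real"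
      have one: "sigma_small ?c (H \<times> {k}) r (topspace X)" if kF: "k \<in> \<F>" for k
      proof -
        obtain i v where iv: "i \<in> I" "v \<in> carrier (V i)" "k = F i v" using kF unfolding \<F>_def by auto
        have Di: "asplund_space (V i)" "cont_cohom G T (V i) (h i)"
          "\<forall>g\<in>carrier G. \<forall>x\<in>topspace (Xs i). \<forall>v\<in>carrier (V i). \<alpha> i (acts i g x) v = \<alpha> i x (h i g v)"
          using D[OF iv(1)] by (simp_all add: D_def)
        have iso: "h i g v \<in> carrier (V i)" "nrm (V i) (h i g v) = nrm (V i) v" if "g \<in> H" for g
        proof -
          have "h i g \<in> linear_isometries (V i)" using conjunct1[OF Di(2)[unfolded cont_cohom_def]] that HG by auto
          then show "h i g v \<in> carrier (V i)" "nrm (V i) (h i g v) = nrm (V i) v"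
            using iv(2) unfolding linear_isometries_def by (auto simp: bij_betw_def)
        qed
        obtain \<A> where A: "countable \<A>" "dual (V i) \<subseteq> \<Union>\<A>"
            "\<forall>B\<in>\<A>. \<forall>\<phi>\<in>B. \<forall>\<psi>\<in>B. \<forall>w\<in>(\<lambda>g. h i g v) ` H. \<bar>\<phi> w - \<psi> w\<bar> < r"
        proof -
          have "\<exists>\<A>. countable \<A> \<and> dual (V i) \<subseteq> \<Union>\<A> \<and>
              (\<forall>B\<in>\<A>. \<forall>\<phi>\<in>B. \<forall>\<psi>\<in>B. \<forall>w\<in>(\<lambda>g. h i g v) ` H. \<bar>\<phi> w - \<psi> w\<bar> < r)"
            by (rule asplund_dual_cover[OF Di(1), where c = "nrm (V i) v"]) (use H(2) iso r in auto)
          then show ?thesis using that by (elim exE conjE)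
        qed
        define P where "P B = {x \<in> topspace X. \<alpha> i (f x i) \<in> B}" for B
        \<comment> \<open>Equivariance shifts the group element from the point to the vector, so the
          functional attached to \<open>x\<close> stays fixed.\<close>
        have k: "k (act g x) = \<alpha> i (f x i) (h i g v)" if "g \<in> H" "x \<in> topspace X" for g x
        proof -
          have "f (act g x) i = acts i g (f x i)" using feq that HG iv(1) by (auto simp: product_action_def)
          moreover have "f x i \<in> topspace (Xs i)" using fX[OF that(2)] iv(1) by auto
          ultimately show ?thesis using Di(3) iv that HG by (auto simp: F_def)
        qed
        show ?thesis
          unfolding sigma_small_def
        proof (intro exI[of _ "P ` \<A>"] conjI ballI)
          show "countable (P ` \<A>)" using A(1) by simp
          show "topspace X \<subseteq> \<Union> (P ` \<A>)"
          proof
            fix x assume x: "x \<in> topspace X"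
            then obtain B where "B \<in> \<A>" "\<alpha> i (f x i) \<in> B" using A(2) dualV[OF iv(1) x] by auto
            then show "x \<in> \<Union> (P ` \<A>)" using x by (auto simp: P_def)
          qed
          fix A' x y j assume "A' \<in> P ` \<A>" "x \<in> A'" "y \<in> A'" and j: "j \<in> H \<times> {k}"
          then obtain B where B: "B \<in> \<A>" "x \<in> P B" "y \<in> P B" by auto
          obtain g where g: "g \<in> H" "j = (g, k)" using j by auto
          have "\<bar>\<alpha> i (f x i) (h i g v) - \<alpha> i (f y i) (h i g v)\<bar> < r" using A(3) B g(1) by (auto simp: P_def)
          then show "\<bar>?c j x - ?c j y\<bar> < r" using B g k by (simp add: P_def)
        qed
      qed
      show "sigma_small ?c (H \<times> Fs) r (topspace X)"
        using Fs
      proof (induction Fs rule: finite_induct)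
        case empty
        show ?case by (rule sigma_small_single) simp
      next
        case (insert k Fs)
        have "sigma_small ?c (H \<times> {k} \<union> H \<times> Fs) r (topspace X)"
          using insert one[of k] by (intro sigma_small_Un_index) auto
        moreover have "H \<times> {k} \<union> H \<times> Fs = H \<times> insert k Fs" by auto
        ultimately show ?case by simp
      qed
    qed
  qed
qed

section \<open>Separable subspaces of interpolation spaces\<close>

text \<open>A copy of \<open>C(X)\<close> inside the bounded functions. Extension by zero makes it
  isometric and determines each vector by its values on \<open>X\<close>.\<close>

definition cont_funs :: "'x topology \<Rightarrow> 'x bfun set" where
  "cont_funs X = {v. continuous_map X euclideanreal (fn v) \<and> (\<forall>x. x \<notin> topspace X \<longrightarrow> fn v x = 0)}"

lemma cont_fun_iff:
  "continuous_map X euclideanreal g \<longleftrightarrow>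
     (\<forall>x\<in>topspace X. \<forall>e>0. \<exists>U. openin X U \<and> x \<in> U \<and> (\<forall>y\<in>U. \<bar>g y - g x\<bar> < e))"
  using Met_TC.continuous_map_to_metric[of X g] by (simp add: dist_real_def abs_minus_commute)

lemma subspace_cont_funs:
  fixes X :: "'x topology" shows "subspace (cont_funs X)"
proof (rule subspaceI)
  fix u v assume "u \<in> cont_funs X" "v \<in> cont_funs X"
  moreover have "fn (u + v) = (\<lambda>x. fn u x + fn v x)" by (rule ext) simp
  ultimately show "u + v \<in> cont_funs X"
    using continuous_map_add[of X "fn u" "fn v"] by (simp add: cont_funs_def)
next
  fix c :: real and v assume "v \<in> cont_funs X"
  moreover have "fn (c *\<^sub>R v) = (\<lambda>x. c * fn v x)" by (rule ext) simp
  ultimately show "c *\<^sub>R v \<in> cont_funs X"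
    using continuous_map_real_mult_left[of X "fn v" c] by (simp add: cont_funs_def)
next
  have "fn (0 :: 'x bfun) = (\<lambda>x. 0)" by (rule ext) simp
  then show "0 \<in> cont_funs X" by (simp add: cont_funs_def)
qed

lemma closed_cont_funs: "closed (cont_funs X)"
proof -
  have "v \<in> cont_funs X" if v: "v \<in> closure (cont_funs X)" for v
  proof -
    have near: "\<exists>u\<in>cont_funs X. norm (u - v) < e" if "e > 0" for e
      using v that by (auto simp: closure_approachable dist_norm)
    have le: "\<bar>fn u x - fn v x\<bar> < e" if "norm (u - v) < e" for u x e
      using abs_fn_le[of "u - v" x] that by simp
    have "continuous_map X euclideanreal (fn v)"
      unfolding cont_fun_iff
    proof (intro ballI allI impI)
      fix x and e :: real assume x: "x \<in> topspace X" and e: "e > 0"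
      obtain u where u: "u \<in> cont_funs X" "norm (u - v) < e / 3" using near[of "e/3"] e by auto
      obtain U where U: "openin X U" "x \<in> U" "\<forall>y\<in>U. \<bar>fn u y - fn u x\<bar> < e / 3"
      proof -
        have "continuous_map X euclideanreal (fn u)" using u(1) by (simp add: cont_funs_def)
        then have "\<exists>U. openin X U \<and> x \<in> U \<and> (\<forall>y\<in>U. \<bar>fn u y - fn u x\<bar> < e / 3)"
          unfolding cont_fun_iff by (elim ballE[of _ _ x] allE[of _ "e/3"]) (use x e in auto)
        then show ?thesis using that by (elim exE conjE)
      qed
      have "\<bar>fn v y - fn v x\<bar> < e" if "y \<in> U" for y
        using bspec[OF U(3) that] le[OF u(2), of y] le[OF u(2), of x] by linarith
      then show "\<exists>U. openin X U \<and> x \<in> U \<and> (\<forall>y\<in>U. \<bar>fn v y - fn v x\<bar> < e)" using U by blast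
    qed
    moreover have "fn v x = 0" if x: "x \<notin> topspace X" for x
    proof (rule ccontr)
      assume "fn v x \<noteq> 0"
      then obtain u where u: "u \<in> cont_funs X" "norm (u - v) < \<bar>fn v x\<bar>" using near[of "\<bar>fn v x\<bar>"] by auto
      then show False using le[OF u(2), of x] x by (simp add: cont_funs_def)
    qed
    ultimately show ?thesis by (simp add: cont_funs_def)
  qed
  then show ?thesis using closure_subset_eq by blast
qed

text \<open>\<open>W_cells\<close> is the form in which the Lindelof property enters the functional
  analysis: one sequence of centres serves a whole countable part of \<open>W\<close>, and each
  point is compared with the same centre for all its members.\<close>

locale function_atoms = atoms W for W :: "'x bfun set" +
  fixes X :: "'x topology"
  assumes compact: "compact_space X" and W_cont: "W \<subseteq> cont_funs X"
    and W_cells: "countable W0 \<Longrightarrow> W0 \<subseteq> W \<Longrightarrow> \<delta> > 0 \<Longrightarrow> \<exists>y :: nat \<Rightarrow> 'x. range y \<subseteq> topspace X \<and>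
        (\<forall>x\<in>topspace X. \<exists>i. \<forall>w\<in>W0. \<bar>fn w x - fn w (y i)\<bar> \<le> \<delta>)"
begin

lemma E_cont: "E \<subseteq> cont_funs X"
  by (rule E_subset_closed_subspace[OF subspace_cont_funs closed_cont_funs W_cont])

text \<open>Each vector of the dense set \<open>D\<close> is split almost optimally at one level
  \<open>n\<close>. The parts in \<open>W\<close> form a countable set, whose cells control their
  oscillation, while the remainders are uniformly small; density extends the estimate to
  \<open>S\<close>.\<close>

lemma separable_cells:
  assumes S: "subspace S" "S \<subseteq> E" and D: "countable D" "D \<subseteq> S" "\<And>v r. v \<in> S \<Longrightarrow> r > 0 \<Longrightarrow> \<exists>d\<in>D. N (v - d) < r"
    and \<eta>: "\<eta> > 0"
  shows "\<exists>y :: nat \<Rightarrow> 'x. range y \<subseteq> topspace X \<and>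
        (\<forall>x\<in>topspace X. \<exists>i. \<forall>v\<in>S. \<bar>fn v x - fn v (y i)\<bar> \<le> \<eta> * N v)"
proof -
  \<comment> \<open>The remainder of \<open>d\<close> has norm at most
    \<open>2 * N d / 2 ^ n\<close>, so its values at \<open>x\<close> and at the centre cost at most
    \<open>\<eta> / 8 * N d\<close> together.\<close>
  obtain n :: nat where n: "4 / 2 ^ n \<le> \<eta> / 8"
  proof -
    obtain n where "(1/2 :: real) ^ n < \<eta> / 32" using real_arch_pow_inv[of "\<eta>/32" "1/2"] \<eta> by auto
    then show ?thesis using that[of n] by (simp add: power_one_over field_simps)
  qed
  \<comment> \<open>The coefficient \<open>t\<close> may reach \<open>2 * N d * 2 ^ n\<close>, and
    \<open>2 * 2 ^ n * \<delta>\<close> is \<open>\<eta> / 8\<close>.\<close>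
  define \<delta> where "\<delta> = \<eta> / (16 * 2 ^ n)"
  have \<delta>: "\<delta> > 0" using \<eta> by (simp add: \<delta>_def)
  have "\<exists>p. 0 \<le> fst p \<and> snd p \<in> W \<and> fst p / 2 ^ n + 2 ^ n * norm (d - fst p *\<^sub>R snd p) \<le> 2 * N d" if d: "d \<in> D" for d
  proof (cases "d = 0")
    case True
    obtain w where "w \<in> W" using W_ne by auto
    then show ?thesis using True by (intro exI[of _ "(0, w)"]) simp
  next
    case False
    have dE: "d \<in> E" using d D S by auto
    have "N d > 0" using N_nonneg[OF dE] N_eq_0[OF dE] False by (simp add: less_le)
    then have "K n d < 2 * N d" using K_le_N[OF dE, of n] by simp
    then obtain t w where "0 \<le> t" "w \<in> W" "t / 2 ^ n + 2 ^ n * norm (d - t *\<^sub>R w) < 2 * N d" by (rule K_near)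
    then show ?thesis by (intro exI[of _ "(t, w)"]) simp
  qed
  then obtain p where p: "\<And>d. d \<in> D \<Longrightarrow> 0 \<le> fst (p d) \<and> snd (p d) \<in> W \<and>
      fst (p d) / 2 ^ n + 2 ^ n * norm (d - fst (p d) *\<^sub>R snd (p d)) \<le> 2 * N d" by metis
  obtain y :: "nat \<Rightarrow> 'x" where y: "range y \<subseteq> topspace X"
    "\<forall>x\<in>topspace X. \<exists>i. \<forall>w\<in>(\<lambda>d. snd (p d)) ` D. \<bar>fn w x - fn w (y i)\<bar> \<le> \<delta>"
    using W_cells[of "(\<lambda>d. snd (p d)) ` D" \<delta>] D(1) p \<delta> by (auto simp: image_subset_iff)
  have "\<exists>i. \<forall>v\<in>S. \<bar>fn v x - fn v (y i)\<bar> \<le> \<eta> * N v" if x: "x \<in> topspace X" for x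
  proof -
    obtain i where i: "\<forall>w\<in>(\<lambda>d. snd (p d)) ` D. \<bar>fn w x - fn w (y i)\<bar> \<le> \<delta>" using y(2) x by blast
    let ?z = "y i"
    have onD: "\<bar>fn d x - fn d ?z\<bar> \<le> \<eta> / 4 * N d" if d: "d \<in> D" for d
    proof -
      define t w where "t = fst (p d)" and "w = snd (p d)"
      have tw: "0 \<le> t" "w \<in> W" "t / 2 ^ n + 2 ^ n * norm (d - t *\<^sub>R w) \<le> 2 * N d"
        using p[OF d] by (auto simp: t_def w_def)
      have nn: "0 \<le> 2 ^ n * norm (d - t *\<^sub>R w)" "0 \<le> t / 2 ^ n" using tw(1) by auto
      have Nd: "0 \<le> N d" using tw(3) nn by linarith
      have "t / 2 ^ n \<le> 2 * N d" "2 ^ n * norm (d - t *\<^sub>R w) \<le> 2 * N d" using tw(3) nn by linarith+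
      then have t: "t \<le> 2 * N d * 2 ^ n" and r: "norm (d - t *\<^sub>R w) \<le> 2 * N d / 2 ^ n" by (simp_all add: field_simps)
      have "\<bar>fn w x - fn w ?z\<bar> \<le> \<delta>" using i d by (auto simp: w_def)
      then have "t * \<bar>fn w x - fn w ?z\<bar> \<le> (2 * N d * 2 ^ n) * \<delta>" using t tw(1) \<delta> Nd by (intro mult_mono) auto
      also have "\<dots> = \<eta> / 8 * N d" by (simp add: \<delta>_def)
      finally have 1: "t * \<bar>fn w x - fn w ?z\<bar> \<le> \<eta> / 8 * N d" .
      have "fn d x - fn d ?z = t * (fn w x - fn w ?z) + (fn (d - t *\<^sub>R w) x - fn (d - t *\<^sub>R w) ?z)"
        by (simp add: algebra_simps)
      moreover have "\<bar>t * (fn w x - fn w ?z)\<bar> = t * \<bar>fn w x - fn w ?z\<bar>" using tw(1) by (simp add: abs_mult)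
      ultimately have "\<bar>fn d x - fn d ?z\<bar> \<le> \<eta> / 8 * N d + 2 * norm (d - t *\<^sub>R w)"
        using 1 abs_fn_le[of "d - t *\<^sub>R w" x] abs_fn_le[of "d - t *\<^sub>R w" ?z] by linarith
      also have "2 * norm (d - t *\<^sub>R w) \<le> 4 / 2 ^ n * N d" using r by simp
      also have "\<dots> \<le> \<eta> / 8 * N d" using n Nd by (rule mult_right_mono)
      finally show ?thesis by simp
    qed
    have "\<bar>fn v x - fn v ?z\<bar> \<le> \<eta> * N v" if v: "v \<in> S" for v
    proof (cases "v = 0")
      case False
      have vE: "v \<in> E" using v S by auto
      have Nv: "N v > 0" using N_nonneg[OF vE] N_eq_0[OF vE] False by (simp add: less_le)
      \<comment> \<open>Close enough for \<open>N d \<le> 2 * N v\<close> and for an error of at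
        most \<open>\<eta> / 8 * N v\<close> at each of the two points.\<close>
      define s where "s = min 1 (\<eta> / 8) * N v"
      have "s > 0" using Nv \<eta> by (simp add: s_def)
      then obtain d where d: "d \<in> D" "N (v - d) < s" using D(3)[OF v] by blast
      have dS: "d \<in> S" "d \<in> E" using d D S by auto
      have vd: "v - d \<in> E" using vE dS by (intro subspace_diff[OF subspace_E])
      have s1: "s \<le> N v" and s2: "s \<le> \<eta> / 8 * N v" unfolding s_def using Nv by (simp_all add: mult_right_mono)
      have "d - v \<in> E" "N (d - v) = N (v - d)"
        using subspace_neg[OF subspace_E vd] N_scale[OF vd, of "-1"] by simp_all
      then have "N d \<le> N v + N (v - d)" using N_triangle[OF vE, of "d - v"] by simp
      then have "N d \<le> 2 * N v" using d(2) s1 by simp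
      then have "\<eta> / 4 * N d \<le> \<eta> / 4 * (2 * N v)" using \<eta> by (intro mult_left_mono) auto
      then have "\<bar>fn d x - fn d ?z\<bar> \<le> \<eta> / 2 * N v" using onD[OF d(1)] by simp
      moreover have "norm (v - d) \<le> \<eta> / 8 * N v" using norm_le_N[OF vd] d(2) s2 by simp
      ultimately have "\<bar>fn v x - fn v ?z\<bar> \<le> \<eta> / 2 * N v + 2 * (\<eta> / 8 * N v)"
        using abs_fn_le[of "v - d" x, unfolded fn_simps] abs_fn_le[of "v - d" ?z, unfolded fn_simps] by linarith
      also have "\<dots> \<le> \<eta> * N v" using Nv \<eta> by (simp add: field_simps)
      finally show ?thesis .
    qed simp
    then show ?thesis by blast
  qed
  then show ?thesis using y(1) by blast
qed

text \<open>Centres for all scales \<open>1 / Suc k\<close> are collected in one set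
  \<open>Q\<close> before any functional is considered, so the same countable set serves every
  \<open>\<phi>\<close>. Half of \<open>r\<close> pays for the approximation by point masses, the
  other half for rational weights.\<close>

lemma separable_subspace_point_masses:
  assumes S: "subspace S" "S \<subseteq> E" and D: "countable D" "D \<subseteq> S" "\<And>v r. v \<in> S \<Longrightarrow> r > 0 \<Longrightarrow> \<exists>d\<in>D. N (v - d) < r"
  obtains Q where "countable Q" "Q \<subseteq> topspace X"
    "\<forall>\<phi> C r. (\<forall>u\<in>S. \<forall>v\<in>S. \<phi> (u + v) = \<phi> u + \<phi> v) \<and> (\<forall>c. \<forall>v\<in>S. \<phi> (c *\<^sub>R v) = c * \<phi> v) \<and>
       (\<forall>v\<in>S. \<bar>\<phi> v\<bar> \<le> C * N v) \<and> r > 0 \<longrightarrow>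
       (\<exists>F q. finite F \<and> F \<subseteq> Q \<and> q ` F \<subseteq> \<rat> \<and> (\<forall>v\<in>S. \<bar>\<phi> v - (\<Sum>x\<in>F. q x * fn v x)\<bar> \<le> r * N v))"
proof -
  have "\<exists>y :: nat \<Rightarrow> 'x. range y \<subseteq> topspace X \<and>
        (\<forall>x\<in>topspace X. \<exists>i. \<forall>v\<in>S. \<bar>fn v x - fn v (y i)\<bar> \<le> 1 / real (Suc k) * N v)" for k
    by (rule separable_cells[OF S D]) auto
  then obtain y :: "nat \<Rightarrow> nat \<Rightarrow> 'x" where y: "\<And>k. range (y k) \<subseteq> topspace X"
     "\<And>k. \<forall>x\<in>topspace X. \<exists>i. \<forall>v\<in>S. \<bar>fn v x - fn v (y k i)\<bar> \<le> 1 / real (Suc k) * N v" by metis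
  define Q where "Q = (\<Union>k. range (y k))"
  note SE = S
  interpret function_norm X S N
  proof
    show "continuous_map X euclideanreal (fn v)" if "v \<in> S" for v using that S E_cont by (auto simp: cont_funs_def)
    show "fn v x = 0" if "v \<in> S" "x \<notin> topspace X" for v x using that S E_cont by (auto simp: cont_funs_def)
    show "N (u + v) \<le> N u + N v" if "u \<in> S" "v \<in> S" for u v using that S(2) by (intro N_triangle) auto
    show "N (c *\<^sub>R v) = \<bar>c\<bar> * N v" if "v \<in> S" for c v using that S(2) by (intro N_scale) auto
    show "norm v \<le> N v" if "v \<in> S" for v using that S(2) by (intro norm_le_N) auto
  qed (rule compact S(1))+
  have cells: "\<exists>y :: nat \<Rightarrow> 'x. range y \<subseteq> Q \<and>
        (\<forall>x\<in>topspace X. \<exists>i. \<forall>v\<in>S. \<bar>fn v x - fn v (y i)\<bar> \<le> \<eta> * N v)" if \<eta>: "\<eta> > 0" for \<eta>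
  proof -
    obtain k where k: "1 / real (Suc k) < \<eta>" using nat_approx_posE[OF \<eta>] by blast
    have "\<exists>i. \<forall>v\<in>S. \<bar>fn v x - fn v (y k i)\<bar> \<le> \<eta> * N v" if x: "x \<in> topspace X" for x
    proof -
      obtain i where i: "\<forall>v\<in>S. \<bar>fn v x - fn v (y k i)\<bar> \<le> 1 / real (Suc k) * N v" using y(2) x by blast
      have "1 / real (Suc k) * N v \<le> \<eta> * N v" if "v \<in> S" for v
        using k N_nonneg that S by (intro mult_right_mono) auto
      then show ?thesis using i by (meson order_trans)
    qed
    then show ?thesis by (intro exI[of _ "y k"]) (auto simp: Q_def)
  qed
  show ?thesis
  proof (rule that[of Q])
    show "countable Q" unfolding Q_def by simp
    show "Q \<subseteq> topspace X" unfolding Q_def using y(1) by blast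
    show "\<forall>\<phi> C r. (\<forall>u\<in>S. \<forall>v\<in>S. \<phi> (u + v) = \<phi> u + \<phi> v) \<and> (\<forall>c. \<forall>v\<in>S. \<phi> (c *\<^sub>R v) = c * \<phi> v) \<and>
       (\<forall>v\<in>S. \<bar>\<phi> v\<bar> \<le> C * N v) \<and> r > 0 \<longrightarrow>
       (\<exists>F q. finite F \<and> F \<subseteq> Q \<and> q ` F \<subseteq> \<rat> \<and> (\<forall>v\<in>S. \<bar>\<phi> v - (\<Sum>x\<in>F. q x * fn v x)\<bar> \<le> r * N v))"
    proof (intro allI impI, elim conjE)
      fix \<phi> C and r :: real
      assume "\<forall>u\<in>S. \<forall>v\<in>S. \<phi> (u + v) = \<phi> u + \<phi> v" "\<forall>c. \<forall>v\<in>S. \<phi> (c *\<^sub>R v) = c * \<phi> v"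
        "\<forall>v\<in>S. \<bar>\<phi> v\<bar> \<le> C * N v" and r: "r > 0"
      then have \<phi>: "\<And>u v. u \<in> S \<Longrightarrow> v \<in> S \<Longrightarrow> \<phi> (u + v) = \<phi> u + \<phi> v"
         "\<And>c v. v \<in> S \<Longrightarrow> \<phi> (c *\<^sub>R v) = c * \<phi> v" "\<And>v. v \<in> S \<Longrightarrow> \<bar>\<phi> v\<bar> \<le> C * N v" by simp_all
      obtain F R where F: "finite F" "F \<subseteq> Q" "\<forall>v\<in>S. \<bar>\<phi> v\<bar> \<le> r / 2 * N v + R * (\<Sum>x\<in>F. \<bar>fn v x\<bar>)"
      proof (rule pointwise_control[OF \<phi> _ cells, of "r/2"])
        show "\<exists>R. \<forall>v\<in>S. \<bar>\<phi> v\<bar> \<le> \<eta> * N v + R * norm v" if "\<eta> > 0" for \<eta>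
          by (rule small_norm_part[OF SE \<phi> that])
      qed (use r in auto)
      obtain a where a: "\<forall>v\<in>S. \<bar>\<phi> v - (\<Sum>x\<in>F. a x * fn v x)\<bar> \<le> r / 2 * N v"
        by (rule point_mass_approximation[OF \<phi>(1,2) F(1) _ F(3)]) (use r in auto)
      \<comment> \<open>Moving each weight by at most \<open>s\<close> changes the sum by at most
        \<open>card F * s * N v\<close>, hence by at most \<open>r / 2 * N v\<close>.\<close>
      define s where "s = r / (2 * (real (card F) + 1))"
      have s: "s > 0" using r by (simp add: s_def)
      have "\<exists>q\<in>\<rat>. a x < q \<and> q < a x + s" for x using Rats_dense_in_real[of "a x" "a x + s"] s by auto
      then obtain q where q: "\<And>x. q x \<in> \<rat>" "\<And>x. a x < q x \<and> q x < a x + s" by metis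
      have "\<bar>\<phi> v - (\<Sum>x\<in>F. q x * fn v x)\<bar> \<le> r * N v" if v: "v \<in> S" for v
      proof -
        have Nv: "N v \<ge> 0" using N_nonneg v S by auto
        have "\<bar>(\<Sum>x\<in>F. a x * fn v x) - (\<Sum>x\<in>F. q x * fn v x)\<bar> = \<bar>\<Sum>x\<in>F. (a x - q x) * fn v x\<bar>"
          by (simp add: sum_subtractf left_diff_distrib)
        also have "\<dots> \<le> (\<Sum>x\<in>F. s * N v)"
        proof (rule order_trans[OF sum_abs sum_mono])
          fix x
          have "\<bar>fn v x\<bar> \<le> N v" using abs_fn_le[of v x] norm_le_N v S by fastforce
          moreover have "\<bar>a x - q x\<bar> \<le> s" using q(2)[of x] by linarith
          ultimately show "\<bar>(a x - q x) * fn v x\<bar> \<le> s * N v" unfolding abs_mult using s by (intro mult_mono) auto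
        qed
        also have "\<dots> = real (card F) * s * N v" by simp
        also have "\<dots> \<le> r / 2 * N v"
        proof (rule mult_right_mono[OF _ Nv])
          have "real (card F) * s \<le> (real (card F) + 1) * s" using s by simp
          also have "\<dots> = r / 2" by (simp add: s_def field_simps)
          finally show "real (card F) * s \<le> r / 2" .
        qed
        finally show ?thesis using bspec[OF a v] by linarith
      qed
      then show "\<exists>F q. finite F \<and> F \<subseteq> Q \<and> q ` F \<subseteq> \<rat> \<and> (\<forall>v\<in>S. \<bar>\<phi> v - (\<Sum>x\<in>F. q x * fn v x)\<bar> \<le> r * N v)"
        using F(1,2) q(1) by blast
    qed
  qed
qed

end

text \<open>A finite combination of point masses, coded by a list so that the rational ones over a
  countable set are countable.\<close>

definition list_eval :: "(real \<times> 'x) list \<Rightarrow> 'x bfun \<Rightarrow> real" where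
  "list_eval l v = (\<Sum>(q, x)\<leftarrow>l. q * fn v x)"

lemma list_eval_add: "list_eval l (u + v) = list_eval l u + list_eval l v"
  by (induction l) (auto simp: list_eval_def distrib_left)

lemma list_eval_scale: "list_eval l (c *\<^sub>R v) = c * list_eval l v"
  by (induction l) (auto simp: list_eval_def distrib_left)

lemma list_eval_bound: "\<bar>list_eval l v\<bar> \<le> (\<Sum>(q, x)\<leftarrow>l. \<bar>q\<bar>) * norm v"
proof (induction l)
  case (Cons a l)
  obtain q x where a: "a = (q, x)" by (cases a)
  have "\<bar>q * fn v x\<bar> \<le> \<bar>q\<bar> * norm v" unfolding abs_mult by (rule mult_left_mono[OF abs_fn_le]) simp
  moreover have "list_eval (a # l) v = q * fn v x + list_eval l v" by (simp add: a list_eval_def)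
  ultimately show ?case using Cons by (simp add: a distrib_right)
qed (simp add: list_eval_def)

locale represented_atoms = function_atoms W X for W :: "'x bfun set" and X +
  fixes \<iota> :: "('x \<Rightarrow> real) \<Rightarrow> 'u"
  assumes inj_\<iota>: "inj \<iota>"
begin

text \<open>The carrier of the representing space must lie in the universe, so \<open>E\<close> is
  copied there by sending the underlying function through \<open>\<iota>\<close>.\<close>

definition j :: "'x bfun \<Rightarrow> 'u" where "j v = \<iota> (fn v)"

lemma j_eq [simp]: "j u = j v \<longleftrightarrow> u = v"
  unfolding j_def using inj_\<iota> bfun_eqI by (metis injD)

lemma inj_j: "inj j" by (rule injI) simp

definition jinv :: "'u \<Rightarrow> 'x bfun" where "jinv = inv_into UNIV j"

lemma jinv_j [simp]: "jinv (j v) = v"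
  unfolding jinv_def using inj_j by (rule inv_f_f)

definition V :: "'u normed" where
  "V = \<lparr>carrier = j ` E, mult = undefined, one = undefined, zero = j 0,
        add = \<lambda>a b. j (jinv a + jinv b), smult = \<lambda>c a. j (c *\<^sub>R jinv a), nrm = \<lambda>a. N (jinv a)\<rparr>"

lemma V_simps [simp]:
  "carrier V = j ` E" "\<zero>\<^bsub>V\<^esub> = j 0" "j u \<oplus>\<^bsub>V\<^esub> j v = j (u + v)" "c \<odot>\<^bsub>V\<^esub> j v = j (c *\<^sub>R v)" "nrm V (j v) = N v"
  by (simp_all add: V_def)

lemmas E_closed [simp] = subspace_0[OF subspace_E] subspace_add[OF subspace_E] subspace_scale[OF subspace_E]
  subspace_neg[OF subspace_E] subspace_diff[OF subspace_E]

lemma normed_V: "normed_space V"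
  unfolding normed_space_def
proof (intro conjI ballI allI)
  show "Module.module real_ring V"
  proof (rule moduleI)
    show "cring real_ring" by (rule cring_real_ring)
    show "abelian_group V"
    proof (rule abelian_groupI)
      fix a assume "a \<in> carrier V"
      then obtain v where v: "v \<in> E" "a = j v" by auto
      have "j (- v) \<in> carrier V" using v(1) by simp
      moreover have "j (- v) \<oplus>\<^bsub>V\<^esub> a = \<zero>\<^bsub>V\<^esub>" by (simp add: v(2))
      ultimately show "\<exists>y\<in>carrier V. y \<oplus>\<^bsub>V\<^esub> a = \<zero>\<^bsub>V\<^esub>" by blast
    qed (auto simp: add_ac)
  qed (auto simp: scaleR_left_distrib scaleR_right_distrib)
  show "(nrm V a = 0) = (a = \<zero>\<^bsub>V\<^esub>)" if "a \<in> carrier V" for a using that by (auto simp: N_eq_0)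
  show "nrm V (c \<odot>\<^bsub>V\<^esub> a) = \<bar>c\<bar> * nrm V a" if "a \<in> carrier V" for c a using that by (auto simp: N_scale)
  show "nrm V (a \<oplus>\<^bsub>V\<^esub> b) \<le> nrm V a + nrm V b" if "a \<in> carrier V" "b \<in> carrier V" for a b
    using that by (auto simp: N_triangle)
qed

sublocale V: normed_carrier V by (rule normed_carrier.intro[OF normed_V])

lemma minus_V [simp]: "u \<in> E \<Longrightarrow> v \<in> E \<Longrightarrow> j u \<ominus>\<^bsub>V\<^esub> j v = j (u - v)"
  using V.neg_eq[of "j v"] by (simp add: a_minus_def)

lemma norm_dist_V: "u \<in> E \<Longrightarrow> v \<in> E \<Longrightarrow> norm_dist V (j u) (j v) = N (u - v)"
  by (simp add: norm_dist_def)

lemma banach_V: "banach_space V"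
  unfolding banach_space_def
proof (intro conjI normed_V)
  interpret M: Metric_space "carrier V" "norm_dist V" by (rule V.metric)
  show "M.mcomplete"
    unfolding M.mcomplete_def
  proof (intro allI impI)
    fix \<sigma> assume \<sigma>: "M.MCauchy \<sigma>"
    define s where "s k = jinv (\<sigma> k)" for k
    have s: "s k \<in> E" "\<sigma> k = j (s k)" for k
    proof -
      have "\<sigma> k \<in> j ` E" using \<sigma> unfolding M.MCauchy_def by auto
      then show "s k \<in> E" "\<sigma> k = j (s k)" by (auto simp: s_def)
    qed
    have Cau: "\<exists>M. \<forall>k\<ge>M. \<forall>l\<ge>M. N (s k - s l) < e" if e: "e > 0" for e
    proof -
      obtain M where "\<forall>n n'. M \<le> n \<longrightarrow> M \<le> n' \<longrightarrow> norm_dist V (\<sigma> n) (\<sigma> n') < e"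
        using \<sigma> e unfolding M.MCauchy_def by auto
      then show ?thesis using norm_dist_V[OF s(1) s(1)] s(2) by (intro exI[of _ M]) simp
    qed
    obtain v where v: "v \<in> E" "\<And>e. e > 0 \<Longrightarrow> \<exists>M. \<forall>k\<ge>M. N (s k - v) < e"
      using E_complete[OF s(1) Cau] by metis
    have "limitin M.mtopology \<sigma> (j v) sequentially"
      unfolding M.limit_metric_sequentially
    proof (intro conjI allI impI)
      show "j v \<in> carrier V" using v(1) by simp
      fix e :: real assume "e > 0"
      then obtain M where "\<forall>k\<ge>M. N (s k - v) < e" using v(2) by blast
      then show "\<exists>M. \<forall>n\<ge>M. \<sigma> n \<in> carrier V \<and> norm_dist V (\<sigma> n) (j v) < e"
        using s v(1) norm_dist_V[OF s(1) v(1)] by (intro exI[of _ M]) auto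
    qed
    then show "\<exists>x. limitin M.mtopology \<sigma> x sequentially" by blast
  qed
qed

text \<open>A separable submodule \<open>U\<close> is the copy of a subspace \<open>S\<close> with a
  countable set dense for \<open>N\<close>. Rational point masses at its countably many centres are
  dense in the dual, because an error of \<open>r * N v\<close> on all vectors is an error of
  \<open>r\<close> in dual norm.\<close>

lemma asplund_V: "asplund_space V"
  unfolding asplund_space_def
proof (intro conjI banach_V allI impI, elim conjE)
  fix U assume sub: "submodule U real_ring V"
    and sep: "separable_space (norm_topology (V\<lparr>carrier := U\<rparr>))"
  let ?V = "V\<lparr>carrier := U\<rparr>"
  interpret U: normed_carrier ?V by (rule V.normed_carrier_submodule[OF sub])
  have UE: "U \<subseteq> j ` E" using V.submoduleE(1)[OF sub] by simp
  define S where "S = {v \<in> E. j v \<in> U}"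
  have US: "a \<in> U \<longleftrightarrow> (\<exists>v\<in>S. a = j v)" for a using UE by (auto simp: S_def)
  have subS: "subspace S"
  proof (rule subspaceI)
    show "0 \<in> S" using V.submoduleE(2,4)[OF sub]
    proof -
      obtain a where a: "a \<in> U" using V.submoduleE(2)[OF sub] by auto
      then have "0 \<odot>\<^bsub>V\<^esub> a \<in> U" using V.submoduleE(4)[OF sub, of 0 a] by simp
      moreover obtain v where "a = j v" using a UE by auto
      ultimately show ?thesis by (simp add: S_def)
    qed
    show "u + v \<in> S" if "u \<in> S" "v \<in> S" for u v
      using that V.submoduleE(5)[OF sub, of "j u" "j v"] by (auto simp: S_def)
    show "c *\<^sub>R v \<in> S" if "v \<in> S" for c v
      using that V.submoduleE(4)[OF sub, of c "j v"] by (auto simp: S_def)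
  qed
  have SE: "S \<subseteq> E" by (auto simp: S_def)
  obtain C where C: "countable C" "C \<subseteq> carrier ?V" "\<forall>v\<in>carrier ?V. \<forall>r>0. \<exists>w\<in>C. nrm ?V (v \<ominus>\<^bsub>?V\<^esub> w) < r"
    using sep unfolding U.separable_iff by blast
  define D where "D = jinv ` C"
  have "jinv a \<in> S" if "a \<in> C" for a
  proof -
    have "a \<in> U" using C(2) that by auto
    then obtain v where "v \<in> S" "a = j v" using US by auto
    then show ?thesis by simp
  qed
  then have D: "countable D" "D \<subseteq> S" using C(1) by (auto simp: D_def)
  have dense: "\<exists>d\<in>D. N (v - d) < r" if v: "v \<in> S" and r: "r > 0" for v r
  proof -
    have "j v \<in> carrier ?V" using v by (simp add: S_def)
    then obtain w where w: "w \<in> C" "nrm ?V (j v \<ominus>\<^bsub>?V\<^esub> w) < r" using C(3) r by blast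
    then have wU: "w \<in> U" using C(2) by auto
    then obtain d where d: "d \<in> S" "w = j d" using US by auto
    have "j v \<ominus>\<^bsub>?V\<^esub> w = j (v - d)"
      using V.minus_submodule[OF sub _ wU, of "j v"] v d by (simp add: S_def)
    moreover have "d \<in> D" unfolding D_def by (rule image_eqI[OF _ w(1)]) (simp add: d(2))
    ultimately show ?thesis using w(2) d(2) by (intro bexI[of _ d]) simp_all
  qed
  obtain Q where Q: "countable Q" "Q \<subseteq> topspace X"
    "\<forall>\<phi> C r. (\<forall>u\<in>S. \<forall>v\<in>S. \<phi> (u + v) = \<phi> u + \<phi> v) \<and> (\<forall>c. \<forall>v\<in>S. \<phi> (c *\<^sub>R v) = c * \<phi> v) \<and>
       (\<forall>v\<in>S. \<bar>\<phi> v\<bar> \<le> C * N v) \<and> r > 0 \<longrightarrow>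
       (\<exists>F q. finite F \<and> F \<subseteq> Q \<and> q ` F \<subseteq> \<rat> \<and> (\<forall>v\<in>S. \<bar>\<phi> v - (\<Sum>x\<in>F. q x * fn v x)\<bar> \<le> r * N v))"
    by (rule separable_subspace_point_masses[OF subS SE D dense])
  define \<psi> where "\<psi> l = restrict (\<lambda>a. list_eval l (jinv a)) U" for l
  have \<psi>j: "\<psi> l (j v) = list_eval l v" if "v \<in> S" for l v using that by (simp add: \<psi>_def S_def)
  have \<psi>_dual: "\<psi> l \<in> dual ?V" for l
    unfolding dual_def
  proof (intro CollectI conjI ballI allI)
    show "\<psi> l \<in> extensional (carrier ?V)" by (simp add: \<psi>_def)
    fix a assume "a \<in> carrier ?V"
    then obtain u where u: "u \<in> S" "a = j u" using US by auto
    show "\<psi> l (c \<odot>\<^bsub>?V\<^esub> a) = c * \<psi> l a" for c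
      using \<psi>j[OF u(1)] \<psi>j[OF subspace_scale[OF subS u(1)]] by (simp add: u(2) list_eval_scale)
    fix b assume "b \<in> carrier ?V"
    then obtain v where v: "v \<in> S" "b = j v" using US by auto
    show "\<psi> l (a \<oplus>\<^bsub>?V\<^esub> b) = \<psi> l a + \<psi> l b"
      using \<psi>j[OF u(1)] \<psi>j[OF v(1)] \<psi>j[OF subspace_add[OF subS u(1) v(1)]] by (simp add: u(2) v(2) list_eval_add)
  next
    show "\<exists>K. \<forall>a\<in>carrier ?V. \<bar>\<psi> l a\<bar> \<le> K * nrm ?V a"
    proof (intro exI ballI)
      fix a assume "a \<in> carrier ?V"
      then obtain u where u: "u \<in> S" "a = j u" using US by auto
      have nn: "0 \<le> (\<Sum>(q, x)\<leftarrow>l. \<bar>q\<bar>)" by (rule sum_list_nonneg) auto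
      have "\<bar>list_eval l u\<bar> \<le> (\<Sum>(q, x)\<leftarrow>l. \<bar>q\<bar>) * norm u" by (rule list_eval_bound)
      also have "\<dots> \<le> (\<Sum>(q, x)\<leftarrow>l. \<bar>q\<bar>) * N u" using u(1) SE by (intro mult_left_mono[OF norm_le_N nn]) auto
      finally show "\<bar>\<psi> l a\<bar> \<le> (\<Sum>(q, x)\<leftarrow>l. \<bar>q\<bar>) * nrm ?V a" using \<psi>j[OF u(1)] by (simp add: u(2))
    qed
  qed
  show "separable_space (dual_norm_topology ?V)"
    unfolding U.dual_separable_iff
  proof (intro exI[of _ "\<psi> ` lists (\<rat> \<times> Q)"] conjI ballI allI impI)
    show "countable (\<psi> ` lists (\<rat> \<times> Q))" using Q(1) countable_rat by auto
    show "\<psi> ` lists (\<rat> \<times> Q) \<subseteq> dual ?V" using \<psi>_dual by auto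
    fix \<phi> and r :: real assume \<phi>: "\<phi> \<in> dual ?V" and r: "r > 0"
    obtain B where B: "\<forall>a\<in>carrier ?V. \<bar>\<phi> a\<bar> \<le> B * nrm ?V a" using U.dual_bounded[OF \<phi>] by blast
    have jU: "j v \<in> carrier ?V" if "v \<in> S" for v using that by (simp add: S_def)
    have "\<exists>F q. finite F \<and> F \<subseteq> Q \<and> q ` F \<subseteq> \<rat> \<and> (\<forall>v\<in>S. \<bar>\<phi> (j v) - (\<Sum>x\<in>F. q x * fn v x)\<bar> \<le> r / 2 * N v)"
    proof (rule Q(3)[rule_format], intro conjI ballI allI)
      fix v assume v: "v \<in> S"
      show "\<phi> (j (u + v)) = \<phi> (j u) + \<phi> (j v)" if "u \<in> S" for u
        using U.dual_add[OF \<phi> jU[OF that] jU[OF v]] by simp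
      show "\<phi> (j (c *\<^sub>R v)) = c * \<phi> (j v)" for c
        using U.dual_smult[OF \<phi> jU[OF v], of c] by simp
      show "\<bar>\<phi> (j v)\<bar> \<le> B * N v" using bspec[OF B jU[OF v]] by simp
    qed (use r in simp)
    then obtain F q where F: "finite F" "F \<subseteq> Q" "q ` F \<subseteq> \<rat>"
      "\<forall>v\<in>S. \<bar>\<phi> (j v) - (\<Sum>x\<in>F. q x * fn v x)\<bar> \<le> r / 2 * N v" by (elim exE conjE)
    obtain xs where xs: "set xs = F" "distinct xs" using finite_distinct_list[OF F(1)] by blast
    define l where "l = map (\<lambda>x. (q x, x)) xs"
    have l: "l \<in> lists (\<rat> \<times> Q)" using F(2,3) xs(1) by (auto simp: l_def image_subset_iff)
    have evl: "list_eval l v = (\<Sum>x\<in>F. q x * fn v x)" for v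
      unfolding list_eval_def l_def using sum_list_distinct_conv_sum_set[OF xs(2), of "\<lambda>x. q x * fn v x"] xs(1)
      by (simp add: o_def)
    have "dual_dist ?V \<phi> (\<psi> l) \<le> r / 2"
    proof (rule U.dual_dist_le[OF \<phi> \<psi>_dual])
      show "0 \<le> r / 2" using r by simp
      fix a assume "a \<in> carrier ?V"
      then obtain u where u: "u \<in> S" "a = j u" using US by auto
      show "\<bar>\<phi> a - \<psi> l a\<bar> \<le> r / 2 * nrm ?V a"
        using bspec[OF F(4) u(1)] \<psi>j[OF u(1)] by (simp add: u(2) evl)
    qed
    then have "dual_dist ?V \<phi> (\<psi> l) < r" using r by simp
    then show "\<exists>\<psi>'\<in>\<psi> ` lists (\<rat> \<times> Q). dual_dist ?V \<phi> \<psi>' < r"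
      using imageI[OF l, of \<psi>] by (intro bexI[of _ "\<psi> l"])
  qed
qed

section \<open>Points of the space as functionals\<close>

definition point_eval :: "'x \<Rightarrow> 'u \<Rightarrow> real" where "point_eval x = restrict (\<lambda>a. fn (jinv a) x) (j ` E)"

lemma point_eval_j [simp]: "v \<in> E \<Longrightarrow> point_eval x (j v) = fn v x"
  by (simp add: point_eval_def)

lemma point_eval_dual: "point_eval x \<in> dual V"
  unfolding dual_def
proof (intro CollectI conjI)
  show "\<exists>K. \<forall>a\<in>carrier V. \<bar>point_eval x a\<bar> \<le> K * nrm V a"
  proof (intro exI[of _ 1] ballI)
    fix a assume "a \<in> carrier V"
    then obtain v where v: "v \<in> E" "a = j v" by auto
    show "\<bar>point_eval x a\<bar> \<le> 1 * nrm V a" using abs_fn_le[of v x] norm_le_N[OF v(1)] v by simp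
  qed
qed (auto simp: point_eval_def)

lemma point_eval_norm: "dual_norm V (point_eval x) \<le> 1"
  unfolding dual_norm_def
proof (rule cSUP_least)
  have "j 0 \<in> {v \<in> carrier V. nrm V v \<le> 1}" by simp
  then show "{v \<in> carrier V. nrm V v \<le> 1} \<noteq> {}" by blast
  fix a assume "a \<in> {v \<in> carrier V. nrm V v \<le> 1}"
  then obtain v where v: "v \<in> E" "a = j v" "N v \<le> 1" by auto
  then show "\<bar>point_eval x a\<bar> \<le> 1" using abs_fn_le[of v x] norm_le_N[OF v(1)] by simp
qed

lemma point_eval_eq_iff: "point_eval x = point_eval y \<longleftrightarrow> (\<forall>v\<in>E. fn v x = fn v y)"
proof
  assume "point_eval x = point_eval y"
  then show "\<forall>v\<in>E. fn v x = fn v y" by (metis point_eval_j)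
next
  assume "\<forall>v\<in>E. fn v x = fn v y"
  then show "point_eval x = point_eval y" unfolding point_eval_def by (intro restrict_ext) auto
qed

lemma continuous_point_eval: "continuous_map X (weak_star_topology V) point_eval"
  unfolding weak_star_topology_def continuous_map_in_subtopology
proof (intro conjI)
  show "continuous_map X (product_topology (\<lambda>_. euclideanreal) (carrier V)) point_eval"
    unfolding continuous_map_componentwise
  proof (intro conjI ballI)
    show "point_eval ` topspace X \<subseteq> extensional (carrier V)" using point_eval_dual by (auto simp: dual_def)
    fix a assume "a \<in> carrier V"
    then obtain v where v: "v \<in> E" "a = j v" by auto
    have "continuous_map X euclideanreal (fn v)" using v(1) E_cont by (auto simp: cont_funs_def)
    then show "continuous_map X euclideanreal (\<lambda>x. point_eval x a)" using v by simp
  qed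
  show "point_eval \<in> topspace X \<rightarrow> dual V" using point_eval_dual by auto
qed

end

section \<open>Translates of a continuous function\<close>

context compact_system
begin

text \<open>Values off \<open>X\<close> are kept, so that translation is an invertible isometry of
  all bounded functions and not only of those supported in \<open>X\<close>.\<close>

definition translate :: "'g \<Rightarrow> 'x bfun \<Rightarrow> 'x bfun" where
  "translate g v = bf (\<lambda>x. if x \<in> topspace X then fn v (act g x) else fn v x)"

lemma fn_translate: "fn (translate g v) x = (if x \<in> topspace X then fn v (act g x) else fn v x)"
  unfolding translate_def by (rule fn_bf[where b = "norm v"]) (simp add: abs_fn_le)

lemma linear_translate: "linear (translate g)"
  by (rule linearI; rule bfun_eqI) (simp_all add: fn_translate)

text \<open>Composition on the inside reverses the order; this is the source of the
  co-homomorphism.\<close>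

lemma translate_mult: "g \<in> carrier G \<Longrightarrow> h \<in> carrier G \<Longrightarrow> translate (g \<otimes>\<^bsub>G\<^esub> h) v = translate h (translate g v)"
  by (rule bfun_eqI) (simp add: fn_translate act_mult)

lemma translate_inv [simp]: "g \<in> carrier G \<Longrightarrow> translate (inv\<^bsub>G\<^esub> g) (translate g v) = v"
  by (rule bfun_eqI) (simp add: fn_translate)

lemma translate_inv' [simp]: "g \<in> carrier G \<Longrightarrow> translate g (translate (inv\<^bsub>G\<^esub> g) v) = v"
  by (rule bfun_eqI) (simp add: fn_translate)

lemma norm_translate: assumes g: "g \<in> carrier G" shows "norm (translate g v) = norm v"
proof -
  have le: "norm (translate h w) \<le> norm w" for h w
    by (rule norm_bfun_le) (simp add: fn_translate abs_fn_le)
  show ?thesis using le[of g v] le[of "inv\<^bsub>G\<^esub> g" "translate g v"] g by simp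
qed

lemma translate_cont:
  assumes "g \<in> carrier G" "v \<in> cont_funs X" shows "translate g v \<in> cont_funs X"
proof -
  have "continuous_map X euclideanreal (\<lambda>x. fn v (act g x))"
    using assms by (intro continuous_act_compose) (auto simp: cont_funs_def)
  then have "continuous_map X euclideanreal (fn (translate g v))"
    by (rule continuous_map_eq) (simp add: fn_translate)
  then show ?thesis using assms by (simp add: cont_funs_def fn_translate)
qed

text \<open>Acting by \<open>g\<close> is acting by \<open>g0\<close> followed by \<open>g\<close>
  times the inverse of \<open>g0\<close>, and an element near the identity moves all points
  uniformly little.\<close>

lemma translate_norm_continuous:
  assumes v: "v \<in> cont_funs X" and g0: "g0 \<in> carrier G" and e: "e > 0"
  obtains U where "openin T U" "g0 \<in> U" "\<forall>g\<in>U. norm (translate g v - translate g0 v) \<le> e"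
proof -
  define Ent where "Ent = {(x, y) \<in> topspace X \<times> topspace X. \<bar>fn v x - fn v y\<bar> < e}"
  have "Ent \<in> \<mu>"
    unfolding Ent_def using v by (intro uniform_continuity_compact[OF compact compat _ e]) (simp add: cont_funs_def)
  then obtain U1 where U1: "openin T U1" "\<one>\<^bsub>G\<^esub> \<in> U1"
    "\<And>u x. u \<in> U1 \<Longrightarrow> x \<in> topspace X \<Longrightarrow> (act u x, x) \<in> Ent"
    using uniform_nbhd_one by blast
  define U where "U = {g \<in> topspace T. g \<otimes>\<^bsub>G\<^esub> inv\<^bsub>G\<^esub> g0 \<in> U1}"
  have "continuous_map T (prod_topology T T) (\<lambda>g. (g, inv\<^bsub>G\<^esub> g0))"
    using g0 by (auto intro: continuous_map_pairedI)
  moreover have "continuous_map (prod_topology T T) T (\<lambda>(g, h). g \<otimes>\<^bsub>G\<^esub> h)"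
    using top_group by (simp add: topological_group_def)
  ultimately have "continuous_map T T ((\<lambda>(g, h). g \<otimes>\<^bsub>G\<^esub> h) \<circ> (\<lambda>g. (g, inv\<^bsub>G\<^esub> g0)))" by (rule continuous_map_compose)
  then have "continuous_map T T (\<lambda>g. g \<otimes>\<^bsub>G\<^esub> inv\<^bsub>G\<^esub> g0)" by (simp add: o_def)
  then have "openin T U" unfolding U_def using U1(1) by (rule openin_continuous_map_preimage)
  moreover have "g0 \<in> U" using g0 U1(2) by (simp add: U_def group.r_inv[OF group])
  moreover have "norm (translate g v - translate g0 v) \<le> e" if g: "g \<in> U" for g
  proof (rule norm_bfun_le)
    fix x
    show "\<bar>fn (translate g v - translate g0 v) x\<bar> \<le> e"
    proof (cases "x \<in> topspace X")
      case True
      have gG: "g \<in> carrier G" "g \<otimes>\<^bsub>G\<^esub> inv\<^bsub>G\<^esub> g0 \<in> U1" using g by (auto simp: U_def)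
      have "act (g \<otimes>\<^bsub>G\<^esub> inv\<^bsub>G\<^esub> g0) (act g0 x) = act g x" using gG g0 True by (simp add: act_mult)
      then have "\<bar>fn v (act g x) - fn v (act g0 x)\<bar> < e"
        using U1(3)[OF gG(2), of "act g0 x"] g0 True by (simp add: Ent_def)
      then show ?thesis using True by (simp add: fn_translate)
    qed (use e in \<open>simp add: fn_translate\<close>)
  qed
  ultimately show ?thesis using that by blast
qed

definition translates :: "'x bfun \<Rightarrow> 'x bfun set" where "translates f0 = (\<lambda>g. translate g f0) ` carrier G"

definition hull_translates :: "'x bfun \<Rightarrow> 'x bfun set" where
  "hull_translates f0 = convex hull (translates f0 \<union> uminus ` translates f0)"

lemma translate_hull_translates: assumes g: "g \<in> carrier G" shows "translate g ` hull_translates f0 = hull_translates f0"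
proof -
  have orb: "translate g ` translates f0 = translates f0"
  proof
    have "translate g (translate h f0) \<in> translates f0" if "h \<in> carrier G" for h
      using translate_mult[OF that g, of f0] g that unfolding translates_def by (metis G_closed(2) imageI)
    then show "translate g ` translates f0 \<subseteq> translates f0" by (auto simp: translates_def)
    have "translate h f0 \<in> translate g ` translates f0" if h: "h \<in> carrier G" for h
    proof (rule image_eqI)
      show "translate h f0 = translate g (translate (h \<otimes>\<^bsub>G\<^esub> inv\<^bsub>G\<^esub> g) f0)" using h g by (simp add: translate_mult)
      show "translate (h \<otimes>\<^bsub>G\<^esub> inv\<^bsub>G\<^esub> g) f0 \<in> translates f0" using h g by (simp add: translates_def)
    qed
    then show "translates f0 \<subseteq> translate g ` translates f0" by (auto simp: translates_def)
  qed
  have "translate g ` (translates f0 \<union> uminus ` translates f0) = translate g ` translates f0 \<union> uminus ` (translate g ` translates f0)"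
    by (simp add: image_Un image_image linear_neg[OF linear_translate])
  then show ?thesis unfolding hull_translates_def convex_hull_linear_image[OF linear_translate] orb by simp
qed

text \<open>A convex combination oscillates no more than its terms, and only finitely many
  translates occur in it. The finite set depends on \<open>w\<close> alone, so it works for all
  points and all \<open>\<delta>\<close>.\<close>

lemma hull_translates_oscillation:
  assumes "w \<in> hull_translates f0"
  obtains \<Gamma> where "finite \<Gamma>" "\<Gamma> \<subseteq> carrier G"
    "\<forall>x\<in>topspace X. \<forall>y\<in>topspace X. \<forall>\<delta>. (\<forall>g\<in>\<Gamma>. \<bar>fn f0 (act g x) - fn f0 (act g y)\<bar> \<le> \<delta>) \<longrightarrow> \<bar>fn w x - fn w y\<bar> \<le> \<delta>"
proof -
  obtain S c where S: "finite S" "S \<subseteq> translates f0 \<union> uminus ` translates f0" "\<forall>v\<in>S. 0 \<le> c v" "sum c S = (1::real)"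
      "(\<Sum>v\<in>S. c v *\<^sub>R v) = w"
    using assms unfolding hull_translates_def convex_hull_explicit by blast
  have "\<exists>g\<in>carrier G. v = translate g f0 \<or> v = - translate g f0" if "v \<in> S" for v using S(2) that by (auto simp: translates_def)
  then obtain \<gamma> where \<gamma>: "\<And>v. v \<in> S \<Longrightarrow> \<gamma> v \<in> carrier G \<and> (v = translate (\<gamma> v) f0 \<or> v = - translate (\<gamma> v) f0)" by metis
  show ?thesis
  proof (rule that[of "\<gamma> ` S"])
    show "finite (\<gamma> ` S)" "\<gamma> ` S \<subseteq> carrier G" using S(1) \<gamma> by auto
    show "\<forall>x\<in>topspace X. \<forall>y\<in>topspace X. \<forall>\<delta>. (\<forall>g\<in>\<gamma> ` S. \<bar>fn f0 (act g x) - fn f0 (act g y)\<bar> \<le> \<delta>) \<longrightarrow> \<bar>fn w x - fn w y\<bar> \<le> \<delta>"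
    proof (intro ballI allI impI)
      fix x y \<delta> assume xy: "x \<in> topspace X" "y \<in> topspace X"
        and le: "\<forall>g\<in>\<gamma> ` S. \<bar>fn f0 (act g x) - fn f0 (act g y)\<bar> \<le> \<delta>"
      have each: "\<bar>fn v x - fn v y\<bar> \<le> \<delta>" if v: "v \<in> S" for v
      proof -
        have b: "\<bar>fn f0 (act (\<gamma> v) x) - fn f0 (act (\<gamma> v) y)\<bar> \<le> \<delta>" using le v by simp
        have "v = translate (\<gamma> v) f0 \<or> v = - translate (\<gamma> v) f0" using \<gamma>[OF v] by simp
        moreover have "\<bar>fn (translate (\<gamma> v) f0) x - fn (translate (\<gamma> v) f0) y\<bar> \<le> \<delta>"
          using b xy by (simp add: fn_translate)
        moreover have "\<bar>fn (- translate (\<gamma> v) f0) x - fn (- translate (\<gamma> v) f0) y\<bar> \<le> \<delta>"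
          using b xy by (simp add: fn_translate abs_minus_commute)
        ultimately show ?thesis by metis
      qed
      have "fn w x - fn w y = (\<Sum>v\<in>S. c v * (fn v x - fn v y))"
        unfolding S(5)[symmetric] by (simp add: fn_sum sum_subtractf right_diff_distrib)
      also have "\<bar>\<dots>\<bar> \<le> (\<Sum>v\<in>S. c v * \<delta>)"
        using S(3) each by (intro order_trans[OF sum_abs sum_mono]) (simp add: abs_mult mult_left_mono)
      also have "\<dots> = \<delta>" using S(4) by (simp add: sum_distrib_right[symmetric])
      finally show "\<bar>fn w x - fn w y\<bar> \<le> \<delta>" .
    qed
  qed
qed

text \<open>Countably many vectors of the hull involve countably many group elements. The group
  \<open>H\<close> generated by these is countable, and the Lindelof property for \<open>H\<close>
  and the entourage on which \<open>f0\<close> varies by less than \<open>\<delta>\<close> supplies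
  the centres.\<close>

lemma function_atoms_hull_translates:
  assumes L: Lindelof_countable and f0: "f0 \<in> cont_funs X" "norm f0 \<le> 1" and X_ne: "topspace X \<noteq> {}"
  shows "function_atoms (hull_translates f0) X"
proof
  have translates: "v \<in> cont_funs X \<and> norm v \<le> 1" if v: "v \<in> translates f0 \<union> uminus ` translates f0" for v
  proof -
    obtain g where g: "g \<in> carrier G" "v = translate g f0 \<or> v = - translate g f0" using v by (auto simp: translates_def)
    then show ?thesis
      using f0 translate_cont[OF g(1) f0(1)] norm_translate[OF g(1), of f0] subspace_neg[OF subspace_cont_funs translate_cont[OF g(1) f0(1)]]
      by auto
  qed
  have sub: "hull_translates f0 \<subseteq> cont_funs X \<inter> cball 0 1" unfolding hull_translates_def
    by (rule hull_minimal) (use translates in \<open>auto intro: convex_Int subspace_imp_convex subspace_cont_funs\<close>)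
  show "hull_translates f0 \<subseteq> cont_funs X" using sub by simp
  show "norm w \<le> 1" if "w \<in> hull_translates f0" for w using sub that by auto
  have "translate \<one>\<^bsub>G\<^esub> f0 \<in> translates f0" unfolding translates_def by (rule imageI) simp
  then show "hull_translates f0 \<noteq> {}" unfolding hull_translates_def using hull_subset by fastforce
  show "convex (hull_translates f0)" by (simp add: hull_translates_def)
  have "uminus ` hull_translates f0 = convex hull (uminus ` (translates f0 \<union> uminus ` translates f0))"
    unfolding hull_translates_def by (rule convex_hull_linear_image) (rule linearI; simp)
  also have "uminus ` (translates f0 \<union> uminus ` translates f0) = translates f0 \<union> uminus ` translates f0"
    by (auto simp: image_Un image_image)
  finally have "uminus ` hull_translates f0 = hull_translates f0" by (simp add: hull_translates_def)
  then show "- w \<in> hull_translates f0" if "w \<in> hull_translates f0" for w using that by blast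
  show "compact_space X" by (rule compact)
  fix W0 :: "'x bfun set" and \<delta> :: real assume W0: "countable W0" "W0 \<subseteq> hull_translates f0" and \<delta>: "\<delta> > 0"
  define P where "P w \<Gamma> \<longleftrightarrow> finite \<Gamma> \<and> \<Gamma> \<subseteq> carrier G \<and>
    (\<forall>x\<in>topspace X. \<forall>y\<in>topspace X. \<forall>\<delta>. (\<forall>g\<in>\<Gamma>. \<bar>fn f0 (act g x) - fn f0 (act g y)\<bar> \<le> \<delta>) \<longrightarrow> \<bar>fn w x - fn w y\<bar> \<le> \<delta>)" for w \<Gamma>
  have "\<exists>\<Gamma>. P w \<Gamma>" if w: "w \<in> W0" for w
  proof -
    have "w \<in> hull_translates f0" using w W0(2) by auto
    then obtain \<Gamma> where "finite \<Gamma>" "\<Gamma> \<subseteq> carrier G"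
    "\<forall>x\<in>topspace X. \<forall>y\<in>topspace X. \<forall>\<delta>. (\<forall>g\<in>\<Gamma>. \<bar>fn f0 (act g x) - fn f0 (act g y)\<bar> \<le> \<delta>) \<longrightarrow> \<bar>fn w x - fn w y\<bar> \<le> \<delta>"
      by (rule hull_translates_oscillation)
    then have "P w \<Gamma>" by (simp add: P_def)
    then show ?thesis by blast
  qed
  then obtain \<Gamma> where \<Gamma>: "\<And>w. w \<in> W0 \<Longrightarrow> P w (\<Gamma> w)" by metis
  define A where "A = (\<Union>w\<in>W0. \<Gamma> w)"
  have \<Gamma>fin: "finite (\<Gamma> w)" "\<Gamma> w \<subseteq> carrier G" if "w \<in> W0" for w using \<Gamma>[OF that] by (simp_all add: P_def)
  have A: "countable A" "A \<subseteq> carrier G"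
    unfolding A_def using \<Gamma>fin by (auto intro: countable_UN[OF W0(1)] countable_finite)
  define H where "H = generate G A"
  have H: "subgroup H G" "countable H" unfolding H_def
    using group.generate_is_subgroup[OF group A(2)] group.countable_generate[OF group A] by auto
  define e where "e = {(x, y) \<in> topspace X \<times> topspace X. \<bar>fn f0 x - fn f0 y\<bar> < \<delta>}"
  have e: "e \<in> \<mu>" unfolding e_def
    using f0(1) by (intro uniform_continuity_compact[OF compact compat _ \<delta>]) (simp add: cont_funs_def)
  have "\<exists>C. countable C \<and> C \<subseteq> topspace X \<and> topspace X \<subseteq> (\<Union>y\<in>C. H_small H e `` {y})"
    using L H e unfolding Lindelof_countable_def uniformly_Lindelof_subgroup_iff by simp
  then obtain C where C: "countable C" "C \<subseteq> topspace X" "topspace X \<subseteq> (\<Union>y\<in>C. H_small H e `` {y})"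
    by (elim exE conjE)
  \<comment> \<open>The centres are to be enumerated by natural numbers, which takes a nonempty
    set.\<close>
  have "C \<noteq> {}" using C(3) X_ne by auto
  define y where "y = from_nat_into C"
  have yC: "range y = C" unfolding y_def by (rule range_from_nat_into[OF \<open>C \<noteq> {}\<close> C(1)])
  have "\<exists>i. \<forall>w\<in>W0. \<bar>fn w x - fn w (y i)\<bar> \<le> \<delta>" if x: "x \<in> topspace X" for x
  proof -
    obtain c where c: "c \<in> C" "(c, x) \<in> H_small H e" using C(3) x by auto
    obtain i where i: "y i = c" using c(1) yC by auto
    have "\<bar>fn w x - fn w c\<bar> \<le> \<delta>" if w: "w \<in> W0" for w
    proof -
      have "\<bar>fn f0 (act g x) - fn f0 (act g c)\<bar> \<le> \<delta>" if g: "g \<in> \<Gamma> w" for g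
      proof -
        have "g \<in> H" unfolding H_def A_def using g w by (intro generate.incl) auto
        then have "(act g c, act g x) \<in> e" using c(2) by (auto simp: H_small_def)
        then show ?thesis by (simp add: e_def abs_minus_commute)
      qed
      moreover have "c \<in> topspace X" using c(1) C(2) by auto
      ultimately show ?thesis using \<Gamma>[OF w] x unfolding P_def by simp
    qed
    then show ?thesis using i by auto
  qed
  then show "\<exists>y :: nat \<Rightarrow> 'x. range y \<subseteq> topspace X \<and>
        (\<forall>x\<in>topspace X. \<exists>i. \<forall>w\<in>W0. \<bar>fn w x - fn w (y i)\<bar> \<le> \<delta>)"
    using yC C(2) by (intro exI[of _ y] conjI) auto
qed

end

section \<open>Pulled back topologies, and actions given by bijections\<close>

lemma embedding_map_pullback:
  assumes "inj_on f A" "f ` A \<subseteq> topspace Y"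
  shows "embedding_map (pullback_topology A f Y) Y f"
proof -
  let ?P = "pullback_topology A f Y"
  have top: "topspace ?P = A" using assms(2) by (auto simp: topspace_pullback_topology)
  have cont: "continuous_map ?P Y f"
    using continuous_map_pullback[of Y Y id A f] by simp
  show ?thesis
    unfolding embedding_map_def
  proof (rule bijective_open_imp_homeomorphic_map)
    show "continuous_map ?P (subtopology Y (f ` topspace ?P)) f"
      using cont by (simp add: continuous_map_in_subtopology)
    show "open_map ?P (subtopology Y (f ` topspace ?P)) f"
      unfolding open_map_def
    proof (intro allI impI)
      fix U assume "openin ?P U"
      then obtain O' where O: "openin Y O'" "U = f -` O' \<inter> A" unfolding openin_pullback_topology by blast
      then have "f ` U = O' \<inter> f ` topspace ?P" unfolding top by auto
      then show "openin (subtopology Y (f ` topspace ?P)) (f ` U)"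
        using O(1) by (auto simp: openin_subtopology)
    qed
    show "f ` topspace ?P = topspace (subtopology Y (f ` topspace ?P))" using assms(2) unfolding top by auto
    show "inj_on f (topspace ?P)" using assms(1) by (simp add: top)
  qed
qed

lemma group_actionI:
  assumes G: "group G" and bij: "\<And>g. g \<in> carrier G \<Longrightarrow> a g \<in> extensional Z \<and> bij_betw (a g) Z Z"
    and mult: "\<And>g h z. g \<in> carrier G \<Longrightarrow> h \<in> carrier G \<Longrightarrow> z \<in> Z \<Longrightarrow> a (g \<otimes>\<^bsub>G\<^esub> h) z = a g (a h z)"
  shows "group_action G Z a"
proof (rule group_action.intro, rule group_hom.intro[OF G group_BijGroup], rule group_hom_axioms.intro, rule homI)
  have Bij: "a g \<in> Bij Z" if "g \<in> carrier G" for g using bij[OF that] by (simp add: Bij_def)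
  then show "a g \<in> carrier (BijGroup Z)" if "g \<in> carrier G" for g using that by (simp add: BijGroup_def)
  fix g h assume gh: "g \<in> carrier G" "h \<in> carrier G"
  then have ghG: "g \<otimes>\<^bsub>G\<^esub> h \<in> carrier G" using G by (simp add: group.is_monoid monoid.m_closed)
  have "a (g \<otimes>\<^bsub>G\<^esub> h) = compose Z (a g) (a h)"
    by (rule extensionalityI[of _ Z]) (use bij[OF ghG] mult gh in \<open>auto simp: compose_def\<close>)
  then show "a (g \<otimes>\<^bsub>G\<^esub> h) = a g \<otimes>\<^bsub>BijGroup Z\<^esub> a h" using Bij gh by (simp add: BijGroup_def)
qed

section \<open>Radon-Nikodym factors\<close>

context compact_system
begin

text \<open>The factor \<open>Z\<close> of \<open>X\<close> identifies points that agree on all of \<open>E\<close>; its points are named by the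
  indicator functions of their fibres, so that they live in the universe \<open>'u\<close>.\<close>

lemma RN_factor:
  fixes \<iota> :: "('x \<Rightarrow> real) \<Rightarrow> 'u"
  assumes L: Lindelof_countable and f0: "f0 \<in> cont_funs X" "norm f0 \<le> 1" and X_ne: "topspace X \<noteq> {}"
    and \<iota>: "inj \<iota>"
  obtains Z :: "'u topology" and actZ q where "RN TYPE('u) G T Z actZ" "continuous_map X Z q"
    "\<forall>g\<in>carrier G. \<forall>x\<in>topspace X. q (act g x) = actZ g (q x)"
    "\<forall>x\<in>topspace X. \<forall>y\<in>topspace X. q x = q y \<longrightarrow> fn f0 x = fn f0 y"
proof -
  interpret function_atoms "hull_translates f0" X by (rule function_atoms_hull_translates[OF L f0 X_ne])
  interpret represented_atoms "hull_translates f0" X \<iota> by unfold_locales (rule \<iota>)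
  have K_translate: "K n (translate g v) = K n v" if "g \<in> carrier G" for n g v
    by (rule K_isometry[OF linear_translate norm_translate[OF that] translate_hull_translates[OF that]])
  have trE [simp]: "translate g v \<in> E" if "g \<in> carrier G" "v \<in> E" for g v
    using that by (simp add: E_def K_translate)
  have N_translate: "N (translate g v) = N v" if "g \<in> carrier G" for g v
    using that by (simp add: N_def K_translate)
  define h where "h g a = j (translate g (jinv a))" for g a
  have hj [simp]: "h g (j v) = j (translate g v)" for g v by (simp add: h_def)
  have cohom: "cont_cohom G T V h"
    unfolding cont_cohom_def
  proof (intro conjI ballI)
    fix g assume g: "g \<in> carrier G"
    show "h g \<in> linear_isometries V"
      unfolding linear_isometries_def
    proof (intro CollectI conjI ballI allI)
      show "bij_betw (h g) (carrier V) (carrier V)"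
      proof (rule bij_betw_byWitness[where f' = "h (inv\<^bsub>G\<^esub> g)"])
        show "\<forall>a\<in>carrier V. h (inv\<^bsub>G\<^esub> g) (h g a) = a" "\<forall>a\<in>carrier V. h g (h (inv\<^bsub>G\<^esub> g) a) = a"
          "h g ` carrier V \<subseteq> carrier V" "h (inv\<^bsub>G\<^esub> g) ` carrier V \<subseteq> carrier V"
          using g by auto
      qed
    qed (use g in \<open>auto simp: linear_add[OF linear_translate] linear_scale[OF linear_translate] N_translate\<close>)
  next
    fix g g' a assume "g \<in> carrier G" "g' \<in> carrier G" "a \<in> carrier V"
    then show "h (g \<otimes>\<^bsub>G\<^esub> g') a = h g' (h g a)" by (auto simp: translate_mult)
  next
    fix a assume "a \<in> carrier V"
    then obtain v where v: "v \<in> E" "a = j v" by auto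
    interpret M: Metric_space "carrier V" "norm_dist V" by (rule V.metric)
    show "continuous_map T (norm_topology V) (\<lambda>g. h g a)"
      unfolding norm_topology_def M.continuous_map_to_metric
    proof (intro ballI allI impI)
      fix g0 and e :: real assume g0: "g0 \<in> topspace T" and e: "e > 0"
      then have g0G: "g0 \<in> carrier G" by simp
      \<comment> \<open>From \<open>n0\<close> on the levels of \<open>v\<close>, and hence of all
        translates, are small, as \<open>K n\<close> is translation invariant. The finitely many
        earlier levels are controlled by the sup norm, in which translation is continuous.\<close>
      obtain n0 where n0: "\<And>n. n \<ge> n0 \<Longrightarrow> norm (K n v - 0) < e / 4"
        using LIMSEQ_D[of "\<lambda>n. K n v" 0 "e/4"] v(1) e unfolding E_def by auto
      have pos: "e / (2 * 2 ^ n0) > 0" using e by simp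
      have vc: "v \<in> cont_funs X" using v(1) E_cont by auto
      obtain U where U: "openin T U" "g0 \<in> U" "\<forall>g\<in>U. norm (translate g v - translate g0 v) \<le> e / (2 * 2 ^ n0)"
        by (rule translate_norm_continuous[OF vc g0G pos])
      have "h g a \<in> M.mball (h g0 a) e" if g: "g \<in> U" for g
      proof -
        have gG: "g \<in> carrier G" using openin_subset[OF U(1)] g by auto
        have "K n (translate g0 v - translate g v) \<le> e / 2" for n
        proof (cases "n \<ge> n0")
          case True
          have "K n (translate g0 v - translate g v) \<le> K n (translate g0 v) + K n (- translate g v)"
            using K_triangle[of n "translate g0 v" "- translate g v"] by simp
          also have "\<dots> = 2 * K n v" using gG g0G by (simp add: K_minus K_translate)
          finally show ?thesis using n0[OF True] by simp
        next
          case False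
          have "K n (translate g0 v - translate g v) \<le> 2 ^ n * norm (translate g0 v - translate g v)" by (rule K_le_norm)
          also have "\<dots> \<le> 2 ^ n0 * (e / (2 * 2 ^ n0))"
            using False bspec[OF U(3) g] by (intro mult_mono power_increasing) (auto simp: norm_minus_commute)
          finally show ?thesis by simp
        qed
        then have "N (translate g0 v - translate g v) \<le> e / 2" by (rule N_le)
        then have "norm_dist V (h g0 a) (h g a) < e" using gG g0G v e by (simp add: norm_dist_V)
        then show ?thesis using gG g0G v unfolding M.in_mball by simp
      qed
      then show "\<exists>U. openin T U \<and> g0 \<in> U \<and> (\<forall>g\<in>U. h g a \<in> M.mball (h g0 a) e)" using U by blast
    qed
  qed
  define q where "q x = \<iota> (\<lambda>y. if y \<in> topspace X \<and> point_eval y = point_eval x then 1 else 0)" for x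
  have q_eq: "q x = q y \<longleftrightarrow> point_eval x = point_eval y" if "x \<in> topspace X" "y \<in> topspace X" for x y
  proof
    assume "q x = q y"
    then have "(\<lambda>z. if z \<in> topspace X \<and> point_eval z = point_eval x then 1 else 0::real) = (\<lambda>z. if z \<in> topspace X \<and> point_eval z = point_eval y then 1 else 0)"
      unfolding q_def by (rule injD[OF \<iota>])
    from fun_cong[OF this, of x] show "point_eval x = point_eval y" using that by (simp split: if_splits)
  qed (simp add: q_def)
  define Zs where "Zs = q ` topspace X"
  define r where "r z = (SOME x. x \<in> topspace X \<and> q x = z)" for z
  have r: "r z \<in> topspace X" "q (r z) = z" if "z \<in> Zs" for z
  proof -
    have "\<exists>x. x \<in> topspace X \<and> q x = z" using that by (auto simp: Zs_def)
    then have "r z \<in> topspace X \<and> q (r z) = z" unfolding r_def by (rule someI_ex)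
    then show "r z \<in> topspace X" "q (r z) = z" by auto
  qed
  have qZ: "q x \<in> Zs" if "x \<in> topspace X" for x using that by (simp add: Zs_def)
  define \<alpha> where "\<alpha> z = point_eval (r z)" for z
  have \<alpha>q: "\<alpha> (q x) = point_eval x" if "x \<in> topspace X" for x
    unfolding \<alpha>_def using q_eq[OF r(1)[OF qZ[OF that]] that] r(2)[OF qZ[OF that]] by simp
  have \<alpha>_inj: "inj_on \<alpha> Zs"
  proof (rule inj_onI)
    fix z z' assume z: "z \<in> Zs" "z' \<in> Zs" "\<alpha> z = \<alpha> z'"
    then have "q (r z) = q (r z')" using q_eq r(1) by (simp add: \<alpha>_def)
    then show "z = z'" using r(2) z by simp
  qed
  have \<alpha>_dual: "\<alpha> z \<in> dual V" for z unfolding \<alpha>_def by (rule point_eval_dual)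
  \<comment> \<open>With the weak-star topology pulled back along \<open>\<alpha>\<close>, the
    embedding holds by construction and continuity into \<open>Z\<close> can be tested on vectors of
    \<open>E\<close>.\<close>
  define Z where "Z = pullback_topology Zs \<alpha> (weak_star_topology V)"
  have topZ: "topspace Z = Zs"
    unfolding Z_def topspace_pullback_topology topspace_weak_star using \<alpha>_dual by auto
  have emb: "embedding_map Z (weak_star_topology V) \<alpha>"
    unfolding Z_def using \<alpha>_inj \<alpha>_dual by (intro embedding_map_pullback) (auto simp: topspace_weak_star)
  have cont_q: "continuous_map X Z q"
    unfolding Z_def
  proof (rule continuous_map_pullback')
    show "continuous_map X (weak_star_topology V) (\<alpha> \<circ> q)"
      by (rule continuous_map_eq[OF continuous_point_eval]) (simp add: \<alpha>q)
    show "topspace X \<subseteq> q -` Zs" using qZ by auto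
  qed
  define actZ where "actZ g = (\<lambda>z\<in>Zs. q (act g (r z)))" for g
  \<comment> \<open>The action descends to the factor because \<open>E\<close> is invariant: a value
    at \<open>act g x\<close> is the value of a translated vector at \<open>x\<close>.\<close>
  have act_point_eval: "point_eval (act g x) = point_eval (act g y)" if "point_eval x = point_eval y" "g \<in> carrier G" "x \<in> topspace X" "y \<in> topspace X" for g x y
    unfolding point_eval_eq_iff
  proof
    fix v assume v: "v \<in> E"
    have "fn (translate g v) x = fn (translate g v) y" using that(1,2) trE[OF that(2) v] unfolding point_eval_eq_iff by simp
    then show "fn v (act g x) = fn v (act g y)" using that(3,4) by (simp add: fn_translate)
  qed
  have actZ_q: "actZ g (q x) = q (act g x)" if "g \<in> carrier G" "x \<in> topspace X" for g x
  proof -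
    have "point_eval (r (q x)) = point_eval x" using \<alpha>q[OF that(2)] by (simp add: \<alpha>_def)
    then have "point_eval (act g (r (q x))) = point_eval (act g x)" using that r(1)[OF qZ[OF that(2)]] by (intro act_point_eval)
    then have "q (act g (r (q x))) = q (act g x)" by (simp add: q_def)
    then show ?thesis using qZ[OF that(2)] by (simp add: actZ_def)
  qed
  have actZ_in: "actZ g z \<in> Zs" if "g \<in> carrier G" "z \<in> Zs" for g z
    using that r(1)[OF that(2)] by (simp add: actZ_def qZ)
  have actZ_\<alpha>: "\<alpha> (actZ g z) (j v) = fn v (act g (r z))" if "g \<in> carrier G" "z \<in> Zs" "v \<in> E" for g z v
    using that r(1)[OF that(2)] by (simp add: actZ_def \<alpha>q)
  have \<alpha>_h: "\<alpha> (actZ g z) (j v) = \<alpha> z (h g (j v))" if "g \<in> carrier G" "z \<in> Zs" "v \<in> E" for g z v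
  proof -
    have "\<alpha> z (h g (j v)) = fn v (act g (r z))"
      using that r(1)[OF that(2)] by (simp add: \<alpha>_def fn_translate)
    then show ?thesis using actZ_\<alpha>[OF that] by simp
  qed
  have group_act: "group_action G Zs actZ"
  proof (rule group_actionI[OF group])
    have mult: "actZ (g \<otimes>\<^bsub>G\<^esub> k) z = actZ g (actZ k z)" if "g \<in> carrier G" "k \<in> carrier G" "z \<in> Zs" for g k z
    proof -
      obtain x where x: "x \<in> topspace X" "z = q x" using \<open>z \<in> Zs\<close> by (auto simp: Zs_def)
      show ?thesis using that x by (simp add: actZ_q act_mult)
    qed
    then show "actZ (g \<otimes>\<^bsub>G\<^esub> k) z = actZ g (actZ k z)" if "g \<in> carrier G" "k \<in> carrier G" "z \<in> Zs" for g k z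
      using that by simp
    fix g assume g: "g \<in> carrier G"
    have one: "actZ \<one>\<^bsub>G\<^esub> z = z" if "z \<in> Zs" for z
    proof -
      obtain x where x: "x \<in> topspace X" "z = q x" using \<open>z \<in> Zs\<close> by (auto simp: Zs_def)
      show ?thesis using x by (simp add: actZ_q)
    qed
    have "bij_betw (actZ g) Zs Zs"
    proof (rule bij_betw_byWitness[where f' = "actZ (inv\<^bsub>G\<^esub> g)"])
      show "\<forall>z\<in>Zs. actZ (inv\<^bsub>G\<^esub> g) (actZ g z) = z"
        using g one by (simp add: mult[symmetric] group.l_inv[OF group])
      show "\<forall>z\<in>Zs. actZ g (actZ (inv\<^bsub>G\<^esub> g) z) = z"
        using g one by (simp add: mult[symmetric] group.r_inv[OF group])
      show "actZ g ` Zs \<subseteq> Zs" "actZ (inv\<^bsub>G\<^esub> g) ` Zs \<subseteq> Zs" using g actZ_in by auto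
    qed
    then show "actZ g \<in> extensional Zs \<and> bij_betw (actZ g) Zs Zs" by (simp add: actZ_def)
  qed
  have list_eval_cont: "continuous_map Z euclideanreal (\<lambda>z. \<alpha> z (j v))" if "v \<in> E" for v
    using that by (intro continuous_map_weak_star_evaluation[OF embedding_map_continuous[OF emb]]) simp
  \<comment> \<open>The change in \<open>g\<close> is estimated in norm and so uniformly in
    \<open>z\<close>; the change in \<open>z\<close> is then measured on one fixed vector, where
    weak-star continuity suffices.\<close>
  have joint: "continuous_map (prod_topology T Z) Z (\<lambda>(g, z). actZ g z)"
  proof -
    have "continuous_map (prod_topology T Z) (weak_star_topology V) (\<alpha> \<circ> (\<lambda>(g, z). actZ g z))"
      unfolding weak_star_topology_def continuous_map_in_subtopology
    proof
      show "continuous_map (prod_topology T Z) (product_topology (\<lambda>_. euclideanreal) (carrier V)) (\<alpha> \<circ> (\<lambda>(g, z). actZ g z))"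
        unfolding continuous_map_componentwise
      proof (intro conjI ballI)
        show "(\<alpha> \<circ> (\<lambda>(g, z). actZ g z)) ` topspace (prod_topology T Z) \<subseteq> extensional (carrier V)"
          using \<alpha>_dual by (auto simp: dual_def)
        fix a assume "a \<in> carrier V"
        then obtain v where v: "v \<in> E" "a = j v" by auto
        have vc: "v \<in> cont_funs X" using v(1) E_cont by auto
        have "continuous_map (prod_topology T Z) euclideanreal (\<lambda>p. \<alpha> (actZ (fst p) (snd p)) (j v))"
          unfolding cont_fun_iff
        proof (intro ballI allI impI)
          fix p and e :: real assume p: "p \<in> topspace (prod_topology T Z)" and e: "e > 0"
          obtain g0 z0 where p0: "p = (g0, z0)" "g0 \<in> carrier G" "z0 \<in> Zs" using p topZ by auto
          have e2: "e / 2 > 0" using e by simp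
          obtain U where U: "openin T U" "g0 \<in> U" "\<forall>g\<in>U. norm (translate g v - translate g0 v) \<le> e / 2"
            by (rule translate_norm_continuous[OF vc p0(2) e2])
          have "\<exists>W. openin Z W \<and> z0 \<in> W \<and> (\<forall>z\<in>W. \<bar>\<alpha> z (j (translate g0 v)) - \<alpha> z0 (j (translate g0 v))\<bar> < e / 2)"
            using list_eval_cont[OF trE[OF p0(2) v(1)], unfolded cont_fun_iff topZ, rule_format, OF p0(3) e2] .
          then obtain W where W: "openin Z W" "z0 \<in> W"
            "\<forall>z\<in>W. \<bar>\<alpha> z (j (translate g0 v)) - \<alpha> z0 (j (translate g0 v))\<bar> < e / 2" by (elim exE conjE)
          have "\<bar>\<alpha> (actZ g z) (j v) - \<alpha> (actZ g0 z0) (j v)\<bar> < e" if gz: "g \<in> U" "z \<in> W" for g z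
          proof -
            have gG: "g \<in> carrier G" and zZ: "z \<in> Zs"
              using openin_subset[OF U(1)] openin_subset[OF W(1)] gz topZ by auto
            have "\<alpha> z (j (translate g v)) - \<alpha> z (j (translate g0 v)) = fn (translate g v - translate g0 v) (r z)"
              using gG p0(2) v(1) by (simp add: \<alpha>_def)
            then have "\<bar>\<alpha> z (j (translate g v)) - \<alpha> z (j (translate g0 v))\<bar> \<le> e / 2"
              using abs_fn_le[of "translate g v - translate g0 v" "r z"] bspec[OF U(3) gz(1)] by simp
            moreover have "\<bar>\<alpha> z (j (translate g0 v)) - \<alpha> z0 (j (translate g0 v))\<bar> < e / 2" using W(3) gz(2) by simp
            ultimately have "\<bar>\<alpha> z (j (translate g v)) - \<alpha> z0 (j (translate g0 v))\<bar> < e" by linarith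
            then show ?thesis using gG zZ p0 v(1) by (simp add: \<alpha>_h)
          qed
          then have "\<forall>p'\<in>U \<times> W. \<bar>\<alpha> (actZ (fst p') (snd p')) (j v) - \<alpha> (actZ (fst p) (snd p)) (j v)\<bar> < e"
            by (auto simp: p0(1))
          moreover have "openin (prod_topology T Z) (U \<times> W)" using U(1) W(1) by (simp add: openin_prod_Times_iff)
          moreover have "p \<in> U \<times> W" using U(2) W(2) by (simp add: p0(1))
          ultimately show "\<exists>O'. openin (prod_topology T Z) O' \<and> p \<in> O' \<and>
             (\<forall>p'\<in>O'. \<bar>\<alpha> (actZ (fst p') (snd p')) (j v) - \<alpha> (actZ (fst p) (snd p)) (j v)\<bar> < e)"
            by (intro exI[of _ "U \<times> W"] conjI)
        qed
        then show "continuous_map (prod_topology T Z) euclideanreal (\<lambda>p. (\<alpha> \<circ> (\<lambda>(g, z). actZ g z)) p a)"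
          by (simp add: v(2) o_def case_prod_beta)
      qed
      show "\<alpha> \<circ> (\<lambda>(g, z). actZ g z) \<in> topspace (prod_topology T Z) \<rightarrow> dual V" using \<alpha>_dual by auto
    qed
    moreover have "topspace (prod_topology T Z) \<subseteq> (\<lambda>(g, z). actZ g z) -` Zs"
      using actZ_in topZ by auto
    ultimately show ?thesis unfolding Z_def by (rule continuous_map_pullback')
  qed
  have "compactin Z (q ` topspace X)"
    using compact cont_q by (intro image_compactin) (simp_all add: compact_space_def)
  then have compZ: "compact_space Z" by (simp add: compact_space_def topZ Zs_def)
  have "Hausdorff_space (weak_star_topology V)"
    unfolding weak_star_topology_def by (intro Hausdorff_space_subtopology) (simp add: Hausdorff_space_product_topology)
  then have HausZ: "Hausdorff_space Z"
    by (rule Hausdorff_space_injective_preimage[OF _ embedding_map_continuous[OF emb]]) (simp add: topZ \<alpha>_inj)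
  have sys: "compact_G_system G T Z actZ"
    unfolding compact_G_system_def topZ using compZ HausZ group_act joint by simp
  have RN: "RN TYPE('u) G T Z actZ"
    unfolding RN_def
  proof (intro conjI sys exI)
    show "asplund_space V" by (rule asplund_V)
    show "cont_cohom G T V h" by (rule cohom)
    show "embedding_map Z (weak_star_topology V) \<alpha>" by (rule emb)
    show "\<forall>z\<in>topspace Z. dual_norm V (\<alpha> z) \<le> 1" by (simp add: \<alpha>_def point_eval_norm)
    show "\<forall>g\<in>carrier G. \<forall>z\<in>topspace Z. \<forall>a\<in>carrier V. \<alpha> (actZ g z) a = \<alpha> z (h g a)"
    proof (intro ballI)
      fix g z a assume "g \<in> carrier G" "z \<in> topspace Z" "a \<in> carrier V"
      moreover then obtain v where "v \<in> E" "a = j v" by auto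
      ultimately show "\<alpha> (actZ g z) a = \<alpha> z (h g a)" using \<alpha>_h topZ by simp
    qed
  qed
  have f0E: "f0 \<in> E"
  proof -
    have "translate \<one>\<^bsub>G\<^esub> f0 = f0" by (rule bfun_eqI) (simp add: fn_translate)
    then have "f0 \<in> translates f0" unfolding translates_def by (metis G_closed(1) imageI)
    then have "f0 \<in> hull_translates f0" unfolding hull_translates_def using hull_subset by fastforce
    then show ?thesis using W_subset_E by auto
  qed
  show ?thesis
  proof (rule that[OF RN cont_q])
    show "\<forall>g\<in>carrier G. \<forall>x\<in>topspace X. q (act g x) = actZ g (q x)" by (simp add: actZ_q)
    show "\<forall>x\<in>topspace X. \<forall>y\<in>topspace X. q x = q y \<longrightarrow> fn f0 x = fn f0 y"
      using q_eq point_eval_eq_iff f0E by simp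
  qed
qed

text \<open>The diagonal map into the product of the factors of all continuous functions of norm at
  most 1 is equivariant and continuous. It is injective since a Urysohn function separating two
  points is one of the indices, and compactness makes it an embedding with closed invariant
  image.\<close>

lemma Lindelof_imp_RN_app:
  fixes \<iota> :: "('x \<Rightarrow> real) \<Rightarrow> 'u"
  assumes L: Lindelof_countable and \<iota>: "inj \<iota>"
  shows "RN_app TYPE('u) G T X act"
proof -
  define A where "A = (if topspace X = {} then {} else {f. f \<in> cont_funs X \<and> norm f \<le> 1})"
  define P where "P f Z actZ q \<longleftrightarrow> RN TYPE('u) G T Z actZ \<and> continuous_map X Z q \<and>
    (\<forall>g\<in>carrier G. \<forall>x\<in>topspace X. q (act g x) = actZ g (q x)) \<and>
    (\<forall>x\<in>topspace X. \<forall>y\<in>topspace X. q x = q y \<longrightarrow> fn f x = fn f y)"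
    for f :: "'x bfun" and Z :: "'u topology" and actZ q
  define k where "k f = \<iota> (fn f)" for f :: "'x bfun"
  have k_inj: "k f = k g \<longleftrightarrow> f = g" for f g unfolding k_def using \<iota> bfun_eqI by (metis injD)
  have "\<exists>Z actZ q. P f Z actZ q" if f: "f \<in> A" for f
  proof -
    have f': "f \<in> cont_funs X" "norm f \<le> 1" "topspace X \<noteq> {}" using f by (auto simp: A_def split: if_splits)
    obtain Z :: "'u topology" and actZ q where "RN TYPE('u) G T Z actZ" "continuous_map X Z q"
      "\<forall>g\<in>carrier G. \<forall>x\<in>topspace X. q (act g x) = actZ g (q x)"
      "\<forall>x\<in>topspace X. \<forall>y\<in>topspace X. q x = q y \<longrightarrow> fn f x = fn f y"
      by (rule RN_factor[OF L f' \<iota>])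
    then have "P f Z actZ q" unfolding P_def by (intro conjI)
    then show ?thesis by (intro exI)
  qed
  then obtain Z actZ q where PA: "\<And>f. f \<in> A \<Longrightarrow> P f (Z f) (actZ f) (q f)" by metis
  define I where "I = k ` A"
  define kinv where "kinv i = (THE f. k f = i)" for i
  have kinv [simp]: "kinv (k f) = f" for f unfolding kinv_def using k_inj by simp
  define Xs where "Xs i = Z (kinv i)" for i
  define acts where "acts i = actZ (kinv i)" for i
  have Pi: "P (kinv i) (Xs i) (acts i) (q (kinv i))" if "i \<in> I" for i
    using that PA by (auto simp: I_def Xs_def acts_def)
  note Pd = Pi[unfolded P_def]
  define F where "F x = (\<lambda>i\<in>I. q (kinv i) x)" for x
  let ?prod = "product_topology Xs I"
  define S where "S = F ` topspace X"
  have RNi: "RN TYPE('u) G T (Xs i) (acts i)" if "i \<in> I" for i using conjunct1[OF Pd[OF that]] .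
  have F_cont: "continuous_map X ?prod F"
    unfolding continuous_map_componentwise
  proof (intro conjI ballI)
    show "F ` topspace X \<subseteq> extensional I" by (auto simp: F_def)
    show "continuous_map X (Xs i) (\<lambda>x. F x i)" if "i \<in> I" for i
      using conjunct1[OF conjunct2[OF Pd[OF that]]] that by (simp add: F_def)
  qed
  have "Hausdorff_space (Xs i)" if "i \<in> I" for i
    using RNi[OF that] by (simp add: RN_def compact_G_system_def)
  then have Haus: "Hausdorff_space ?prod" by (simp add: Hausdorff_space_product_topology)
  have "compactin ?prod S" unfolding S_def
    using compact F_cont by (intro image_compactin) (simp_all add: compact_space_def)
  then have S_closed: "closedin ?prod S" by (rule compactin_imp_closedin[OF Haus])
  have F_eq: "F (act g x) = product_action I acts g (F x)" if "g \<in> carrier G" "x \<in> topspace X" for g x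
    unfolding F_def product_action_def
    using conjunct1[OF conjunct2[OF conjunct2[OF Pd]]] that by (intro restrict_ext) simp
  have F_inj: "inj_on F (topspace X)"
  proof (rule inj_onI, rule ccontr)
    fix x y assume xy: "x \<in> topspace X" "y \<in> topspace X" "F x = F y" "x \<noteq> y"
    obtain f where f: "continuous_map X euclideanreal f" "f ` topspace X \<subseteq> {0..1::real}" "f x \<noteq> f y"
      by (rule continuous_functions_separate[OF compact Hausdorff xy(1,2,4)])
    define f0 where "f0 = bf (\<lambda>z. if z \<in> topspace X then f z else 0)"
    have ff: "fn f0 z = (if z \<in> topspace X then f z else 0)" for z
      unfolding f0_def by (rule fn_bf01) (use f(2) in \<open>auto simp: image_subset_iff\<close>)
    have "continuous_map X euclideanreal (fn f0)" by (rule continuous_map_eq[OF f(1)]) (simp add: ff)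
    then have "f0 \<in> cont_funs X" by (simp add: cont_funs_def ff)
    moreover have "norm f0 \<le> 1"
      by (rule norm_bfun_le) (use f(2) in \<open>auto simp: ff image_subset_iff\<close>)
    ultimately have fA: "f0 \<in> A" using xy(1) by (auto simp: A_def)
    then have i: "k f0 \<in> I" by (simp add: I_def)
    have "F x (k f0) = F y (k f0)" using xy(3) by simp
    then have "q f0 x = q f0 y" using i by (simp add: F_def)
    then have "fn f0 x = fn f0 y"
      using conjunct2[OF conjunct2[OF conjunct2[OF PA[OF fA, unfolded P_def]]]] xy(1,2) by blast
    then show False using f(3) xy(1,2) by (simp add: ff)
  qed
  have "homeomorphic_map X (subtopology ?prod S) F"
  proof (rule continuous_imp_homeomorphic_map[OF _ compact])
    show "continuous_map X (subtopology ?prod S) F"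
      using F_cont by (simp add: continuous_map_in_subtopology S_def)
    show "Hausdorff_space (subtopology ?prod S)" by (rule Hausdorff_space_subtopology[OF Haus])
    show "F ` topspace X = topspace (subtopology ?prod S)"
      using closedin_subset[OF S_closed] by (auto simp: S_def)
  qed (rule F_inj)
  then have "G_isomorphic G X act (subtopology ?prod S) (product_action I acts)"
    unfolding G_isomorphic_def using F_eq by (intro exI[of _ F]) simp
  moreover have "invariant G (product_action I acts) S"
    unfolding invariant_def
  proof (intro ballI)
    fix g s assume g: "g \<in> carrier G" and "s \<in> S"
    then obtain x where x: "x \<in> topspace X" "s = F x" by (auto simp: S_def)
    then show "product_action I acts g s \<in> S" using F_eq[OF g x(1)] g unfolding S_def
      by (intro image_eqI[of _ _ "act g x"]) simp_all
  qed
  ultimately show ?thesis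
    unfolding RN_app_def G_subsystem_def
    using RNi S_closed system by (intro conjI exI[of _ I] exI[of _ Xs] exI[of _ acts] exI[of _ S] ballI)
qed

end

theorem theorem9p9:
  fixes G :: "('g, 'b) monoid_scheme" and T :: "'g topology"
    and X :: "'x topology" and act :: "'g \<Rightarrow> 'x \<Rightarrow> 'x"
    and \<mu> :: "('x \<times> 'x) set set"
    and \<iota> :: "('x \<Rightarrow> real) \<Rightarrow> 'u"
  assumes "topological_group G T"
    and "compact_G_system G T X act"
    and "compatible_uniformity X \<mu>"
    and universe_large: "inj \<iota>"
  shows "(RN_app TYPE('u) G T X act \<longleftrightarrow> HNS G X \<mu> act) \<and>
    (HNS G X \<mu> act \<longleftrightarrow>
      fragmented_map X (uniform_convergence G T X \<mu>) (pi_sharp G act)) \<and>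
    (fragmented_map X (uniform_convergence G T X \<mu>) (pi_sharp G act) \<longleftrightarrow>
      fragmented_family X \<mu> (act ` carrier G)) \<and>
    (fragmented_family X \<mu> (act ` carrier G) \<longleftrightarrow>
      (\<forall>H. subgroup H G \<and> countable H \<longrightarrow>
         uniformly_Lindelof (topspace X) (subgroup_uniformity X \<mu> act H))) \<and>
    ((\<forall>H. subgroup H G \<and> countable H \<longrightarrow>
         uniformly_Lindelof (topspace X) (subgroup_uniformity X \<mu> act H)) \<longleftrightarrow>
      (\<forall>H. subgroup H G \<and>
           uniformly_Lindelof_group (G\<lparr>carrier := H\<rparr>) (subtopology T H) \<longrightarrow>
         uniformly_Lindelof (topspace X) (subgroup_uniformity X \<mu> act H)))"
proof -
  interpret compact_system G T X act \<mu> using assms by unfold_locales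
  have 1: "RN_app TYPE('u) G T X act \<longleftrightarrow> Lindelof_countable"
    using RN_app_imp_Lindelof Lindelof_imp_RN_app[OF _ universe_large] by (rule iffI)
  have 4: "fragmented_family X \<mu> (act ` carrier G) \<longleftrightarrow> Lindelof_countable"
    using fragmented_imp_Lindelof Lindelof_imp_fragmented by (rule iffI)
  show ?thesis
    unfolding Lindelof_countable_def[symmetric] Lindelof_countable_iff[symmetric]
      fragmented_map_iff_family HNS_iff_fragmented 1 4 by simp
qed

end
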